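(* Consider the system $\dot x=f(x)+g(x)u$ with running cost $r(x,u)=q(x)+u^TRu$, $R$ constant, as in the context. Let $r$, $d$ be positive integers as in the context and $\Omega\subset\mathbb{R}^n$ a compact set containing the origin as an interior point. Assume: (A2) there exists $V^{\rm o}\in\mathcal{P}$ such that $\mathcal{H}(V^{\rm o})=0$ on $\mathbb{R}^n$; let $u^{\rm o}=-\frac12R^{-1}g^T\nabla V^{\rm o}$; (A3) there exist $V_0:\mathbb{R}^n\to\mathbb{R}$ and $u_1:\mathbb{R}^n\to\mathbb{R}^m$ such that $V_0=p_0^T\vec m_{2,2r}(x)\in\mathbb{R}[x]_{2,2r}\cap\mathcal{P}$, $u_1=K_1\vec m_{1,d}(x)$ for a constant matrix $K_1$, and $\mathcal{L}(V_0,u_1)$ is SOS. Starting from $(V_0,u_1)$, generate $V_i=p_i^T\vec m_{2,2r}(x)$ and $u_{i+1}=K_{i+1}\vec m_{1,d}(x)$, $i=1,2,\dots$, as follows: form the data matrices $\Phi_i,\Xi_i,\Theta_i$ (defined in the context) along a solution of $\dot x=f(x)+g(x)(u_i(x)+e)$, and let $(p_i,K_{i+1})$ be an optimal solution $(p,K_p)$ of $$\min_{p,K_p}\ c^Tp\quad\text{s.t.}\quad \Phi_i\begin{bmatrix}l_p\\ \mathrm{vec}(K_p)\end{bmatrix}=\Xi_i+\Theta_ip,\quad l_p^T\vec m_{2,2d}(x)\text{ is SOS},\quad (p_{i-1}-p)^T\vec m_{2,2r}(x)\text{ is SOS},\qquad(\ast_i)$$ where $c=\int_\Omega\vec m_{2,2r}(x)\,dx$.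 Assume further: (A4) for each $i=1,2,\dots$ there exists an integer $q_{i0}$ such that $\mathrm{rank}(\Phi_i)=n_{2d}+mn_d$ whenever the number $q_i$ of data intervals satisfies $q_i\ge q_{i0}$; and $q_i\ge q_{i0}$ is used for every $i$. Then: 1) For each $i=1,2,\dots$, the optimization problem $(\ast_i)$ has a nonempty feasible set. 2) The sequences $\{V_i\}_{i=1}^\infty$ and $\{u_i\}_{i=1}^\infty$ satisfy: (a) for each $i\ge1$, the closed-loop system $\dot x=f(x)+g(x)u_i(x)$ is globally asymptotically stable at the origin; (b) for each $i\ge1$, $V_i\in\mathcal{P}$ and $V^{\rm o}(x_0)\le V_i(x_0)\le V_{i-1}(x_0)$ for all $x_0\in\mathbb{R}^n$; (c) there exists $V^*\in\mathbb{R}[x]_{2,2r}\cap\mathcal{P}$ such that $\lim_{i\to\infty}V_i(x_0)=V^*(x_0)$ for any $x_0\in\mathbb{R}^n$; (d) along the solutions $x(t)$ of $\dot x=f(x)+g(x)u^{\rm o}(x)$, $x(0)=x_0$, $$0\le V^*(x_0)-V^{\rm o}(x_0)\le-\int_0^\infty\mathcal{H}(V^*(x(t)))\,dt.$$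
   Context: Here $x\in\mathbb{R}^n$ is the state, $u\in\mathbb{R}^m$ the control, and $f:\mathbb{R}^n\to\mathbb{R}^n$, $g:\mathbb{R}^n\to\mathbb{R}^{n\times m}$ are polynomial mappings with $f(0)=0$. The function $q$ is a positive definite polynomial, and $R\in\mathbb{R}^{m\times m}$ is a constant symmetric positive definite matrix. (The integer $r$ and the running cost $r(x,u)$ are different objects, as are the function $q(x)$ and the integers $q_i$.) $\mathcal{P}$ is the set of continuously differentiable functions on $\mathbb{R}^n$ that are positive definite (zero at the origin, positive elsewhere) and proper (radially unbounded). $\nabla V$ is the gradient (a column vector). For $V\in\mathcal{C}^1$ and a control $u$, $$\mathcal{L}(V,u)=-\nabla V^T(x)\big(f(x)+g(x)u\big)-r(x,u),$$ $$\mathcal{H}(V)=\nabla V^T(x)f(x)+q(x)-\tfrac14\nabla V^T(x)g(x)R^{-1}g^T(x)\nabla V(x).$$ $\mathbb{R}[x]_{d_1,d_2}$ is the set of real polynomials in $x\in\mathbb{R}^n$ all of whose monomials have degree at least $d_1$ and at most $d_2$; $\vec m_{d_1,d_2}(x)$ is the column vector of all distinct monic monomials in $x$ of degree at least $d_1$ and at most $d_2$, in lexicographic order. "SOS" means: is a sum of squares of polynomials. $\deg$ of a vector or matrix of polynomials is the highest degree of its entries. $\mathrm{vec}$ stacks the columns of a matrix and $\otimes$ is the Kronecker product. The integer $d$ satisfies $$d\ge\tfrac12\max\{\deg(f)+2r-1,\ \deg(g)+2(2r-1),\ \deg(q),\ 2(2r-1)+2\deg(g)\}.$$ Let $n_d=\binom{n+d}{d}-1$,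 $n_{2d}=\binom{n+2d}{2d}-n-1$, $n_{2r}=\binom{n+2r}{2r}-n-1$ be the lengths of $\vec m_{1,d}$, $\vec m_{2,2d}$, $\vec m_{2,2r}$. In $(\ast_i)$ the unknowns are $p\in\mathbb{R}^{n_{2r}}$, $K_p\in\mathbb{R}^{m\times n_d}$ and the vector $l_p\in\mathbb{R}^{n_{2d}}$ tied to them by the linear equality constraint. Data: the exploration noise $e$ is a bounded time-varying $\mathbb{R}^m$-valued function. At step $i$, let $x(t)$ be a solution of $\dot x=f(x)+g(x)(u_i(x)+e)$ on $[t_{0,i},t_{q_i,i}]$, with sampling times $t_{0,i}<t_{1,i}<\dots<t_{q_i,i}$. Along this solution put $$\sigma_e=-\begin{bmatrix}\vec m_{2,2d}^T(x)& 2\,\vec m_{1,d}^T(x)\otimes e^TR\end{bmatrix}^T\in\mathbb{R}^{n_{2d}+mn_d},$$ $$\Phi_i=\begin{bmatrix}\int_{t_{0,i}}^{t_{1,i}}\sigma_e\,dt&\cdots&\int_{t_{q_i-1,i}}^{t_{q_i,i}}\sigma_e\,dt\end{bmatrix}^T\in\mathbb{R}^{q_i\times(n_{2d}+mn_d)},$$ $$\Xi_i=\begin{bmatrix}\int_{t_{0,i}}^{t_{1,i}}r(x,u_i)\,dt&\cdots&\int_{t_{q_i-1,i}}^{t_{q_i,i}}r(x,u_i)\,dt\end{bmatrix}^T\in\mathbb{R}^{q_i},$$ $$\Theta_i=\begin{bmatrix}\vec m_{2,2r}\big|_{t_{0,i}}^{t_{1,i}}&\cdots&\vec m_{2,2r}\big|_{t_{q_i-1,i}}^{t_{q_i,i}}\end{bmatrix}^T\in\mathbb{R}^{q_i\times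 n_{2r}},$$ where $\vec m_{2,2r}|_{s}^{t}=\vec m_{2,2r}(x(t))-\vec m_{2,2r}(x(s))$. It is understood that an optimal solution is selected at each step. *)

theory Defs
  imports
    "HOL-Analysis.Analysis"
    "HOL-Library.List_Lexorder"
    "Jordan_Normal_Form.DL_Rank"
begin

no_notation Matrix.vec_index (infixl \<open>$\<close> 100)
no_notation Matrix.scalar_prod (infix \<open>\<bullet>\<close> 70)
unbundle inner_syntax

text \<open>
  States and controls live in \<^typ>\<open>real^'n\<close> and \<^typ>\<open>real^'m\<close>.  Vectors and matrices whose
  size depends on the degrees are those of \<^theory>\<open>Jordan_Normal_Form.Matrix\<close>.  The linear order
  on the index types numbers the coordinates, so that the two kinds of vectors can be converted.
\<close>

definition coord :: "nat \<Rightarrow> 'n::{finite,linorder}" where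
  "coord k = sorted_list_of_set UNIV ! k"

definition to_vec :: "real^'n::{finite,linorder} \<Rightarrow> real Matrix.vec" where
  "to_vec x = Matrix.vec CARD('n) (\<lambda>k. x $ coord k)"

definition of_vec :: "real Matrix.vec \<Rightarrow> real^'n::{finite,linorder}" where
  "of_vec v = (\<chi> i. vec_index v (card {j. j < i}))"

lemma coord_card_less: "coord (card {j. j < i}) = (i :: 'n::{finite,linorder})"
proof -
  let ?xs = "sorted_list_of_set (UNIV :: 'n set)"
  have strict: "sorted_wrt (<) ?xs"
    by (rule strict_sorted_list_of_set)
  have "i \<in> set ?xs"
    by simp
  then obtain k where k: "k < length ?xs" "?xs ! k = i"
    unfolding in_set_conv_nth by blast
  have "{j. j < i} = (!) ?xs ` {..<k}"
  proof (intro equalityI subsetI)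
    fix j assume j: "j \<in> {j. j < i}"
    have "j \<in> set ?xs"
      by simp
    then obtain l where l: "l < length ?xs" "?xs ! l = j"
      unfolding in_set_conv_nth by blast
    have "l < k"
    proof (rule ccontr)
      assume "\<not> l < k"
      then have "k = l \<or> k < l" by auto
      then have "i \<le> j"
        using strict k l by (auto simp: sorted_wrt_iff_nth_less less_imp_le)
      then show False using j by auto
    qed
    then show "j \<in> (!) ?xs ` {..<k}" using l by auto
  next
    fix j assume "j \<in> (!) ?xs ` {..<k}"
    then show "j \<in> {j. j < i}"
      using strict k by (auto simp: sorted_wrt_iff_nth_less)
  qed
  moreover have "inj_on ((!) ?xs) {..<k}"
    using k(1) by (intro inj_on_nth) auto
  ultimately have "card {j. j < i} = k"
    by (simp add: card_image)
  then show ?thesis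
    using k by (simp add: coord_def)
qed

lemma of_vec_to_vec: "of_vec (to_vec x) = x"
proof -
  have "card {j. j < i} < CARD('a)" for i :: "'a::{finite,linorder}"
    by (rule psubset_card_mono) auto
  then show ?thesis
    by (simp add: of_vec_def to_vec_def coord_card_less vec_eq_iff)
qed

definition exponents :: "nat \<Rightarrow> nat \<Rightarrow> nat \<Rightarrow> nat list set" where
  "exponents n d1 d2 = {\<alpha>. length \<alpha> = n \<and> d1 \<le> sum_list \<alpha> \<and> sum_list \<alpha> \<le> d2}"

definition monomial :: "nat list \<Rightarrow> real^'n::{finite,linorder} \<Rightarrow> real" where
  "monomial \<alpha> x = (\<Prod>k<length \<alpha>. (x $ coord k) ^ (\<alpha> ! k))"

text \<open>Larger exponents come first, i.e. the order is lexicographic with \<open>x\<^sub>1 > x\<^sub>2 > \<dots>\<close>.\<close>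

definition monomials :: "nat \<Rightarrow> nat \<Rightarrow> real^'n::{finite,linorder} \<Rightarrow> real Matrix.vec" where
  "monomials d1 d2 x =
     vec_of_list (map (\<lambda>\<alpha>. monomial \<alpha> x) (rev (sorted_list_of_set (exponents CARD('n) d1 d2))))"

definition num_monomials1 :: "nat \<Rightarrow> nat \<Rightarrow> nat" where
  "num_monomials1 n d = ((n + d) choose d) - 1"

definition num_monomials2 :: "nat \<Rightarrow> nat \<Rightarrow> nat" where
  "num_monomials2 n d = ((n + d) choose d) - n - 1"

lemma finite_exponents: "finite (exponents n d1 d2)"
proof (rule finite_subset)
  show "exponents n d1 d2 \<subseteq> {\<alpha>. set \<alpha> \<subseteq> {..d2} \<and> length \<alpha> = n}"
    using member_le_sum_list by (fastforce simp: exponents_def)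
  show "finite {\<alpha>. set \<alpha> \<subseteq> {..d2} \<and> length \<alpha> = n}"
    by (rule finite_lists_length_eq) simp
qed

lemma card_exponents_eq: "card (exponents n k k) = (n + k - 1) choose k"
proof -
  have "exponents n k k = {\<alpha>. length \<alpha> = n \<and> sum_list \<alpha> = k}"
    by (auto simp: exponents_def)
  then show ?thesis
    by (simp add: card_length_sum_list add.commute)
qed

lemma card_exponents:
  assumes "n \<ge> 1"
  shows "card (exponents n 0 d) = (n + d) choose d"
proof (induction d)
  case 0
  show ?case using card_exponents_eq[of n 0] by simp
next
  case (Suc d)
  have "exponents n 0 (Suc d) = exponents n 0 d \<union> exponents n (Suc d) (Suc d)"
    "exponents n 0 d \<inter> exponents n (Suc d) (Suc d) = {}"
    by (auto simp: exponents_def)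
  then have "card (exponents n 0 (Suc d)) = card (exponents n 0 d) + card (exponents n (Suc d) (Suc d))"
    by (simp add: card_Un_disjoint finite_exponents)
  then show ?case
    using Suc card_exponents_eq[of n "Suc d"] by simp
qed

lemma card_exponents_diff:
  assumes "d1 \<le> Suc d2"
  shows "card (exponents n 0 d2) =
    card (exponents n d1 d2) + (\<Sum>k<d1. card (exponents n k k))"
  using assms
proof (induction d1)
  case 0
  show ?case by simp
next
  case (Suc d1)
  have "exponents n d1 d2 = exponents n d1 d1 \<union> exponents n (Suc d1) d2"
    "exponents n d1 d1 \<inter> exponents n (Suc d1) d2 = {}"
    using Suc.prems by (auto simp: exponents_def)
  then have "card (exponents n d1 d2) = card (exponents n d1 d1) + card (exponents n (Suc d1) d2)"
    by (simp add: card_Un_disjoint finite_exponents)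
  then show ?case using Suc by simp
qed

lemma dim_monomials1:
  "dim_vec (monomials 1 d (x :: real^'n::{finite,linorder})) = num_monomials1 CARD('n) d"
proof -
  have "CARD('n) \<ge> 1"
    by (simp add: Suc_leI)
  then show ?thesis
    using card_exponents_diff[of 1 d "CARD('n)"] card_exponents[of "CARD('n)" d]
      card_exponents_eq[of "CARD('n)" 0]
    by (simp add: monomials_def num_monomials1_def)
qed

lemma dim_monomials2:
  assumes "d \<ge> 1"
  shows "dim_vec (monomials 2 d (x :: real^'n::{finite,linorder})) = num_monomials2 CARD('n) d"
proof -
  have "CARD('n) \<ge> 1"
    by (simp add: Suc_leI)
  then show ?thesis
    using assms card_exponents_diff[of 2 d "CARD('n)"] card_exponents[of "CARD('n)" d]
      card_exponents_eq[of "CARD('n)" 0] card_exponents_eq[of "CARD('n)" 1]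
    by (simp add: monomials_def num_monomials2_def numeral_2_eq_2)
qed

text \<open>
  Real polynomials in \<open>n\<close> variables are identified with the functions they induce, which is
  harmless over an infinite field.  The zero polynomial gets degree 0.
\<close>

definition poly_space :: "nat \<Rightarrow> nat \<Rightarrow> (real^'n::{finite,linorder} \<Rightarrow> real) set" where
  "poly_space d1 d2 =
     {p. \<exists>a. p = (\<lambda>x. \<Sum>\<alpha>\<in>exponents CARD('n) d1 d2. a \<alpha> * monomial \<alpha> x)}"

definition is_polynomial :: "(real^'n::{finite,linorder} \<Rightarrow> real) \<Rightarrow> bool" where
  "is_polynomial p \<longleftrightarrow> (\<exists>d. p \<in> poly_space 0 d)"

definition poly_degree :: "(real^'n::{finite,linorder} \<Rightarrow> real) \<Rightarrow> nat" where
  "poly_degree p = (LEAST d. p \<in> poly_space 0 d)"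

definition degree_vec :: "(real^'n::{finite,linorder} \<Rightarrow> real^'k) \<Rightarrow> nat" where
  "degree_vec h = Max (range (\<lambda>i. poly_degree (\<lambda>x. h x $ i)))"

definition degree_mat :: "(real^'n::{finite,linorder} \<Rightarrow> real^'l^'k) \<Rightarrow> nat" where
  "degree_mat h = Max (range (\<lambda>(i, j). poly_degree (\<lambda>x. h x $ i $ j)))"

definition SOS :: "(real^'n::{finite,linorder} \<Rightarrow> real) \<Rightarrow> bool" where
  "SOS p \<longleftrightarrow> (\<exists>hs. (\<forall>h\<in>set hs. is_polynomial h) \<and> p = (\<lambda>x. \<Sum>h\<leftarrow>hs. (h x)\<^sup>2))"

definition positive_definite_fun :: "(real^'n \<Rightarrow> real) \<Rightarrow> bool" where
  "positive_definite_fun V \<longleftrightarrow> V 0 = 0 \<and> (\<forall>x. x \<noteq> 0 \<longrightarrow> V x > 0)"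

definition positive_definite_mat :: "real^'m^'m \<Rightarrow> bool" where
  "positive_definite_mat R \<longleftrightarrow> (\<forall>u. u \<noteq> 0 \<longrightarrow> u \<bullet> (R *v u) > 0)"

definition grad :: "(real^'n \<Rightarrow> real) \<Rightarrow> real^'n \<Rightarrow> real^'n" where
  "grad V x = (THE D. GDERIV V x :> D)"

definition class_P :: "(real^'n \<Rightarrow> real) set" where
  "class_P = {V. (\<forall>x. V differentiable (at x)) \<and> continuous_on UNIV (grad V) \<and>
     positive_definite_fun V \<and> filterlim V at_top at_infinity}"

definition running_cost :: "(real^'n \<Rightarrow> real) \<Rightarrow> real^'m^'m \<Rightarrow> real^'n \<Rightarrow> real^'m \<Rightarrow> real" where
  "running_cost q R x u = q x + u \<bullet> (R *v u)"

definition L_op :: "(real^'n \<Rightarrow> real^'n) \<Rightarrow> (real^'n \<Rightarrow> real^'m^'n) \<Rightarrow> (real^'n \<Rightarrow> real) \<Rightarrow>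
    real^'m^'m \<Rightarrow> (real^'n \<Rightarrow> real) \<Rightarrow> (real^'n \<Rightarrow> real^'m) \<Rightarrow> real^'n \<Rightarrow> real" where
  "L_op f g q R V u x =
     - (grad V x \<bullet> (f x + g x *v u x)) - running_cost q R x (u x)"

definition H_op :: "(real^'n \<Rightarrow> real^'n) \<Rightarrow> (real^'n \<Rightarrow> real^'m^'n) \<Rightarrow> (real^'n \<Rightarrow> real) \<Rightarrow>
    real^'m^'m \<Rightarrow> (real^'n \<Rightarrow> real) \<Rightarrow> real^'n \<Rightarrow> real" where
  "H_op f g q R V x = grad V x \<bullet> f x + q x
     - 1/4 * (grad V x \<bullet> (g x *v (matrix_inv R *v (transpose (g x) *v grad V x))))"

definition solution :: "(real^'n \<Rightarrow> real^'n) \<Rightarrow> (real \<Rightarrow> real^'n) \<Rightarrow> bool" where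
  "solution F x \<longleftrightarrow> (\<forall>t\<ge>0. (x has_vector_derivative F (x t)) (at t within {0..}))"

text \<open>
  Existence of a solution on \<open>[0, \<infinity>)\<close> for every initial state is part of the definition, so that
  stability and attractivity are not vacuous.
\<close>

definition globally_asymptotically_stable :: "(real^'n \<Rightarrow> real^'n) \<Rightarrow> bool" where
  "globally_asymptotically_stable F \<longleftrightarrow>
     (\<forall>x0. \<exists>x. solution F x \<and> x 0 = x0) \<and>
     (\<forall>\<epsilon>>0. \<exists>\<delta>>0. \<forall>x. solution F x \<and> norm (x 0) < \<delta> \<longrightarrow> (\<forall>t\<ge>0. norm (x t) < \<epsilon>)) \<and>
     (\<forall>x. solution F x \<longrightarrow> (x \<longlongrightarrow> 0) at_top)"

text \<open>
  Solutions in the sense of Caratheodory, for right-hand sides that are only measurable in time;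
  by the fundamental theorem of calculus every classical solution is one.
\<close>

definition caratheodory_solution ::
    "(real \<Rightarrow> real^'n \<Rightarrow> real^'n) \<Rightarrow> (real \<Rightarrow> real^'n) \<Rightarrow> real \<Rightarrow> real \<Rightarrow> bool" where
  "caratheodory_solution F x a b \<longleftrightarrow> continuous_on {a..b} x \<and>
     (\<forall>t\<in>{a..b}. ((\<lambda>s. F s (x s)) has_integral (x t - x a)) {a..t})"

text \<open>The improper integral over \<open>[0, \<infinity>)\<close>, which may be infinite.\<close>

definition has_improper_integral :: "(real \<Rightarrow> real) \<Rightarrow> ereal \<Rightarrow> bool" where
  "has_improper_integral h I \<longleftrightarrow> (\<forall>T\<ge>0. h integrable_on {0..T}) \<and>
     ((\<lambda>T. ereal (integral {0..T} h)) \<longlongrightarrow> I) at_top"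

definition value_poly :: "nat \<Rightarrow> real Matrix.vec \<Rightarrow> real^'n::{finite,linorder} \<Rightarrow> real" where
  "value_poly r p x = scalar_prod p (monomials 2 (2*r) x)"

definition feedback :: "nat \<Rightarrow> real mat \<Rightarrow>
    real^'n::{finite,linorder} \<Rightarrow> real^'m::{finite,linorder}" where
  "feedback d K x = of_vec (K *\<^sub>v monomials 1 d x)"

definition stack_columns :: "real mat \<Rightarrow> real Matrix.vec" where
  "stack_columns K = Matrix.vec (dim_row K * dim_col K)
     (\<lambda>k. K $$ (k mod dim_row K, k div dim_row K))"

text \<open>Kronecker product of two row vectors.\<close>

definition kronecker_vec :: "real Matrix.vec \<Rightarrow> real Matrix.vec \<Rightarrow> real Matrix.vec" where
  "kronecker_vec v w = Matrix.vec (dim_vec v * dim_vec w)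
     (\<lambda>k. vec_index v (k div dim_vec w) * vec_index w (k mod dim_vec w))"

definition sigma_e :: "real^'m::_^'m::{finite,linorder} \<Rightarrow> nat \<Rightarrow> real^'n::{finite,linorder} \<Rightarrow>
    real^'m::_ \<Rightarrow> real Matrix.vec" where
  "sigma_e R d x e =
     - (monomials 2 (2*d) x @\<^sub>v (2 \<cdot>\<^sub>v kronecker_vec (monomials 1 d x) (to_vec (e v* R))))"

text \<open>In the data matrices, \<open>\<tau> 0 < \<dots> < \<tau> N\<close> are the sampling times and \<open>x\<close> is the trajectory.\<close>

definition Phi :: "real^'m::_^'m::{finite,linorder} \<Rightarrow> nat \<Rightarrow> (real \<Rightarrow> real^'m::_) \<Rightarrow>
    (real \<Rightarrow> real^'n::{finite,linorder}) \<Rightarrow> (nat \<Rightarrow> real) \<Rightarrow> nat \<Rightarrow> real mat" where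
  "Phi R d e x \<tau> N =
     Matrix.mat N (num_monomials2 CARD('n) (2*d) + CARD('m) * num_monomials1 CARD('n) d)
       (\<lambda>(j, k). integral {\<tau> j..\<tau> (Suc j)} (\<lambda>t. vec_index (sigma_e R d (x t) (e t)) k))"

definition Xi :: "(real^'n \<Rightarrow> real) \<Rightarrow> real^'m^'m \<Rightarrow> (real^'n \<Rightarrow> real^'m) \<Rightarrow>
    (real \<Rightarrow> real^'n) \<Rightarrow> (nat \<Rightarrow> real) \<Rightarrow> nat \<Rightarrow> real Matrix.vec" where
  "Xi q R u x \<tau> N = Matrix.vec N
     (\<lambda>j. integral {\<tau> j..\<tau> (Suc j)} (\<lambda>t. running_cost q R (x t) (u (x t))))"

definition Theta :: "nat \<Rightarrow> (real \<Rightarrow> real^'n::{finite,linorder}) \<Rightarrow> (nat \<Rightarrow> real) \<Rightarrow> nat \<Rightarrow> real mat"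
  where
  "Theta r x \<tau> N = Matrix.mat N (num_monomials2 CARD('n) (2*r))
     (\<lambda>(j, k). vec_index (monomials 2 (2*r) (x (\<tau> (Suc j)))) k
             - vec_index (monomials 2 (2*r) (x (\<tau> j))) k)"

definition sampled_data :: "(real^'n \<Rightarrow> real^'n) \<Rightarrow> (real^'n \<Rightarrow> real^'m^'n) \<Rightarrow>
    (real \<Rightarrow> real^'m) \<Rightarrow> (real^'n \<Rightarrow> real^'m) \<Rightarrow>
    (real \<Rightarrow> real^'n) \<Rightarrow> (nat \<Rightarrow> real) \<Rightarrow> nat \<Rightarrow> bool" where
  "sampled_data f g e u x \<tau> N \<longleftrightarrow> (\<forall>k<N. \<tau> k < \<tau> (Suc k)) \<and>
     caratheodory_solution (\<lambda>t y. f y + g y *v (u y + e t)) x (\<tau> 0) (\<tau> N)"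

text \<open>
  Here the data are a family indexed by the number of data intervals: \<open>x N\<close> and \<open>\<tau> N\<close> are
  the trajectory and the sampling times when \<open>N\<close> intervals are used.
\<close>

definition rank_condition :: "real^'m::_^'m::{finite,linorder} \<Rightarrow> nat \<Rightarrow> (real \<Rightarrow> real^'m::_) \<Rightarrow>
    (nat \<Rightarrow> real \<Rightarrow> real^'n::{finite,linorder}) \<Rightarrow> (nat \<Rightarrow> nat \<Rightarrow> real) \<Rightarrow> nat \<Rightarrow> bool" where
  "rank_condition R d e x \<tau> N0 \<longleftrightarrow> (\<forall>N\<ge>N0. vec_space.rank N (Phi R d e (x N) (\<tau> N) N) =
     num_monomials2 CARD('n) (2*d) + CARD('m) * num_monomials1 CARD('n) d)"

text \<open>The last component of a feasible triple is the vector \<open>l\<^sub>p\<close>.\<close>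

definition feasible_set :: "(real^'n::{finite,linorder} \<Rightarrow> real) \<Rightarrow>
    real^'m::_^'m::{finite,linorder} \<Rightarrow> nat \<Rightarrow> nat \<Rightarrow> (real \<Rightarrow> real^'m::_) \<Rightarrow> (real^'n::_ \<Rightarrow> real^'m::_) \<Rightarrow>
    (real \<Rightarrow> real^'n::_) \<Rightarrow> (nat \<Rightarrow> real) \<Rightarrow> nat \<Rightarrow> real Matrix.vec \<Rightarrow>
    (real Matrix.vec \<times> real mat \<times> real Matrix.vec) set" where
  "feasible_set q R r d e u x \<tau> N p_prev = {(p, K, l).
     p \<in> carrier_vec (num_monomials2 CARD('n) (2*r)) \<and>
     K \<in> carrier_mat CARD('m) (num_monomials1 CARD('n) d) \<and>
     l \<in> carrier_vec (num_monomials2 CARD('n) (2*d)) \<and>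
     Phi R d e x \<tau> N *\<^sub>v (l @\<^sub>v stack_columns K) = Xi q R u x \<tau> N + Theta r x \<tau> N *\<^sub>v p \<and>
     SOS (\<lambda>y :: real^'n::_. scalar_prod l (monomials 2 (2*d) y)) \<and>
     SOS (\<lambda>y :: real^'n::_. scalar_prod (p_prev - p) (monomials 2 (2*r) y))}"

definition cost_vec :: "(real^'n::{finite,linorder}) set \<Rightarrow> nat \<Rightarrow> real Matrix.vec" where
  "cost_vec \<Omega> r = Matrix.vec (num_monomials2 CARD('n) (2*r))
     (\<lambda>k. integral \<Omega> (\<lambda>x. vec_index (monomials 2 (2*r) x) k))"

definition optimal_solution :: "(real^'n::{finite,linorder}) set \<Rightarrow> (real^'n::_ \<Rightarrow> real) \<Rightarrow>
    real^'m::_^'m::{finite,linorder} \<Rightarrow> nat \<Rightarrow> nat \<Rightarrow> (real \<Rightarrow> real^'m::_) \<Rightarrow> (real^'n::_ \<Rightarrow> real^'m::_) \<Rightarrow>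
    (real \<Rightarrow> real^'n::_) \<Rightarrow> (nat \<Rightarrow> real) \<Rightarrow> nat \<Rightarrow> real Matrix.vec \<Rightarrow>
    real Matrix.vec \<Rightarrow> real mat \<Rightarrow> bool" where
  "optimal_solution \<Omega> q R r d e u x \<tau> N p_prev p K \<longleftrightarrow>
     (\<exists>l. (p, K, l) \<in> feasible_set q R r d e u x \<tau> N p_prev) \<and>
     (\<forall>(p', K', l') \<in> feasible_set q R r d e u x \<tau> N p_prev.
        scalar_prod (cost_vec \<Omega> r) p \<le> scalar_prod (cost_vec \<Omega> r) p')"

end

theory Submission
  imports Defs
begin

text \<open>
  Write \<open>u' = - R\<^sup>-\<^sup>1 g\<^sup>T \<nabla>V / 2\<close> for the control that is greedy for \<open>V\<close>.  Completing the square gives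
  \<open>L(V, u) = - H(V) - (u - u')\<^sup>T R (u - u')\<close> for every control \<open>u\<close>.

  Along any sampled trajectory, the fundamental theorem of calculus applied to \<open>V = p\<^sup>T m\<close> shows that
  the coefficients of \<open>L(V, u\<^sub>i)\<close> and of \<open>u'\<close> solve the linear data equation.  By the rank condition
  they are its only solution for the given \<open>p\<close>, so a feasible triple consists of some \<open>V\<^sub>i\<close> with \<open>L(V\<^sub>i, u\<^sub>i)\<close> SOS
  and of its greedy control \<open>u\<^sub>i\<^sub>+\<^sub>1\<close>.  By the identity above, \<open>L(V\<^sub>i, u\<^sub>i\<^sub>+\<^sub>1)\<close> is SOS as well, whence
  \<open>p\<^sub>i\<close> is feasible in the next step and \<open>V\<^sub>i\<close> is a Lyapunov function for \<open>u\<^sub>i\<^sub>+\<^sub>1\<close>.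

  Since \<open>H(V\<^sub>o) = 0\<close>, the difference \<open>V\<^sub>i - V\<^sub>o\<close> decreases to \<open>0\<close> along the closed loop of \<open>u\<^sub>i\<close>, so
  \<open>V\<^sub>o \<le> V\<^sub>i\<close>.  The decreasing sequence \<open>V\<^sub>i\<close> lives in a finite-dimensional space of polynomials; hence its
  pointwise limit is a polynomial, the gradients converge too, and \<open>H(V\<^sup>*) \<le> 0\<close>.  The last estimate comes
  from integrating \<open>d/dt (V\<^sup>* - V\<^sub>o) \<ge> H(V\<^sup>*)\<close> along the optimal closed loop.
\<close>

subsection \<open>Pointwise limits in finite-dimensional spaces of functions\<close>

text \<open>The obstacle is positivity: that \<open>L(V\<^sub>i, u\<^sub>i)\<close> is SOS makes
  \<open>V\<^sub>i\<close> decrease along the loop of \<open>u\<^sub>i\<close>, but does not by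
  itself say that \<open>V\<^sub>i\<close> is positive or proper. Each stage therefore leans on its
  predecessor, which lies in \<open>class_P\<close> and stabilises the loop of
  \<open>u\<^sub>i\<close>; stability yields \<open>V\<^sub>o \<le> V\<^sub>i\<close>, and
  positivity and properness of \<open>V\<^sub>i\<close> are inherited from \<open>V\<^sub>o\<close>.
  Stability includes existence for all time, although polynomial fields are only locally Lipschitz;
  the Lyapunov function excludes blow-up. The noise is only bounded and measurable, so trajectories
  are indefinite integrals, and the chain rule must hold for these. Gradients of value functions
  have degrees 1 to \<open>2*r - 1\<close>. The bound on \<open>d\<close> makes greedy controls fit
  into degrees 1 to \<open>d\<close>, and \<open>L\<close> into degrees 2 to \<open>2*d\<close>;
  \<open>q\<close> has no linear part because it is minimal at 0. The SOS property passes from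
  \<open>u\<^sub>i\<close> to \<open>u\<^sub>i\<^sub>+\<^sub>1\<close> because the form of
  \<open>R\<close> is a sum of squares of linear forms with constant coefficients.\<close>

text \<open>The \<open>b i\<close> may be linearly dependent, so the coefficients themselves need
  not converge. Hence the second assumption: linear relations among the \<open>b i\<close> pass to
  the \<open>c i\<close>, so a combination of the \<open>c i\<close> depends only on the function
  that the same coefficients give with the \<open>b i\<close>. In the application the
  \<open>b i\<close> are monomials and the \<open>c i\<close> their partial derivatives.\<close>

lemma finite_span_pointwise_limit:
  fixes b :: "'i \<Rightarrow> 'a \<Rightarrow> real" and c :: "'i \<Rightarrow> 'c \<Rightarrow> real"
  assumes "finite A"
    and "\<And>a z. (\<And>y. (\<Sum>i\<in>A. a i * b i y) = 0) \<Longrightarrow> (\<Sum>i\<in>A. a i * c i z) = 0"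
    and "\<And>y. (\<lambda>k. \<Sum>i\<in>A. a k i * b i y) \<longlonglongrightarrow> h y"
  shows "\<exists>s. h = (\<lambda>y. \<Sum>i\<in>A. s i * b i y) \<and>
    (\<forall>z. (\<lambda>k. \<Sum>i\<in>A. a k i * c i z) \<longlonglongrightarrow> (\<Sum>i\<in>A. s i * c i z))"
  using assms
proof (induction A arbitrary: a h rule: finite_induct)
  case empty
  then have "h y = 0" for y
    using LIMSEQ_unique[of "\<lambda>k. 0"] by fastforce
  then show ?case by auto
next
  case (insert j A a h)
  have split: "(\<Sum>i\<in>insert j A. u i * w i) = u j * w j + (\<Sum>i\<in>A. u i * w i)"
    for u w :: "'i \<Rightarrow> real"
    using insert.hyps by simp
  have upd: "(\<Sum>i\<in>A. (u(j := v)) i * w i) = (\<Sum>i\<in>A. u i * w i)" for u w :: "'i \<Rightarrow> real" and v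
    using insert.hyps by (intro sum.cong) auto
  have lin: "(\<Sum>i\<in>A. u i * c i z) = 0" if "\<And>y. (\<Sum>i\<in>A. u i * b i y) = 0" for u z
    using insert.prems(1)[of "u(j := 0)" z] that
    by (simp add: split upd fun_upd_same del: fun_upd_apply)
  show ?case
  proof (cases "\<exists>s. b j = (\<lambda>y. \<Sum>i\<in>A. s i * b i y)")
    case True
    then obtain s where s: "b j y = (\<Sum>i\<in>A. s i * b i y)" for y by metis
    have cj: "c j z = (\<Sum>i\<in>A. s i * c i z)" for z
      using insert.prems(1)[of "s(j := - 1)" z] by (simp add: split upd s fun_upd_same del: fun_upd_apply)
    \<comment> \<open>A dependent \<open>b j\<close> is eliminated by spreading its coefficient over
      the others; by \<open>cj\<close> the same redistribution is correct for
      \<open>c\<close>.\<close>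
    define a' where "a' k i = a k i + a k j * s i" for k i
    have a': "(\<Sum>i\<in>insert j A. a k i * w i) = (\<Sum>i\<in>A. a' k i * w i)"
      if "w j = (\<Sum>i\<in>A. s i * w i)" for w k
      by (simp add: split that a'_def distrib_right sum.distrib sum_distrib_left mult.assoc)
    have lim: "(\<lambda>k. \<Sum>i\<in>A. a' k i * b i y) \<longlonglongrightarrow> h y" for y
      using insert.prems(2)[of y] by (simp add: a'[of "\<lambda>i. b i y"] s)
    obtain s' where s': "h = (\<lambda>y. \<Sum>i\<in>A. s' i * b i y)"
      "\<And>z. (\<lambda>k. \<Sum>i\<in>A. a' k i * c i z) \<longlonglongrightarrow> (\<Sum>i\<in>A. s' i * c i z)"
      using insert.IH[of a' h] lin lim by blast
    show ?thesis
    proof (intro exI conjI allI)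
      show "h = (\<lambda>y. \<Sum>i\<in>insert j A. (s'(j := 0)) i * b i y)"
        by (simp add: split upd s'(1) fun_upd_same del: fun_upd_apply)
      show "(\<lambda>k. \<Sum>i\<in>insert j A. a k i * c i z) \<longlonglongrightarrow> (\<Sum>i\<in>insert j A. (s'(j := 0)) i * c i z)" for z
        using s'(2)[of z] a'[of "\<lambda>i. c i z", OF cj]
          by (simp add: split upd fun_upd_same del: fun_upd_apply)
    qed
  next
    case False
    \<comment> \<open>Otherwise there are pairs of combinations, arbitrarily far out, whose
      coefficients at \<open>j\<close> differ by at least \<open>e\<close> while the combinations
      themselves differ by a null sequence. Dividing by the gap exhibits \<open>b j\<close> as a
      pointwise limit of combinations over \<open>A\<close>, and the induction hypothesis puts it in
      their span.\<close>
    have "Cauchy (\<lambda>k. a k j)"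
    proof (rule ccontr)
      assume "\<not> Cauchy (\<lambda>k. a k j)"
      then obtain e where e: "e > 0" "\<And>M. \<exists>m\<ge>M. \<exists>n\<ge>M. e \<le> \<bar>a m j - a n j\<bar>"
        unfolding Cauchy_def dist_real_def by (meson not_less)
      then obtain m n where mn: "\<And>M. m M \<ge> M" "\<And>M. n M \<ge> M" "\<And>M. e \<le> \<bar>a (m M) j - a (n M) j\<bar>"
        by metis
      define \<delta> where "\<delta> k = a (m k) j - a (n k) j" for k
      have \<delta>: "e \<le> \<bar>\<delta> k\<bar>" "\<delta> k \<noteq> 0" for k using mn(3)[of k] e(1) by (auto simp: \<delta>_def)
      define a' where "a' k i = (a (n k) i - a (m k) i) / \<delta> k" for k i
      have "(\<lambda>k. \<Sum>i\<in>A. a' k i * b i y) \<longlonglongrightarrow> b j y" for y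
      proof -
        define H where "H k = (\<Sum>i\<in>insert j A. a k i * b i y)" for k
        have H: "H \<longlonglongrightarrow> h y"
          unfolding H_def[abs_def] by (rule insert.prems(2))
        have "filterlim m at_top sequentially" "filterlim n at_top sequentially"
          using mn by (auto simp: filterlim_at_top eventually_sequentially intro: order_trans)
        then have "(\<lambda>k. H (m k) - H (n k)) \<longlonglongrightarrow> h y - h y"
          by (intro tendsto_diff) (rule filterlim_compose[OF H], assumption)+
        then have 0: "(\<lambda>k. \<bar>H (m k) - H (n k)\<bar> / e) \<longlonglongrightarrow> 0"
          using tendsto_divide[OF tendsto_rabs tendsto_const, of _ 0 sequentially e] e(1)
          by fastforce
        have "(\<lambda>k. (H (m k) - H (n k)) / \<delta> k) \<longlonglongrightarrow> 0"
        proof (rule tendsto_rabs_zero_cancel, rule tendsto_sandwich[OF _ _ tendsto_const 0])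
          show "\<forall>\<^sub>F k in sequentially. \<bar>(H (m k) - H (n k)) / \<delta> k\<bar> \<le> \<bar>H (m k) - H (n k)\<bar> / e"
            using \<delta> e(1) by (auto simp: abs_divide intro!: always_eventually divide_left_mono mult_pos_pos)
        qed auto
        then have "(\<lambda>k. b j y - (H (m k) - H (n k)) / \<delta> k) \<longlonglongrightarrow> b j y - 0"
          by (intro tendsto_intros)
        moreover have "b j y - (H (m k) - H (n k)) / \<delta> k = (\<Sum>i\<in>A. a' k i * b i y)" for k
        proof -
          have "(\<Sum>i\<in>A. a' k i * b i y) = ((\<Sum>i\<in>A. a (n k) i * b i y) - (\<Sum>i\<in>A. a (m k) i * b i y)) / \<delta> k"
            by (simp add: a'_def sum_divide_distrib sum_subtractf[symmetric] algebra_simps)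
          also have "\<dots> = (H (n k) - H (m k) + \<delta> k * b j y) / \<delta> k"
            by (simp add: H_def split \<delta>_def algebra_simps)
          also have "\<dots> = b j y - (H (m k) - H (n k)) / \<delta> k"
            using \<delta>(2)[of k] by (simp add: field_simps)
          finally show ?thesis by simp
        qed
        ultimately show ?thesis by simp
      qed
      then have "\<exists>s. b j = (\<lambda>y. \<Sum>i\<in>A. s i * b i y)"
        using insert.IH[of a' "b j"] lin by blast
      with False show False by blast
    qed
    then obtain \<alpha> where \<alpha>: "(\<lambda>k. a k j) \<longlonglongrightarrow> \<alpha>"
      using Cauchy_convergent_iff convergent_def by blast
    have "(\<lambda>k. \<Sum>i\<in>A. a k i * b i y) \<longlonglongrightarrow> h y - \<alpha> * b j y" for y
      using tendsto_diff[OF insert.prems(2)[of y] tendsto_mult[OF \<alpha> tendsto_const[of "b j y"]]]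
      by (simp add: split)
    then obtain s where s: "(\<lambda>y. h y - \<alpha> * b j y) = (\<lambda>y. \<Sum>i\<in>A. s i * b i y)"
      "\<And>z. (\<lambda>k. \<Sum>i\<in>A. a k i * c i z) \<longlonglongrightarrow> (\<Sum>i\<in>A. s i * c i z)"
      using insert.IH[of a "\<lambda>y. h y - \<alpha> * b j y"] lin by blast
    show ?thesis
    proof (intro exI conjI allI)
      have "h y = \<alpha> * b j y + (\<Sum>i\<in>A. s i * b i y)" for y
        using fun_cong[OF s(1), of y] by simp
      then show "h = (\<lambda>y. \<Sum>i\<in>insert j A. (s(j := \<alpha>)) i * b i y)"
        by (intro ext) (simp add: split upd fun_upd_same del: fun_upd_apply)
      show "(\<lambda>k. \<Sum>i\<in>insert j A. a k i * c i z) \<longlonglongrightarrow> (\<Sum>i\<in>insert j A. (s(j := \<alpha>)) i * c i z)" for z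
        using tendsto_add[OF tendsto_mult[OF \<alpha> tendsto_const[of "c j z"]] s(2)[of z]]
        by (simp add: split upd fun_upd_same del: fun_upd_apply)
    qed
  qed
qed

subsection \<open>Ordinary differential equations\<close>

lemma picard_global:
  fixes F :: "'a::euclidean_space \<Rightarrow> 'a"
  assumes lip: "L-lipschitz_on UNIV F" and bnd: "bounded (range F)"
  obtains x where "x 0 = x0"
    "\<And>t. t \<ge> 0 \<Longrightarrow> (x has_vector_derivative F (x t)) (at t within {0..})"
proof -
  \<comment> \<open>The Picard operator will contract with factor \<open>L / k\<close>, which is at
    most 1/2; the summand 1 keeps \<open>k\<close> positive when \<open>L = 0\<close>.\<close>
  define k where "k = 2 * (L + 1)"
  have L0: "L \<ge> 0" using lip lipschitz_on_nonneg by blast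
  then have k: "k > 0" by (simp add: k_def)
  obtain M where M: "\<And>y. norm (F y) \<le> M" using bnd by (auto simp: bounded_iff)
  then have M0: "M \<ge> 0" using norm_ge_zero order_trans by blast
  have contF: "continuous_on S F" for S
    using lipschitz_on_continuous_on[OF lip] continuous_on_subset by blast
  \<comment> \<open>The unknown is \<open>\<psi> t = exp (- k t) x t\<close>: in this weighted (Bielecki) norm the Picard operator
    is a contraction on all of \<open>[0, \<infinity>)\<close>, so no extension of local solutions is needed.\<close>
  define G where "G \<psi> s = F (exp (k * s) *\<^sub>R apply_bcontfun \<psi> s)" for \<psi> :: "real \<Rightarrow>\<^sub>C 'a" and s
  have contG: "continuous_on S (G \<psi>)" for S \<psi>
    unfolding G_def
    by (rule continuous_on_compose2[OF contF[of UNIV]]) (auto intro!: continuous_intros)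
  have intG: "G \<psi> integrable_on {u..v}" for \<psi> u v
    by (rule integrable_continuous_interval[OF contG])
  \<comment> \<open>Bounded continuous functions are defined on all of \<open>real\<close>, so
    negative times are clamped to 0 and the operator yields constants there.\<close>
  define I where "I \<psi> t = integral {0..max 0 t} (G \<psi>)" for \<psi> t
  define T where "T \<psi> t = exp (- k * max 0 t) *\<^sub>R (x0 + I \<psi> t)" for \<psi> t
  have contI: "continuous_on UNIV (I \<psi>)" for \<psi>
  proof -
    have "continuous_on {-B<..<B} (I \<psi>)" for B :: real
      unfolding I_def
      by (rule continuous_on_compose2[OF indefinite_integral_continuous_1[OF intG[of \<psi> 0 "max 0 B"]]])
        (auto intro!: continuous_intros)
    then have "continuous_on {-(\<bar>t\<bar>+1)<..<\<bar>t\<bar>+1} (I \<psi>)" "t \<in> {-(\<bar>t\<bar>+1)<..<\<bar>t\<bar>+1}" for t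
      by blast auto
    then have "isCont (I \<psi>) t" for t
      using continuous_on_eq_continuous_at open_greaterThanLessThan by blast
    then show ?thesis by (simp add: continuous_at_imp_continuous_on)
  qed
  have normI: "norm (I \<psi> t) \<le> M * max 0 t" for \<psi> t
    using integral_bound[of 0 "max 0 t" "G \<psi>" M] contG M by (auto simp: I_def G_def)
  have Tb: "T \<psi> \<in> bcontfun" for \<psi>
  proof (rule bcontfun_normI)
    show "continuous_on UNIV (T \<psi>)"
      unfolding T_def by (intro continuous_intros contI) 
    \<comment> \<open>Since \<open>F\<close> is bounded, the integral grows at most linearly, and
      the weight absorbs this through \<open>s * exp (- s) \<le> 1\<close>.\<close>
    show "norm (T \<psi> t) \<le> norm x0 + M / k" for t
    proof -
      let ?s = "max 0 t"
      have "norm (T \<psi> t) \<le> exp (- k * ?s) * (norm x0 + M * ?s)"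
        unfolding T_def using norm_triangle_le[OF add_left_mono[OF normI]]
        by (auto intro!: mult_left_mono)
      also have "\<dots> = exp (- k * ?s) * norm x0 + M / k * (exp (- k * ?s) * (k * ?s))"
        using k by (simp add: field_simps)
      also have "\<dots> \<le> 1 * norm x0 + M / k * 1"
      proof (intro add_mono mult_right_mono mult_left_mono)
        have "k * ?s \<le> exp (k * ?s)" using exp_ge_add_one_self[of "k * ?s"] by linarith
        then show "exp (- k * ?s) * (k * ?s) \<le> 1" by (simp add: exp_minus field_simps)
      qed (use k M0 in auto)
      finally show ?thesis by simp
    qed
  qed
  define TT where "TT \<psi> = Bcontfun (T \<psi>)" for \<psi>
  have TT: "apply_bcontfun (TT \<psi>) = T \<psi>" for \<psi>
    by (simp add: TT_def Bcontfun_inverse Tb)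
  have "\<exists>!\<psi>. TT \<psi> = \<psi>"
  proof (rule banach_fix_type[of "1/2"], goal_cases)
    case 3
    show ?case
    proof (intro allI)
      fix \<psi> \<phi> :: "real \<Rightarrow>\<^sub>C 'a"
      show "dist (TT \<psi>) (TT \<phi>) \<le> 1/2 * dist \<psi> \<phi>"
      proof (rule dist_bound)
        fix t :: real
        let ?s = "max 0 t"
        have ptw: "norm (G \<psi> s - G \<phi> s) \<le> L * exp (k * s) * dist \<psi> \<phi>" for s
        proof -
          have "norm (G \<psi> s - G \<phi> s) \<le> L * dist (exp (k * s) *\<^sub>R \<psi> s) (exp (k * s) *\<^sub>R \<phi> s)"
            using lipschitz_onD[OF lip] by (auto simp: G_def dist_norm)
          also have "\<dots> = L * (exp (k * s) * dist (\<psi> s) (\<phi> s))"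
            by (simp add: dist_norm scaleR_diff_right[symmetric])
          also have "\<dots> \<le> L * (exp (k * s) * dist \<psi> \<phi>)"
            by (intro mult_left_mono dist_bounded L0) auto
          finally show ?thesis by (simp add: mult.assoc)
        qed
        have hi: "((\<lambda>s. L * exp (k * s) * dist \<psi> \<phi>) has_integral
            (L * exp (k * ?s) / k * dist \<psi> \<phi> - L * exp (k * 0) / k * dist \<psi> \<phi>)) {0..?s}"
          by (rule fundamental_theorem_of_calculus)
            (use k in \<open>auto intro!: derivative_eq_intros simp: has_real_derivative_iff_has_vector_derivative[symmetric]\<close>)
        have "norm (I \<psi> t - I \<phi> t) = norm (integral {0..?s} (\<lambda>s. G \<psi> s - G \<phi> s))"
          by (simp add: I_def Henstock_Kurzweil_Integration.integral_diff intG)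
        also have "\<dots> \<le> integral {0..?s} (\<lambda>s. L * exp (k * s) * dist \<psi> \<phi>)"
          by (rule integral_norm_bound_integral) (use hi ptw intG in \<open>auto intro!: integrable_diff\<close>)
        also have "\<dots> = L * exp (k * ?s) / k * dist \<psi> \<phi> - L * exp (k * 0) / k * dist \<psi> \<phi>"
          using hi by (rule integral_unique)
        also have "\<dots> \<le> L * exp (k * ?s) / k * dist \<psi> \<phi>"
          using L0 k by auto
        finally have I: "norm (I \<psi> t - I \<phi> t) \<le> L * exp (k * ?s) / k * dist \<psi> \<phi>" .
        have "dist (TT \<psi> t) (TT \<phi> t) = exp (- k * ?s) * norm (I \<psi> t - I \<phi> t)"
          by (simp add: TT T_def dist_norm scaleR_diff_right[symmetric])
        also have "\<dots> \<le> exp (- k * ?s) * (L * exp (k * ?s) / k * dist \<psi> \<phi>)"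
          by (intro mult_left_mono I) auto
        also have "\<dots> = (exp (- k * ?s) * exp (k * ?s)) * (L / k) * dist \<psi> \<phi>"
          by simp
        also have "\<dots> = (L / k) * dist \<psi> \<phi>"
          by (simp add: exp_minus)
        also have "\<dots> \<le> 1/2 * dist \<psi> \<phi>"
          by (intro mult_right_mono) (use L0 in \<open>auto simp: k_def field_simps\<close>)
        finally show "dist (TT \<psi> t) (TT \<phi> t) \<le> 1/2 * dist \<psi> \<phi>" .
      qed
    qed
  qed auto
  then obtain \<psi> where \<psi>: "TT \<psi> = \<psi>" by blast
  define x where "x t = exp (k * t) *\<^sub>R apply_bcontfun \<psi> t" for t
  have G\<psi>: "G \<psi> = (\<lambda>s. F (x s))" by (simp add: G_def x_def fun_eq_iff)
  have x: "x t = x0 + integral {0..t} (\<lambda>s. F (x s))" if "t \<ge> 0" for t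
  proof -
    have "apply_bcontfun \<psi> t = T \<psi> t" using TT[of \<psi>] \<psi> by simp
    then show ?thesis
      using that by (simp add: x_def[of t] T_def I_def exp_minus G\<psi>)
  qed
  show thesis
  proof
    show "x 0 = x0" using x[of 0] by simp
    fix t :: real assume t: "t \<ge> 0"
    \<comment> \<open>The integral is differentiated on a compact interval that reaches beyond
      \<open>t\<close>; near \<open>t\<close> it coincides with \<open>{0..}\<close>.\<close>
    have "((\<lambda>u. x0 + integral {0..u} (G \<psi>)) has_vector_derivative 0 + G \<psi> t) (at t within {0..t + 1})"
      by (intro derivative_intros integral_has_vector_derivative contG) (use t in auto)
    then have "((\<lambda>u. x0 + integral {0..u} (\<lambda>s. F (x s))) has_vector_derivative F (x t)) (at t within {0..t + 1})"
      by (simp add: G\<psi>)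
    then have "(x has_vector_derivative F (x t)) (at t within {0..t + 1})"
      by (rule has_vector_derivative_transform[rotated 2]) (use t x in auto)
    moreover have "at t within {0..t + 1} = at t within {0..}"
      by (rule at_within_nhd[of t "{..<t + 1}"]) auto
    ultimately show "(x has_vector_derivative F (x t)) (at t within {0..})"
      by simp
  qed
qed

text \<open>
  \<open>V (x t) - \<integral> DV (x s) \<bullet> \<phi> s ds\<close> has derivative zero at every point, although \<open>x\<close> need not be
  differentiable anywhere: boundedness of \<open>\<phi>\<close> suffices.
\<close>

lemma chain_rule_indefinite_integral:
  fixes x :: "real \<Rightarrow> 'a::euclidean_space" and V :: "'a \<Rightarrow> real"
  assumes ab: "a \<le> b"
    and \<phi>: "\<phi> integrable_on {a..b}" "\<And>t. t \<in> {a..b} \<Longrightarrow> norm (\<phi> t) \<le> M"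
    and x: "\<And>t. t \<in> {a..b} \<Longrightarrow> x t = x a + integral {a..t} \<phi>"
    and V: "\<And>y. GDERIV V y :> DV y" and DV: "continuous_on UNIV DV"
    and int: "(\<lambda>t. DV (x t) \<bullet> \<phi> t) integrable_on {a..b}"
  shows "((\<lambda>t. DV (x t) \<bullet> \<phi> t) has_integral (V (x b) - V (x a))) {a..b}"
proof -
  define h where "h t = DV (x t) \<bullet> \<phi> t" for t
  define W where "W t = V (x t) - integral {a..t} h" for t
  have subint: "\<phi> integrable_on {s..t}" "h integrable_on {s..t}" if "a \<le> s" "t \<le> b" for s t
    using that \<phi>(1) int by (auto simp: h_def[abs_def] intro: integrable_on_subinterval)
  have diff: "x t - x s = integral {s..t} \<phi>" "integral {a..t} h - integral {a..s} h = integral {s..t} h"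
    if "a \<le> s" "s \<le> t" "t \<le> b" for s t
  proof -
    have "integral {a..s} \<phi> + integral {s..t} \<phi> = integral {a..t} \<phi>"
      "integral {a..s} h + integral {s..t} h = integral {a..t} h"
      using that subint[of a t]
      by (auto intro!: Henstock_Kurzweil_Integration.integral_combine)
    moreover have "x t - x s = integral {a..t} \<phi> - integral {a..s} \<phi>"
      using x[of t] x[of s] that by simp
    ultimately show "x t - x s = integral {s..t} \<phi>"
      "integral {a..t} h - integral {a..s} h = integral {s..t} h"
      by (metis add_diff_cancel_left')+
  qed
  have "M \<ge> 0" using order_trans[OF norm_ge_zero \<phi>(2)[of a]] ab by simp
  \<comment> \<open>A strictly positive bound, because the radii chosen later divide by it and
    \<open>M\<close> may be 0.\<close>
  define M' where "M' = M + 1"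
  have M': "M' > 0" "\<And>t. t \<in> {a..b} \<Longrightarrow> norm (\<phi> t) \<le> M'"
    using \<open>M \<ge> 0\<close> by (simp_all add: M'_def \<phi>(2) add_increasing2)
  have lipx: "norm (x t - x s) \<le> M' * (t - s)" if "a \<le> s" "s \<le> t" "t \<le> b" for s t
    unfolding diff(1)[OF that]
    using has_integral_bound_real[of M' "{}" \<phi> "integral {s..t} \<phi>" s t] subint(1)[of s t] that M'
    by auto
  have "M'-lipschitz_on {a..b} x"
  proof (rule lipschitz_onI)
    fix s t assume "s \<in> {a..b}" "t \<in> {a..b}"
    then show "dist (x s) (x t) \<le> M' * dist s t"
      using lipx[of s t] lipx[of t s]
      by (cases "s \<le> t") (auto simp: dist_norm norm_minus_commute)
  qed (use M' in auto)
  then have contx: "continuous_on {a..b} x" by (rule lipschitz_on_continuous_on)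
  have contD: "continuous_on {a..b} (\<lambda>t. DV (x t))"
    by (rule continuous_on_compose2[OF DV contx]) auto
  \<comment> \<open>With the gradient frozen at \<open>z\<close>, the integral of
    \<open>DV z \<bullet> \<phi> r\<close> is exactly \<open>DV z \<bullet> (x t - x s)\<close>.
    Only the oscillation of \<open>DV\<close> along the piece remains as an error, and a bound on
    \<open>\<phi>\<close> controls it.\<close>
  have key: "\<bar>DV z \<bullet> (x t - x s) - integral {s..t} h\<bar> \<le> e * M' * (t - s)"
    if st: "a \<le> s" "s \<le> t" "t \<le> b" and e: "e \<ge> 0" "\<And>r. r \<in> {s..t} \<Longrightarrow> norm (DV z - DV (x r)) \<le> e" for s t e z
  proof -
    have "((\<lambda>r. DV z \<bullet> \<phi> r - h r) has_integral (DV z \<bullet> integral {s..t} \<phi> - integral {s..t} h)) {s..t}"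
      using st subint[of s t]
      by (intro has_integral_diff has_integral_linear[OF _ bounded_linear_inner_right, unfolded o_def])
        auto
    moreover have "norm (DV z \<bullet> \<phi> r - h r) \<le> e * M'" if "r \<in> {s..t}" for r
    proof -
      have "norm (DV z \<bullet> \<phi> r - h r) = \<bar>(DV z - DV (x r)) \<bullet> \<phi> r\<bar>"
        by (simp add: h_def inner_diff_left)
      also have "\<dots> \<le> norm (DV z - DV (x r)) * norm (\<phi> r)"
        by (rule Cauchy_Schwarz_ineq2)
      also have "\<dots> \<le> e * M'"
        using that st e by (intro mult_mono M') auto
      finally show ?thesis .
    qed
    ultimately have "norm (DV z \<bullet> integral {s..t} \<phi> - integral {s..t} h) \<le> e * M' * (t - s)"
      using has_integral_bound_real[of "e * M'" "{}" "\<lambda>r. DV z \<bullet> \<phi> r - h r" _ s t] e(1) M'(1) st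
      by auto
    then show ?thesis by (simp add: diff(1)[OF st])
  qed
  have "(W has_derivative (\<lambda>_. 0)) (at t within {a..b})" if t: "t \<in> {a..b}" for t
    unfolding has_derivative_within_alt
  proof (intro conjI allI impI)
    fix e :: real assume "e > 0"
    define e' where "e' = e / (2 * M')"
    have e': "e' > 0" using \<open>e > 0\<close> M' by (simp add: e'_def)
    have "(V has_derivative (\<lambda>v. DV (x t) \<bullet> v)) (at (x t))"
      using V[of "x t"] by (simp add: gderiv_def inner_commute)
    then obtain d1 where d1: "d1 > 0" "\<And>y. norm (y - x t) < d1 \<Longrightarrow>
        norm (V y - V (x t) - DV (x t) \<bullet> (y - x t)) \<le> e' * norm (y - x t)"
      using e' unfolding has_derivative_at_alt by blast
    obtain d2 where d2: "d2 > 0" "\<And>s. s \<in> {a..b} \<Longrightarrow> dist s t < d2 \<Longrightarrow> dist (DV (x s)) (DV (x t)) < e'"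
      using contD t e' unfolding continuous_on_iff by metis
    show "\<exists>\<delta>>0. \<forall>s\<in>{a..b}. norm (s - t) < \<delta> \<longrightarrow> norm (W s - W t - 0) \<le> e * norm (s - t)"
    proof (intro exI[of _ "min d2 (d1 / M')"] conjI ballI impI)
      show "min d2 (d1 / M') > 0" using d1 d2 M' by simp
      fix s assume s: "s \<in> {a..b}" "norm (s - t) < min d2 (d1 / M')"
      have xs: "norm (x s - x t) \<le> M' * \<bar>s - t\<bar>"
        using lipx[of s t] lipx[of t s] s t by (cases "s \<le> t") (auto simp: norm_minus_commute)
      also have "\<dots> < d1" using s(2) M'(1) by (simp add: field_simps)
      finally have "norm (x s - x t) < d1" .
      from d1(2)[OF this] have A: "\<bar>V (x s) - V (x t) - DV (x t) \<bullet> (x s - x t)\<bar> \<le> e' * (M' * \<bar>s - t\<bar>)"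
        using mult_left_mono[OF xs, of e'] e' by (metis less_imp_le order_trans real_norm_def)
      have near: "norm (DV (x t) - DV (x r)) \<le> e'" if "r \<in> {min s t..max s t}" for r
        using d2(2)[of r] that s t by (auto simp: dist_norm norm_minus_commute min_def max_def split: if_splits)
      have B: "\<bar>DV (x t) \<bullet> (x s - x t) - (integral {a..s} h - integral {a..t} h)\<bar> \<le> e' * M' * \<bar>s - t\<bar>"
      proof (cases "s \<le> t")
        case True
        then show ?thesis
          using key[of s t e' "x t"] near s t e' diff(2)[of s t]
          by (auto simp: inner_diff_right abs_minus_commute algebra_simps)
      next
        case False
        then show ?thesis
          using key[of t s e' "x t"] near s t e' diff(2)[of t s]
          by (auto simp: inner_diff_right abs_minus_commute algebra_simps)
      qed
      have "\<bar>W s - W t\<bar> \<le> 2 * (e' * M' * \<bar>s - t\<bar>)"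
        using A B unfolding W_def by (simp add: abs_if split: if_splits)
      also have "\<dots> = e * \<bar>s - t\<bar>" using M' by (simp add: e'_def)
      finally show "norm (W s - W t - 0) \<le> e * norm (s - t)" by simp
    qed
  qed simp
  then have "W b = W a"
    using has_derivative_zero_unique[of "{a..b}" W b a] ab by auto
  then have "integral {a..b} h = V (x b) - V (x a)"
    by (simp add: W_def)
  then show ?thesis
    using int integrable_integral unfolding h_def by metis
qed

subsection \<open>Lyapunov functions\<close>

lemma GDERIV_grad:
  assumes "V differentiable (at y)"
  shows "GDERIV V y :> grad V (y :: real^'n)"
proof -
  obtain V' where V': "(V has_derivative V') (at y)"
    using assms by (auto simp: differentiable_def)
  then interpret V': bounded_linear V' by (rule has_derivative_bounded_linear)
  define D where "D = (\<Sum>b\<in>Basis. V' b *\<^sub>R b)"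
  have "V' = (\<lambda>h. h \<bullet> D)"
  proof
    fix h
    have "V' h = V' (\<Sum>b\<in>Basis. (h \<bullet> b) *\<^sub>R b)" by (simp add: euclidean_representation)
    also have "\<dots> = h \<bullet> D"
      by (simp add: D_def V'.sum V'.scaleR inner_sum_right mult.commute)
    finally show "V' h = h \<bullet> D" .
  qed
  then have D: "GDERIV V y :> D"
    using V' by (simp add: gderiv_def)
  show ?thesis
    unfolding grad_def
  proof (rule theI)
    show "GDERIV V y :> D" by (rule D)
    fix D' assume "GDERIV V y :> D'"
    then have "(\<lambda>h. h \<bullet> D') = (\<lambda>h. h \<bullet> D)"
      using D unfolding gderiv_def by (rule has_derivative_unique)
    then show "D' = D" by (metis inner_commute vector_eq_ldot)
  qed
qed

lemma grad_eqI:
  assumes "GDERIV V y :> D"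
  shows "grad V (y :: real^'n) = D"
proof -
  have "(\<lambda>h. h \<bullet> grad V y) = (\<lambda>h. h \<bullet> D)"
    using assms GDERIV_grad[of V y] unfolding gderiv_def
    by (auto simp: differentiable_def intro!: has_derivative_unique)
  then show ?thesis by (metis inner_commute vector_eq_ldot)
qed

lemma class_PD:
  assumes "V \<in> class_P"
  shows "GDERIV V y :> grad V y" "continuous_on UNIV (grad V)" "V 0 = 0" "y \<noteq> 0 \<Longrightarrow> V y > 0"
    "filterlim V at_top at_infinity" "continuous_on S V" "V y \<ge> 0"
proof -
  show "V y \<ge> 0"
    using assms by (cases "y = 0") (auto simp: class_P_def positive_definite_fun_def less_imp_le)
  have "\<And>y. V differentiable at y" using assms by (auto simp: class_P_def)
  then show "continuous_on S V"
    by (simp add: continuous_at_imp_continuous_on differentiable_imp_continuous_within)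
qed (use assms in \<open>auto simp: class_P_def positive_definite_fun_def intro: GDERIV_grad\<close>)

text \<open>Far out, properness gives the bound 1; what is left is a compact shell that avoids the
  origin, where the continuous \<open>V\<close> attains a positive minimum.\<close>

lemma class_P_bounded_away:
  assumes V: "V \<in> class_P" and "\<epsilon> > 0"
  obtains m where "m > 0" "\<And>y :: real^'n. norm y \<ge> \<epsilon> \<Longrightarrow> V y \<ge> m"
proof -
  have "\<forall>\<^sub>F y in at_infinity. V y \<ge> 1"
    using class_PD(5)[OF V] by (simp add: filterlim_at_top)
  then obtain B where B: "\<And>y. norm y \<ge> B \<Longrightarrow> V y \<ge> 1"
    by (auto simp: eventually_at_infinity)
  define S where "S = {y :: real^'n. norm y \<in> {\<epsilon>..B}}"
  have "bounded S" by (auto simp: S_def bounded_iff)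
  moreover have "closed S"
    unfolding S_def by (rule continuous_closed_vimage[of "{\<epsilon>..B}" norm, unfolded vimage_def]) auto
  ultimately have S: "compact S" by (simp add: compact_eq_bounded_closed)
  show thesis
  proof (cases "S = {}")
    case True
    then have "norm y \<ge> B" if "norm y \<ge> \<epsilon>" for y :: "real^'n"
      using that by (force simp: S_def)
    then show ?thesis using B by (intro that[of 1]) auto
  next
    case False
    then obtain z where z: "z \<in> S" "\<And>y. y \<in> S \<Longrightarrow> V z \<le> V y"
      using continuous_attains_inf[OF S] class_PD(6)[OF V] by metis
    have "z \<noteq> 0" using z(1) \<open>\<epsilon> > 0\<close> by (auto simp: S_def)
    then have "V z > 0" by (rule class_PD(4)[OF V])
    show ?thesis
    proof (rule that[of "min 1 (V z)"])
      fix y :: "real^'n" assume "norm y \<ge> \<epsilon>"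
      then show "V y \<ge> min 1 (V z)"
        using B[of y] z(2)[of y] by (cases "norm y \<ge> B") (auto simp: S_def)
    qed (use \<open>V z > 0\<close> in auto)
  qed
qed

lemma has_real_derivative_along:
  assumes "(x has_vector_derivative F (x t)) (at t within S)" and "GDERIV V (x t) :> D"
  shows "((\<lambda>t. V (x t)) has_real_derivative D \<bullet> F (x t)) (at t within S)"
proof -
  have "((\<lambda>t. V (x t)) has_derivative (\<lambda>h. (h *\<^sub>R F (x t)) \<bullet> D)) (at t within S)"
    using has_derivative_compose[of x "\<lambda>h. h *\<^sub>R F (x t)" t S V "\<lambda>h. h \<bullet> D"] assms
    by (simp add: has_vector_derivative_def gderiv_def)
  moreover have "(\<lambda>h. (h *\<^sub>R F (x t)) \<bullet> D) = (*) (D \<bullet> F (x t))"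
    by (auto simp: inner_commute)
  ultimately show ?thesis by (simp add: has_field_derivative_def)
qed

text \<open>The mean value theorem, with derivatives within \<open>S\<close> so that
  \<open>S = {0..}\<close> admits the one-sided derivative at the initial time.\<close>

lemma decrease_of_derivative_le:
  fixes \<phi> :: "real \<Rightarrow> real"
  assumes "s \<le> t" "{s..t} \<subseteq> S"
    and "\<And>r. r \<in> {s..t} \<Longrightarrow> (\<phi> has_real_derivative \<phi>' r) (at r within S)"
    and "\<And>r. r \<in> {s..t} \<Longrightarrow> \<phi>' r \<le> - m"
  shows "\<phi> t \<le> \<phi> s - m * (t - s)"
proof (cases "s = t")
  case False
  then have "s < t" using assms(1) by simp
  then obtain r where r: "r \<in> {s<..<t}" "\<phi> t - \<phi> s = \<phi>' r * (t - s)"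
    using mvt_simple[of s t \<phi> "\<lambda>r. (*) (\<phi>' r)"] assms has_field_derivative_subset
    unfolding has_field_derivative_def by (metis atLeastAtMost_iff)
  have "\<phi>' r * (t - s) \<le> - m * (t - s)"
    using r(1) assms(4)[of r] \<open>s < t\<close> by (intro mult_right_mono) auto
  then show ?thesis using r(2) by simp
qed simp

lemma Lyapunov_nonincreasing:
  assumes "V \<in> class_P" "solution F x" "\<And>y. grad V y \<bullet> F y \<le> 0" "0 \<le> s" "s \<le> t"
  shows "V (x t) \<le> V (x s)"
  using decrease_of_derivative_le[of s t "{0..}" "\<lambda>t. V (x t)" "\<lambda>t. grad V (x t) \<bullet> F (x t)" 0]
    has_real_derivative_along[of x F _ "{0..}" V] class_PD(1)[OF assms(1)] assms
  by (auto simp: solution_def)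

text \<open>If \<open>V\<close> stayed above some \<open>c > 0\<close>, the orbit would remain in
  the compact set where \<open>V\<close> lies between \<open>c\<close> and \<open>V (x 0)\<close>.
  There \<open>q\<close> has a positive minimum, so \<open>V\<close> would fall at a uniform rate
  and eventually reach 0. Smallness at one time persists because \<open>V\<close> is
  nonincreasing.\<close>

lemma Lyapunov_tendsto_0:
  fixes V :: "real^'n \<Rightarrow> real"
  assumes V: "V \<in> class_P" and x: "solution F x"
    and q: "continuous_on UNIV q" "positive_definite_fun q"
    and decr: "\<And>y. grad V y \<bullet> F y \<le> - q y"
  shows "(x \<longlongrightarrow> 0) at_top"
proof -
  have q0: "q y \<ge> 0" "y \<noteq> 0 \<Longrightarrow> q y > 0" for y
    using q(2) by (cases "y = 0"; force simp: positive_definite_fun_def)+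
  have "grad V y \<bullet> F y \<le> 0" for y using decr[of y] q0(1)[of y] by linarith
  note mono = Lyapunov_nonincreasing[OF V x this]
  have "\<exists>t\<ge>0. V (x t) < c" if c: "c > 0" for c
  proof (rule ccontr)
    assume "\<not> ?thesis"
    then have ge: "V (x t) \<ge> c" if "t \<ge> 0" for t using that by force
    have "V (x 0) \<ge> c" using ge by simp
    define S where "S = {y. V y \<in> {c..V (x 0)}}"
    have "closed S"
      unfolding S_def
      by (rule continuous_closed_vimage[of "{c..V (x 0)}" V, unfolded vimage_def])
        (use class_PD(6)[OF V, of UNIV] in \<open>auto simp: continuous_on_eq_continuous_at\<close>)
    moreover have "bounded S"
    proof -
      have "\<forall>\<^sub>F y in at_infinity. V y \<ge> V (x 0) + 1"
        using class_PD(5)[OF V] by (simp add: filterlim_at_top)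
      then obtain B where "\<And>y. norm y \<ge> B \<Longrightarrow> V y \<ge> V (x 0) + 1"
        by (auto simp: eventually_at_infinity)
      then have "norm y \<le> B" if "y \<in> S" for y
        using that by (smt (verit) S_def atLeastAtMost_iff mem_Collect_eq)
      then show ?thesis by (auto intro: boundedI)
    qed
    ultimately have "compact S" by (simp add: compact_eq_bounded_closed)
    moreover have xS: "x t \<in> S" if "t \<ge> 0" for t
      using ge[OF that] mono[of 0 t] that by (auto simp: S_def)
    ultimately obtain z where z: "z \<in> S" "\<And>y. y \<in> S \<Longrightarrow> q z \<le> q y"
      using continuous_attains_inf[of S q] continuous_on_subset[OF q(1)] xS[of 0]
      by (metis empty_iff order_refl subset_UNIV)
    have "z \<noteq> 0" using z(1) c class_PD(3)[OF V] by (auto simp: S_def)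
    then have qz: "q z > 0" by (rule q0)
    \<comment> \<open>The time at which a decrease at rate \<open>q z\<close> has used up the
      initial value of \<open>V\<close>.\<close>
    define T where "T = V (x 0) / q z"
    have T: "T \<ge> 0" using qz \<open>V (x 0) \<ge> c\<close> c by (simp add: T_def)
    have "V (x T) \<le> V (x 0) - q z * (T - 0)"
    proof (rule decrease_of_derivative_le[OF T])
      fix r assume r: "r \<in> {0..T}"
      then show "((\<lambda>t. V (x t)) has_real_derivative grad V (x r) \<bullet> F (x r)) (at r within {0..})"
        using has_real_derivative_along[of x F _ "{0..}" V] class_PD(1)[OF V] x
        by (auto simp: solution_def)
      show "grad V (x r) \<bullet> F (x r) \<le> - q z"
        using decr[of "x r"] z(2)[of "x r"] xS[of r] r by auto
    qed auto
    then have "V (x T) \<le> 0" using qz by (simp add: T_def)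
    then show False using ge[OF T] c by simp
  qed
  note small = this
  show ?thesis
  proof (rule tendstoI)
    fix \<epsilon> :: real assume "\<epsilon> > 0"
    then obtain m where m: "m > 0" "\<And>y. norm y \<ge> \<epsilon> \<Longrightarrow> V y \<ge> m"
      using class_P_bounded_away[OF V] by metis
    obtain t0 where t0: "t0 \<ge> 0" "V (x t0) < m" using small[OF m(1)] by blast
    have "norm (x t) < \<epsilon>" if "t \<ge> t0" for t
      using mono[OF t0(1) that] t0(2) m(2)[of "x t"] by force
    then show "\<forall>\<^sub>F t in at_top. dist (x t) 0 < \<epsilon>"
      by (auto simp: eventually_at_top_linorder)
  qed
qed

text \<open>Local Lipschitz continuity alone permits blow-up in finite time. By properness the
  sublevel set of \<open>V\<close> through \<open>x0\<close> lies inside an open ball, and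
  \<open>V\<close> does not increase, so the orbit is trapped.\<close>

lemma solution_exists_of_Lyapunov:
  fixes V :: "real^'n \<Rightarrow> real"
  assumes V: "V \<in> class_P" and lip: "\<And>\<rho>. \<exists>L. L-lipschitz_on (cball 0 \<rho>) F"
    and decr: "\<And>y. grad V y \<bullet> F y \<le> 0"
  shows "\<exists>x. solution F x \<and> x 0 = x0"
proof -
  have "\<forall>\<^sub>F y in at_infinity. V y \<ge> V x0 + 1"
    using class_PD(5)[OF V] by (simp add: filterlim_at_top)
  then obtain B where B: "\<And>y. norm y \<ge> B \<Longrightarrow> V y \<ge> V x0 + 1"
    by (auto simp: eventually_at_infinity)
  define \<rho> where "\<rho> = max B 1"
  have \<rho>: "\<rho> > 0" "\<And>y. V y \<le> V x0 \<Longrightarrow> norm y < \<rho>"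
    using B by (auto simp: \<rho>_def) (smt (verit))
  obtain L where L: "L-lipschitz_on (cball 0 \<rho>) F" using lip by blast
  \<comment> \<open>Composing \<open>F\<close> with this projection makes it globally Lipschitz and bounded; the solution of the
    modified equation never leaves the ball, where both vector fields agree.\<close>
  define P where "P = closest_point (cball (0 :: real^'n) \<rho>)"
  have P: "P y \<in> cball 0 \<rho>" for y
    unfolding P_def using \<rho>(1) by (intro closest_point_in_set) auto
  have P1: "1-lipschitz_on UNIV P"
    unfolding P_def using \<rho>(1) closest_point_lipschitz[of "cball (0 :: real^'n) \<rho>"]
    by (intro lipschitz_onI) auto
  have "(L * 1)-lipschitz_on UNIV (\<lambda>y. F (P y))"
    by (rule lipschitz_on_compose2[OF P1]) (rule lipschitz_on_subset[OF L], use P in auto)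
  moreover have "bounded (range (\<lambda>y. F (P y)))"
  proof (rule bounded_subset)
    show "bounded (F ` cball 0 \<rho>)"
      by (intro compact_imp_bounded compact_continuous_image compact_cball
          lipschitz_on_continuous_on[OF L])
    show "range (\<lambda>y. F (P y)) \<subseteq> F ` cball 0 \<rho>" using P by auto
  qed
  ultimately obtain x where x: "x 0 = x0"
    "\<And>t. t \<ge> 0 \<Longrightarrow> (x has_vector_derivative F (P (x t))) (at t within {0..})"
    using picard_global[of "L * 1" "\<lambda>y. F (P y)" x0] by metis
  have Pid: "P y = y" if "norm y \<le> \<rho>" for y
    unfolding P_def using that by (intro closest_point_self) auto
  have contx: "continuous_on {0..} x"
    using x(2) has_vector_derivative_continuous by (force simp: continuous_on_eq_continuous_within)
  have inside: "norm (x t) < \<rho>" if "t \<ge> 0" for t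
  proof (rule ccontr)
    assume far: "\<not> ?thesis"
    \<comment> \<open>\<open>Inf E\<close> is the first time at which the orbit meets the sphere.
      Until then it follows \<open>F\<close> itself, so \<open>V\<close> is still at most
      \<open>V x0\<close> there, and \<open>\<rho>\<close> was chosen so that this forces the norm
      strictly below \<open>\<rho>\<close>.\<close>
    define E where "E = {0..} \<inter> (\<lambda>s. norm (x s)) -` {\<rho>..}"
    have tE: "t \<in> E" using far that by (auto simp: E_def)
    have "closed E"
      unfolding E_def by (intro continuous_closed_preimage continuous_intros contx)
    moreover have bE: "bdd_below E" by (auto simp: E_def intro: bdd_belowI)
    ultimately have I: "Inf E \<in> E" using closed_contains_Inf tE by blast
    have small: "norm (x s) < \<rho>" if "0 \<le> s" "s < Inf E" for s
      using that cInf_lower[OF _ bE, of s] by (force simp: E_def)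
    have I0: "Inf E > 0"
      using I \<rho>(2)[of x0] x(1) by (cases "Inf E = 0") (auto simp: E_def)
    have "norm (x (Inf E)) \<le> \<rho>"
    proof (rule tendsto_upperbound)
      show "((\<lambda>s. norm (x s)) \<longlongrightarrow> norm (x (Inf E))) (at (Inf E) within {0..<Inf E})"
      proof (rule tendsto_norm, rule tendsto_within_subset)
        show "(x \<longlongrightarrow> x (Inf E)) (at (Inf E) within {0..})"
          using contx I0 by (simp add: continuous_on_def)
      qed auto
      show "\<forall>\<^sub>F s in at (Inf E) within {0..<Inf E}. norm (x s) \<le> \<rho>"
        using small by (auto simp: eventually_at_filter less_imp_le)
      show "at (Inf E) within {0..<Inf E} \<noteq> bot"
        using I0 by (simp add: trivial_limit_within islimpt_Ico)
    qed
    then have le: "norm (x s) \<le> \<rho>" if "s \<in> {0..Inf E}" for s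
      using small[of s] that by (cases "s = Inf E") auto
    have "V (x (Inf E)) \<le> V (x 0) - 0 * (Inf E - 0)"
    proof (rule decrease_of_derivative_le[where \<phi> = "\<lambda>t. V (x t)" and S = "{0..}"])
      fix s assume s: "s \<in> {0..Inf E}"
      then have "(x has_vector_derivative F (x s)) (at s within {0..})"
        using x(2)[of s] Pid[OF le[OF s]] by simp
      then show "((\<lambda>t. V (x t)) has_real_derivative grad V (x s) \<bullet> F (x s)) (at s within {0..})"
        by (rule has_real_derivative_along[OF _ class_PD(1)[OF V]])
      show "grad V (x s) \<bullet> F (x s) \<le> - 0" using decr by simp
    qed (use I0 in auto)
    then have "norm (x (Inf E)) < \<rho>" using \<rho>(2) x(1) by simp
    then show False using I by (simp add: E_def)
  qed
  have "solution F x"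
    unfolding solution_def using x(2) Pid[OF less_imp_le[OF inside]] by simp
  with x(1) show ?thesis by blast
qed

theorem Lyapunov_globally_asymptotically_stable:
  fixes V :: "real^'n \<Rightarrow> real"
  assumes V: "V \<in> class_P" and lip: "\<And>\<rho>. \<exists>L. L-lipschitz_on (cball 0 \<rho>) F"
    and q: "continuous_on UNIV q" "positive_definite_fun q"
    and decr: "\<And>y. grad V y \<bullet> F y \<le> - q y"
  shows "globally_asymptotically_stable F"
proof -
  have "q y \<ge> 0" for y
    using q(2) by (cases "y = 0"; force simp: positive_definite_fun_def)
  then have decr0: "grad V y \<bullet> F y \<le> 0" for y using decr[of y] by (meson neg_le_0_iff_le order_trans)
  have "\<exists>\<delta>>0. \<forall>x. solution F x \<and> norm (x 0) < \<delta> \<longrightarrow> (\<forall>t\<ge>0. norm (x t) < \<epsilon>)" if "\<epsilon> > 0" for \<epsilon>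
  proof -
    obtain m where m: "m > 0" "\<And>y. norm y \<ge> \<epsilon> \<Longrightarrow> V y \<ge> m"
      using class_P_bounded_away[OF V \<open>\<epsilon> > 0\<close>] by metis
    obtain \<delta> where \<delta>: "\<delta> > 0" "\<And>y. norm y < \<delta> \<Longrightarrow> V y < m"
    proof -
      obtain \<delta> where "\<delta> > 0" "\<And>y. dist y 0 < \<delta> \<Longrightarrow> dist (V y) (V 0) < m"
        using class_PD(6)[OF V, of UNIV] m(1) unfolding continuous_on_iff by blast
      then show thesis
        using class_PD(3)[OF V] by (intro that[of \<delta>]) (auto simp: dist_real_def abs_less_iff)
    qed
    have "norm (x t) < \<epsilon>" if "solution F x" "norm (x 0) < \<delta>" "t \<ge> 0" for x t
      using Lyapunov_nonincreasing[OF V that(1) decr0 order_refl that(3)] m(2)[of "x t"] \<delta>(2)[OF that(2)]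
      by force
    with \<delta>(1) show ?thesis by blast
  qed
  then show ?thesis
    unfolding globally_asymptotically_stable_def
    using solution_exists_of_Lyapunov[OF V lip decr0] Lyapunov_tendsto_0[OF V _ q decr] by blast
qed

subsection \<open>Polynomials\<close>

lemma bij_coord: "bij_betw coord {..<CARD('n)} (UNIV :: 'n::{finite,linorder} set)"
  using bij_betw_nth[of "sorted_list_of_set (UNIV :: 'n set)"] 
  by (simp add: coord_def[abs_def])

lemma card_less_CARD: "card {j. j < (i :: 'n::{finite,linorder})} < CARD('n)"
  by (rule psubset_card_mono) auto

lemma card_less_coord:
  assumes "k < CARD('n::{finite,linorder})"
  shows "card {j. j < (coord k :: 'n)} = k"
  using inj_onD[OF bij_betw_imp_inj_on[OF bij_coord[where 'n='n]], of "card {j. j < (coord k :: 'n)}" k]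
    assms card_less_CARD coord_card_less by auto

declare finite_exponents [simp]

lemma poly_spaceI:
  fixes p :: "real^'n::{finite,linorder} \<Rightarrow> real"
  assumes "\<And>x. p x = (\<Sum>\<alpha>\<in>exponents CARD('n) d1 d2. a \<alpha> * monomial \<alpha> x)"
  shows "p \<in> poly_space d1 d2"
  unfolding poly_space_def mem_Collect_eq by (rule exI, rule ext, rule assms)

lemma poly_spaceE:
  fixes p :: "real^'n::{finite,linorder} \<Rightarrow> real"
  assumes "p \<in> poly_space d1 d2"
  obtains a where "p = (\<lambda>x. \<Sum>\<alpha>\<in>exponents CARD('n) d1 d2. a \<alpha> * monomial \<alpha> x)"
  using assms unfolding poly_space_def by blast

lemma monomial_in_poly_space:
  fixes d1 d2 :: nat
  assumes "\<alpha> \<in> exponents CARD('n::{finite,linorder}) d1 d2"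
  shows "(monomial \<alpha> :: real^'n::_ \<Rightarrow> real) \<in> poly_space d1 d2"
proof -
  have "monomial \<alpha> x = (\<Sum>\<beta>\<in>exponents CARD('n) d1 d2. (if \<beta> = \<alpha> then 1 else 0) * monomial \<beta> x)"
    for x :: "real^'n::_"
    using assms by (simp add: if_distrib[of "\<lambda>c. c * _"] sum.delta cong: if_cong)
  then show ?thesis by (rule poly_spaceI)
qed

lemma poly_space_0: "(\<lambda>x. 0) \<in> poly_space d1 d2"
  unfolding poly_space_def by (auto intro!: exI[of _ "\<lambda>_. 0"])

lemma poly_space_add:
  assumes "p \<in> poly_space d1 d2" "q \<in> poly_space d1 d2"
  shows "(\<lambda>x. p x + q x) \<in> poly_space d1 d2"
proof -
  obtain a where "p = (\<lambda>x. \<Sum>\<alpha>\<in>exponents CARD('a) d1 d2. a \<alpha> * monomial \<alpha> x)"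
    using assms(1) by (rule poly_spaceE)
  moreover obtain b where "q = (\<lambda>x. \<Sum>\<alpha>\<in>exponents CARD('a) d1 d2. b \<alpha> * monomial \<alpha> x)"
    using assms(2) by (rule poly_spaceE)
  ultimately have "p x + q x = (\<Sum>\<alpha>\<in>exponents CARD('a) d1 d2. (a \<alpha> + b \<alpha>) * monomial \<alpha> x)" for x
    by (simp add: distrib_right sum.distrib)
  then show ?thesis by (rule poly_spaceI)
qed

lemma poly_space_cmult:
  assumes "p \<in> poly_space d1 d2"
  shows "(\<lambda>x. c * p x) \<in> poly_space d1 d2"
proof -
  obtain a where "p = (\<lambda>x. \<Sum>\<alpha>\<in>exponents CARD('a) d1 d2. a \<alpha> * monomial \<alpha> x)"
    using assms by (rule poly_spaceE)
  then have "c * p x = (\<Sum>\<alpha>\<in>exponents CARD('a) d1 d2. (c * a \<alpha>) * monomial \<alpha> x)" for x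
    by (simp add: sum_distrib_left mult.assoc)
  then show ?thesis by (rule poly_spaceI)
qed

lemma poly_space_uminus: "p \<in> poly_space d1 d2 \<Longrightarrow> (\<lambda>x. - p x) \<in> poly_space d1 d2"
  using poly_space_cmult[of p d1 d2 "- 1"] by simp

lemma poly_space_diff:
  "p \<in> poly_space d1 d2 \<Longrightarrow> q \<in> poly_space d1 d2 \<Longrightarrow> (\<lambda>x. p x - q x) \<in> poly_space d1 d2"
  using poly_space_add[OF _ poly_space_uminus, of p d1 d2 q] by simp

lemma poly_space_sum:
  "(\<And>i. i \<in> I \<Longrightarrow> p i \<in> poly_space d1 d2) \<Longrightarrow> (\<lambda>x. \<Sum>i\<in>I. p i x) \<in> poly_space d1 d2"
  by (induction I rule: infinite_finite_induct) (auto intro: poly_space_0 poly_space_add)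

lemma poly_space_induct [consumes 1, case_names monomial zero add cmult]:
  fixes p :: "real^'n::{finite,linorder} \<Rightarrow> real"
  assumes p: "p \<in> poly_space d1 d2"
    and mono: "\<And>\<alpha>. \<alpha> \<in> exponents CARD('n) d1 d2 \<Longrightarrow> P (monomial \<alpha>)"
    and zero: "P (\<lambda>x. 0)"
    and add: "\<And>p q. P p \<Longrightarrow> P q \<Longrightarrow> P (\<lambda>x. p x + q x)"
    and cmult: "\<And>c p. P p \<Longrightarrow> P (\<lambda>x. c * p x)"
  shows "P p"
proof -
  obtain a where a: "p = (\<lambda>x. \<Sum>\<alpha>\<in>exponents CARD('n) d1 d2. a \<alpha> * monomial \<alpha> x)"
    using p by (auto simp: poly_space_def)
  have "P (\<lambda>x. \<Sum>\<alpha>\<in>A. a \<alpha> * monomial \<alpha> x)" if "A \<subseteq> exponents CARD('n) d1 d2" for A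
    using finite_subset[OF that finite_exponents] that
    by (induction A rule: finite_induct) (auto intro!: zero add cmult mono)
  then show ?thesis using a by simp
qed

lemma poly_space_mono:
  assumes "p \<in> poly_space d1 d2" "d1' \<le> d1" "d2 \<le> d2'"
  shows "p \<in> poly_space d1' d2'"
  using assms(1)
proof (induction rule: poly_space_induct)
  case (monomial \<alpha>)
  then show ?case using assms(2,3) by (intro monomial_in_poly_space) (auto simp: exponents_def)
qed (auto intro: poly_space_0 poly_space_add poly_space_cmult)

section \<open>Degrees of products and vanishing low-order terms\<close>

lemma sum_list_map2_plus:
  fixes xs ys :: "nat list"
  shows "length xs = length ys \<Longrightarrow> sum_list (map2 (+) xs ys) = sum_list xs + sum_list ys"
  by (induction xs ys rule: list_induct2) auto

lemma monomial_mult: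
  assumes "length \<alpha> = length \<beta>"
  shows "monomial \<alpha> x * monomial \<beta> x = monomial (map2 (+) \<alpha> \<beta>) x"
  using assms by (simp add: monomial_def power_add prod.distrib)

text \<open>The lower degree bounds add up as well; this is what puts a product of two factors
  without constant term into degrees at least 2.\<close>

lemma poly_space_mult:
  fixes p q :: "real^'n::{finite,linorder} \<Rightarrow> real"
  assumes "p \<in> poly_space a b" "q \<in> poly_space c d"
  shows "(\<lambda>x. p x * q x) \<in> poly_space (a + c) (b + d)"
  using assms(1)
proof (induction rule: poly_space_induct)
  case (monomial \<alpha>)
  from assms(2) show ?case
  proof (induction rule: poly_space_induct)
    case (monomial \<beta>)
    have "(\<lambda>x :: real^'n::_. monomial \<alpha> x * monomial \<beta> x) = monomial (map2 (+) \<alpha> \<beta>)"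
      using monomial \<open>\<alpha> \<in> _\<close> by (auto simp: exponents_def monomial_mult)
    also have "\<dots> \<in> poly_space (a + c) (b + d)"
      using monomial \<open>\<alpha> \<in> _\<close>
      by (intro monomial_in_poly_space) (auto simp: exponents_def sum_list_map2_plus)
    finally show ?case .
  next
    case (cmult k p)
    then show ?case using poly_space_cmult[OF cmult, of k] by (simp add: mult.left_commute)
  qed (auto simp: distrib_left intro: poly_space_0 poly_space_add)
next
  case (cmult k p)
  then show ?case using poly_space_cmult[OF cmult, of k] by (simp add: mult.assoc)
qed (auto simp: distrib_right intro: poly_space_0 poly_space_add)

text \<open>Homogeneity lets the terms of a fixed total degree be isolated by restricting a
  polynomial to the ray through \<open>x\<close>.\<close>

lemma monomial_scaleR:
  assumes "length \<alpha> = CARD('n)"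
  shows "monomial \<alpha> (t *\<^sub>R x :: real^'n::{finite,linorder}) = t ^ sum_list \<alpha> * monomial \<alpha> x"
  by (simp add: monomial_def power_mult_distrib prod.distrib power_sum[symmetric]
      sum_list_sum_nth atLeast0LessThan)

lemma poly_space_at_0:
  assumes "p \<in> poly_space d1 d2" "d1 \<ge> 1"
  shows "p (0 :: real^'n::{finite,linorder}) = 0"
  using assms(1)
proof (induction rule: poly_space_induct)
  case (monomial \<alpha>)
  then show ?case
    using monomial_scaleR[of \<alpha> 0 "0 :: real^'n::_"] assms(2)
    by (simp add: exponents_def power_0_left del: sum_list_eq_0_iff)
qed auto

text \<open>The low-order terms may be dropped as soon as their sum vanishes as a function, without
  looking at single coefficients.\<close>

lemma poly_space_drop_low:
  fixes p :: "real^'n::{finite,linorder} \<Rightarrow> real"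
  assumes "\<And>x. p x = (\<Sum>\<alpha>\<in>exponents CARD('n) 0 d. a \<alpha> * monomial \<alpha> x)"
    and "\<And>x :: real^'n::_. (\<Sum>\<alpha>\<in>{\<alpha> \<in> exponents CARD('n) 0 d. sum_list \<alpha> < k}. a \<alpha> * monomial \<alpha> x) = 0"
  shows "p \<in> poly_space k d"
proof -
  have "p x = (\<Sum>\<alpha>\<in>exponents CARD('n) k d. a \<alpha> * monomial \<alpha> x)" for x
  proof -
    let ?E = "exponents CARD('n) 0 d"
    have "exponents CARD('n) k d = ?E - {\<alpha> \<in> ?E. sum_list \<alpha> < k}"
      by (auto simp: exponents_def)
    then show ?thesis
      using sum.subset_diff[of "{\<alpha> \<in> ?E. sum_list \<alpha> < k}" ?E "\<lambda>\<alpha>. a \<alpha> * monomial \<alpha> x"]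
        assms(1)[of x] assms(2)[of x]
      by simp
  qed
  then show ?thesis by (rule poly_spaceI)
qed

lemma poly_space_1_of_zero:
  fixes p :: "real^'n::{finite,linorder} \<Rightarrow> real"
  assumes "p \<in> poly_space 0 d" "p 0 = 0"
  shows "p \<in> poly_space 1 d"
proof -
  obtain a where a: "p x = (\<Sum>\<alpha>\<in>exponents CARD('n) 0 d. a \<alpha> * monomial \<alpha> x)" for x
    using assms(1) by (auto simp: poly_space_def)
  show ?thesis
  proof (rule poly_space_drop_low[OF a])
    fix x :: "real^'n::_"
    \<comment> \<open>By homogeneity, evaluation at \<open>0 *\<^sub>R x\<close> keeps exactly the
      terms of degree 0, because \<open>0 ^ 0 = 1\<close>.\<close>
    have "0 = p (0 *\<^sub>R x)" using assms(2) by simp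
    also have "\<dots> = (\<Sum>\<alpha>\<in>exponents CARD('n) 0 d. a \<alpha> * (0 ^ sum_list \<alpha> * monomial \<alpha> x))"
      unfolding a by (intro sum.cong refl) (simp only: monomial_scaleR exponents_def mem_Collect_eq)
    also have "\<dots> = (\<Sum>\<alpha>\<in>{\<alpha> \<in> exponents CARD('n) 0 d. sum_list \<alpha> < 1}. a \<alpha> * monomial \<alpha> x)"
      by (rule sum.mono_neutral_cong_right) (auto simp: power_0_left)
    finally show "(\<Sum>\<alpha>\<in>{\<alpha> \<in> exponents CARD('n) 0 d. sum_list \<alpha> < 1}. a \<alpha> * monomial \<alpha> x) = 0"
      by simp
  qed
qed

text \<open>The origin is a minimum, so the derivative along every ray vanishes there, and that
  derivative is the linear part of \<open>p\<close>.\<close>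

lemma poly_space_2_of_nonneg:
  fixes p :: "real^'n::{finite,linorder} \<Rightarrow> real"
  assumes "p \<in> poly_space 0 d" "p 0 = 0" "\<And>x. p x \<ge> 0"
  shows "p \<in> poly_space 2 d"
proof -
  let ?E = "exponents CARD('n) 1 d"
  have "p \<in> poly_space 1 d" by (rule poly_space_1_of_zero[OF assms(1,2)])
  then obtain a where a: "p x = (\<Sum>\<alpha>\<in>?E. a \<alpha> * monomial \<alpha> x)" for x
    by (auto simp: poly_space_def)
  have lin: "(\<Sum>\<alpha>\<in>{\<alpha> \<in> ?E. sum_list \<alpha> = 1}. a \<alpha> * monomial \<alpha> x) = 0" for x :: "real^'n::_"
  proof -
    have p: "p (t *\<^sub>R x) = (\<Sum>\<alpha>\<in>?E. a \<alpha> * (t ^ sum_list \<alpha> * monomial \<alpha> x))" for t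
      unfolding a by (intro sum.cong refl) (simp only: monomial_scaleR exponents_def mem_Collect_eq)
    have "((\<lambda>t. p (t *\<^sub>R x)) has_real_derivative
      (\<Sum>\<alpha>\<in>?E. a \<alpha> * (real (sum_list \<alpha>) * 0 ^ (sum_list \<alpha> - 1) * monomial \<alpha> x))) (at 0)"
      unfolding p by (auto intro!: derivative_eq_intros sum.cong)
    then have "(\<Sum>\<alpha>\<in>?E. a \<alpha> * (real (sum_list \<alpha>) * 0 ^ (sum_list \<alpha> - 1) * monomial \<alpha> x)) = 0"
      by (rule DERIV_local_min[of _ _ _ 1]) (use assms in auto)
    also have "(\<Sum>\<alpha>\<in>?E. a \<alpha> * (real (sum_list \<alpha>) * 0 ^ (sum_list \<alpha> - 1) * monomial \<alpha> x)) =
      (\<Sum>\<alpha>\<in>{\<alpha> \<in> ?E. sum_list \<alpha> = 1}. a \<alpha> * monomial \<alpha> x)"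
      by (rule sum.mono_neutral_cong_right[OF finite_exponents])
        (auto simp: power_0_left exponents_def)
    finally show ?thesis .
  qed
  have "p x = (\<Sum>\<alpha>\<in>exponents CARD('n) 2 d. a \<alpha> * monomial \<alpha> x)" for x
  proof -
    have "exponents CARD('n) 2 d = ?E - {\<alpha> \<in> ?E. sum_list \<alpha> = 1}"
      by (auto simp: exponents_def)
    then show ?thesis
      using sum.subset_diff[of "{\<alpha> \<in> ?E. sum_list \<alpha> = 1}" ?E "\<lambda>\<alpha>. a \<alpha> * monomial \<alpha> x"] a lin
      by simp
  qed
  then show ?thesis by (rule poly_spaceI)
qed

lemma inner_vec_coord:
  "(v :: real^'n::{finite,linorder}) \<bullet> w = (\<Sum>k<CARD('n). v $ coord k * w $ coord k)"
  unfolding inner_vec_def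
  using sum.reindex_bij_betw[OF bij_coord[where 'n='n], of "\<lambda>i. v $ i * w $ i"] by simp

section \<open>Gradients of polynomials\<close>

text \<open>When an exponent is 0, the truncated subtraction leaves it at 0, but then the factor
  \<open>real (\<alpha> ! k)\<close> makes the component vanish.\<close>

lemma GDERIV_monomial:
  fixes x :: "real^'n::{finite,linorder}"
  assumes "length \<alpha> = CARD('n)"
  shows "GDERIV (monomial \<alpha>) x :>
    (\<chi> i. let k = card {j. j < i} in real (\<alpha> ! k) * monomial (\<alpha>[k := \<alpha> ! k - 1]) x)"
proof -
  let ?n = "CARD('n)"
  have main: "((\<lambda>x. \<Prod>k<?n. (x $ coord k) ^ (\<alpha> ! k)) has_derivative
     (\<lambda>h. \<Sum>k<?n. (of_nat (\<alpha> ! k) * h $ coord k * (x $ coord k) ^ (\<alpha> ! k - 1)) *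
        (\<Prod>l\<in>{..<?n} - {k}. (x $ coord l) ^ (\<alpha> ! l)))) (at x)"
    by (intro has_derivative_prod has_derivative_power bounded_linear_imp_has_derivative
        bounded_linear_vec_nth)
  have summand: "(of_nat (\<alpha> ! k) * h $ coord k * (x $ coord k) ^ (\<alpha> ! k - 1)) *
        (\<Prod>l\<in>{..<?n} - {k}. (x $ coord l) ^ (\<alpha> ! l)) =
      h $ coord k * (real (\<alpha> ! k) * monomial (\<alpha>[k := \<alpha> ! k - 1]) x)" if "k < ?n" for k h
  proof -
    have "monomial (\<alpha>[k := \<alpha> ! k - 1]) x = (x $ coord k) ^ (\<alpha> ! k - 1) *
       (\<Prod>l\<in>{..<?n} - {k}. (x $ coord l) ^ (\<alpha>[k := \<alpha> ! k - 1] ! l))"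
      unfolding monomial_def
      using prod.remove[of "{..<?n}" k "\<lambda>l. (x $ coord l) ^ (\<alpha>[k := \<alpha> ! k - 1] ! l)"] that assms
      by simp
    also have "(\<Prod>l\<in>{..<?n} - {k}. (x $ coord l) ^ (\<alpha>[k := \<alpha> ! k - 1] ! l)) =
        (\<Prod>l\<in>{..<?n} - {k}. (x $ coord l) ^ (\<alpha> ! l))"
      by (intro prod.cong) auto
    finally show ?thesis by simp
  qed
  have "((\<lambda>x. \<Prod>k<?n. (x $ coord k) ^ (\<alpha> ! k)) has_derivative
     (\<lambda>h. \<Sum>k<?n. h $ coord k * (real (\<alpha> ! k) * monomial (\<alpha>[k := \<alpha> ! k - 1]) x))) (at x)"
    by (rule has_derivative_eq_rhs[OF main]) (intro ext sum.cong refl summand, simp)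
  then show ?thesis
    unfolding gderiv_def inner_vec_coord
    by (simp add: assms monomial_def[of \<alpha>, abs_def] card_less_coord Let_def cong: sum.cong_simp)
qed

lemma GDERIV_poly_space:
  fixes p :: "real^'n::{finite,linorder} \<Rightarrow> real"
  assumes "p \<in> poly_space d1 d2"
  shows "(\<forall>x. GDERIV p x :> grad p x) \<and> (\<forall>i. (\<lambda>x. grad p x $ i) \<in> poly_space (d1 - 1) (d2 - 1))"
proof -
  have "\<exists>D. (\<forall>x. GDERIV p x :> D x) \<and> (\<forall>i. (\<lambda>x. D x $ i) \<in> poly_space (d1 - 1) (d2 - 1))"
    using assms
  proof (induction rule: poly_space_induct)
    case (monomial \<alpha>)
    show ?case
    proof (intro exI conjI allI)
      show "GDERIV (monomial \<alpha>) x :>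
          (\<chi> i. let k = card {j. j < i} in real (\<alpha> ! k) * monomial (\<alpha>[k := \<alpha> ! k - 1]) x)" for x :: "real^'n::_"
        using monomial by (intro GDERIV_monomial) (auto simp: exponents_def)
      fix i :: 'n
      define k where "k = card {j. j < i}"
      have k: "k < length \<alpha>" using monomial card_less_CARD[of i] by (simp add: k_def exponents_def)
      have "(\<lambda>x :: real^'n::_. real (\<alpha> ! k) * monomial (\<alpha>[k := \<alpha> ! k - 1]) x) \<in> poly_space (d1 - 1) (d2 - 1)"
      proof (cases "\<alpha> ! k = 0")
        case True
        then show ?thesis by (simp add: poly_space_0)
      next
        case False
        then have "sum_list (\<alpha>[k := \<alpha> ! k - 1]) = sum_list \<alpha> - 1"
          using k by (simp add: sum_list_update)
        then show ?thesis
          using monomial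
          by (intro poly_space_cmult monomial_in_poly_space) (auto simp: exponents_def)
      qed
      then show "(\<lambda>x :: real^'n::_. (\<chi> i. let k = card {j. j < i} in real (\<alpha> ! k) * monomial (\<alpha>[k := \<alpha> ! k - 1]) x) $ i)
          \<in> poly_space (d1 - 1) (d2 - 1)"
        by (simp add: k_def Let_def)
    qed
  next
    case zero
    show ?case by (rule exI[of _ "\<lambda>_. 0"]) (auto simp: GDERIV_const poly_space_0)
  next
    case (add p q)
    then obtain D E where "\<forall>x. GDERIV p x :> D x" "\<forall>i. (\<lambda>x. D x $ i) \<in> poly_space (d1 - 1) (d2 - 1)"
      "\<forall>x. GDERIV q x :> E x" "\<forall>i. (\<lambda>x. E x $ i) \<in> poly_space (d1 - 1) (d2 - 1)" by blast
    then show ?case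
      by (intro exI[of _ "\<lambda>x. D x + E x"]) (auto intro: GDERIV_add poly_space_add)
  next
    case (cmult c p)
    then obtain D where "\<forall>x. GDERIV p x :> D x" "\<forall>i. (\<lambda>x. D x $ i) \<in> poly_space (d1 - 1) (d2 - 1)"
      by blast
    moreover from this have "GDERIV (\<lambda>x. c * p x) x :> c *\<^sub>R D x" for x
      using GDERIV_mult[OF GDERIV_const[of c], of p x "D x"] by simp
    ultimately show ?case
      by (intro exI[of _ "\<lambda>x. c *\<^sub>R D x"]) (auto intro: poly_space_cmult)
  qed
  then obtain D where D: "\<And>x. GDERIV p x :> D x" "\<And>i. (\<lambda>x. D x $ i) \<in> poly_space (d1 - 1) (d2 - 1)"
    by blast
  moreover have "grad p = D" using grad_eqI[OF D(1)] by auto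
  ultimately show ?thesis by auto
qed

section \<open>Polynomials without degree bounds: closure, continuity and Lipschitz constants on
  balls\<close>

lemma is_polynomialI: "p \<in> poly_space d1 d2 \<Longrightarrow> is_polynomial p"
  unfolding is_polynomial_def using poly_space_mono[of p d1 d2 0 d2] by auto

lemma is_polynomial_poly_degree: "is_polynomial p \<Longrightarrow> p \<in> poly_space 0 (poly_degree p)"
  unfolding is_polynomial_def poly_degree_def by (rule LeastI_ex)

lemma poly_space_common:
  assumes "is_polynomial p" "is_polynomial q"
  obtains d where "p \<in> poly_space 0 d" "q \<in> poly_space 0 d"
proof -
  obtain a b where "p \<in> poly_space 0 a" "q \<in> poly_space 0 b"
    using assms by (auto simp: is_polynomial_def)
  then have "p \<in> poly_space 0 (max a b)" "q \<in> poly_space 0 (max a b)"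
    by (auto elim: poly_space_mono)
  then show thesis by (rule that)
qed

lemma poly_space_const: "(\<lambda>x :: real^'n::{finite,linorder}. c) \<in> poly_space 0 0"
proof -
  have "(monomial (replicate CARD('n) 0) :: real^'n::_ \<Rightarrow> real) \<in> poly_space 0 0"
    by (rule monomial_in_poly_space) (simp add: exponents_def sum_list_replicate)
  moreover have "monomial (replicate CARD('n) 0) = (\<lambda>x :: real^'n::_. 1)"
    by (simp add: monomial_def fun_eq_iff)
  ultimately show ?thesis using poly_space_cmult[of "\<lambda>x. 1" 0 0 c] by simp
qed

lemma is_polynomial_const: "is_polynomial (\<lambda>x. c)"
  using poly_space_const by (rule is_polynomialI)

lemma is_polynomial_add:
  assumes "is_polynomial p" "is_polynomial q"
  shows "is_polynomial (\<lambda>x. p x + q x)"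
proof -
  obtain d where "p \<in> poly_space 0 d" "q \<in> poly_space 0 d"
    using assms by (rule poly_space_common)
  then show ?thesis by (rule is_polynomialI[OF poly_space_add])
qed

lemma is_polynomial_mult:
  assumes "is_polynomial p" "is_polynomial q"
  shows "is_polynomial (\<lambda>x. p x * q x)"
proof -
  obtain d where "p \<in> poly_space 0 d" "q \<in> poly_space 0 d"
    using assms by (rule poly_space_common)
  then show ?thesis by (rule is_polynomialI[OF poly_space_mult])
qed

lemma is_polynomial_diff:
  assumes "is_polynomial p" "is_polynomial q"
  shows "is_polynomial (\<lambda>x. p x - q x)"
proof -
  obtain d where "p \<in> poly_space 0 d" "q \<in> poly_space 0 d"
    using assms by (rule poly_space_common)
  then show ?thesis by (rule is_polynomialI[OF poly_space_diff])
qed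

lemma is_polynomial_sum:
  "(\<And>i. i \<in> I \<Longrightarrow> is_polynomial (p i)) \<Longrightarrow> is_polynomial (\<lambda>x. \<Sum>i\<in>I. p i x)"
  by (induction I rule: infinite_finite_induct) (simp_all add: is_polynomial_const is_polynomial_add)

lemma polynomial_GDERIV: "is_polynomial p \<Longrightarrow> GDERIV p x :> grad p x"
  unfolding is_polynomial_def by (erule exE) (drule GDERIV_poly_space, blast)

lemma polynomial_continuous: "is_polynomial p \<Longrightarrow> continuous_on S p"
  by (intro continuous_at_imp_continuous_on ballI
      has_derivative_continuous[OF polynomial_GDERIV[unfolded gderiv_def]])

lemma polynomial_continuous_grad: "is_polynomial p \<Longrightarrow> continuous_on S (grad p)"
proof -
  assume "is_polynomial p"
  then obtain d where "p \<in> poly_space 0 d" by (auto simp: is_polynomial_def)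
  then have "is_polynomial (\<lambda>x. grad p x $ i)" for i
    using GDERIV_poly_space is_polynomialI by blast
  then have "continuous_on S (\<lambda>x. \<chi> i. grad p x $ i)"
    by (intro continuous_on_vec_lambda polynomial_continuous)
  then show ?thesis by simp
qed

lemma polynomial_lipschitz_cball:
  fixes p :: "real^'n::{finite,linorder} \<Rightarrow> real"
  assumes "is_polynomial p"
  shows "\<exists>L. L-lipschitz_on (cball 0 \<rho>) p"
proof -
  have "bounded (grad p ` cball 0 \<rho>)"
    by (intro compact_imp_bounded compact_continuous_image polynomial_continuous_grad assms compact_cball)
  then obtain B where B: "B > 0" "\<And>y. y \<in> cball 0 \<rho> \<Longrightarrow> norm (grad p y) \<le> B"
    by (auto simp: bounded_pos)
  have "B-lipschitz_on (cball 0 \<rho>) p"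
  proof (rule lipschitz_onI)
    fix x y :: "real^'n::_" assume xy: "x \<in> cball 0 \<rho>" "y \<in> cball 0 \<rho>"
    have "norm (p x - p y) \<le> B * norm (x - y)"
    proof (rule differentiable_bound[of "cball 0 \<rho>" p "\<lambda>y h. h \<bullet> grad p y"])
      fix z :: "real^'n::_" assume z: "z \<in> cball 0 \<rho>"
      show "(p has_derivative (\<lambda>h. h \<bullet> grad p z)) (at z within cball 0 \<rho>)"
        using polynomial_GDERIV[OF assms] by (auto simp: gderiv_def intro: has_derivative_at_withinI)
      show "onorm (\<lambda>h. h \<bullet> grad p z) \<le> B"
      proof (rule onorm_bound)
        fix h :: "real^'n::_"
        have "norm (h \<bullet> grad p z) \<le> norm h * norm (grad p z)"
          by (simp add: Cauchy_Schwarz_ineq2)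
        also have "\<dots> \<le> norm h * B" using B(2)[OF z] by (intro mult_left_mono) auto
        finally show "norm (h \<bullet> grad p z) \<le> B * norm h" by (simp add: mult.commute)
      qed (use B in auto)
    qed (use xy in auto)
    then show "dist (p x) (p y) \<le> B * dist x y" by (simp add: dist_norm)
  qed (use B in auto)
  then show ?thesis by blast
qed

lemma polynomial_map_lipschitz_cball:
  fixes F :: "real^'n::{finite,linorder} \<Rightarrow> real^'k"
  assumes "\<And>i. is_polynomial (\<lambda>x. F x $ i)"
  shows "\<exists>L. L-lipschitz_on (cball 0 \<rho>) F"
proof -
  obtain L where L: "\<And>i. (L i)-lipschitz_on (cball 0 \<rho>) (\<lambda>x. F x $ i)"
    using polynomial_lipschitz_cball[OF assms] by metis
  have "(\<Sum>i\<in>UNIV. L i)-lipschitz_on (cball 0 \<rho>) F"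
  proof (rule lipschitz_onI)
    fix x y :: "real^'n::_" assume xy: "x \<in> cball 0 \<rho>" "y \<in> cball 0 \<rho>"
    have "dist (F x) (F y) \<le> (\<Sum>i\<in>UNIV. \<bar>(F x - F y) $ i\<bar>)"
      unfolding dist_norm by (rule norm_le_l1_cart)
    also have "\<dots> \<le> (\<Sum>i\<in>UNIV. L i * dist x y)"
      using lipschitz_onD[OF L xy] by (intro sum_mono) (simp add: dist_real_def)
    finally show "dist (F x) (F y) \<le> (\<Sum>i\<in>UNIV. L i) * dist x y"
      by (simp add: sum_distrib_right)
  qed (intro sum_nonneg lipschitz_on_nonneg[OF L])
  then show ?thesis by blast
qed

section \<open>Coefficient vectors and limits of polynomials\<close>

lemma scalar_prod_monomials:
  fixes x :: "real^'n::{finite,linorder}"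
  shows "scalar_prod a (monomials d1 d2 x) =
    (\<Sum>k<card (exponents CARD('n) d1 d2).
       vec_index a k * monomial (rev (sorted_list_of_set (exponents CARD('n) d1 d2)) ! k) x)"
  by (auto simp: scalar_prod_def monomials_def vec_of_list_index atLeast0LessThan intro!: sum.cong)

lemma dim_monomials:
  "dim_vec (monomials d1 d2 (x :: real^'n::{finite,linorder})) = card (exponents CARD('n) d1 d2)"
  by (simp add: monomials_def)

lemma scalar_prod_monomials_poly_space:
  "(\<lambda>x :: real^'n::{finite,linorder}. scalar_prod a (monomials d1 d2 x)) \<in> poly_space d1 d2"
  unfolding scalar_prod_monomials
proof (intro poly_space_sum poly_space_cmult monomial_in_poly_space)
  let ?E = "exponents CARD('n) d1 d2"
  fix k assume "k \<in> {..<card ?E}"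
  then have "rev (sorted_list_of_set ?E) ! k \<in> set (rev (sorted_list_of_set ?E))"
    by (intro nth_mem) auto
  then show "rev (sorted_list_of_set ?E) ! k \<in> ?E" by simp
qed

lemma poly_space_scalar_prodE:
  fixes p :: "real^'n::{finite,linorder} \<Rightarrow> real"
  assumes "p \<in> poly_space d1 d2"
  obtains a where "a \<in> carrier_vec (card (exponents CARD('n) d1 d2))"
    "\<And>x. p x = scalar_prod a (monomials d1 d2 x)"
proof -
  let ?E = "exponents CARD('n) d1 d2" and ?es = "rev (sorted_list_of_set (exponents CARD('n) d1 d2))"
  obtain b where b: "p x = (\<Sum>\<alpha>\<in>?E. b \<alpha> * monomial \<alpha> x)" for x
    using assms by (auto simp: poly_space_def)
  define a where "a = Matrix.vec (card ?E) (\<lambda>k. b (?es ! k))"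
  show thesis
  proof
    show "a \<in> carrier_vec (card ?E)" by (simp add: a_def)
    fix x :: "real^'n::_"
    have "p x = sum_list (map (\<lambda>\<alpha>. b \<alpha> * monomial \<alpha> x) ?es)"
      unfolding b by (subst sum_list_distinct_conv_sum_set) auto
    also have "\<dots> = scalar_prod a (monomials d1 d2 x)"
      by (simp add: sum_list_sum_nth scalar_prod_monomials a_def atLeast0LessThan)
    finally show "p x = scalar_prod a (monomials d1 d2 x)" .
  qed
qed

text \<open>An instance of \<open>finite_span_pointwise_limit\<close>: the companion family consists
  of the partial derivatives of the monomials, indexed by a point and a coordinate. Linear relations
  carry over because the zero function has zero gradient.\<close>

lemma poly_space_pointwise_limit:
  fixes p :: "nat \<Rightarrow> real^'n::{finite,linorder} \<Rightarrow> real"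
  assumes p: "\<And>k. p k \<in> poly_space d1 d2" and lim: "\<And>x. (\<lambda>k. p k x) \<longlonglongrightarrow> h x"
  shows "h \<in> poly_space d1 d2" "(\<lambda>k. grad (p k) x) \<longlonglongrightarrow> grad h x"
proof -
  let ?E = "exponents CARD('n) d1 d2"
  obtain a where a: "\<And>k. p k = (\<lambda>x. \<Sum>\<alpha>\<in>?E. a k \<alpha> * monomial \<alpha> x)"
    using p unfolding poly_space_def by simp metis
  have gm: "GDERIV (monomial \<alpha>) x :> grad (monomial \<alpha>) x" if "\<alpha> \<in> ?E" for \<alpha> and x :: "real^'n::_"
    using GDERIV_poly_space[OF monomial_in_poly_space[OF that]] by blast
  have g: "grad (\<lambda>x. \<Sum>\<alpha>\<in>?E. b \<alpha> * monomial \<alpha> x) x = (\<Sum>\<alpha>\<in>?E. b \<alpha> *\<^sub>R grad (monomial \<alpha>) x)"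
    for b and x :: "real^'n::_"
    by (rule grad_eqI) (use gm in \<open>auto simp: gderiv_def inner_sum_right intro!: derivative_eq_intros sum.cong\<close>)
  have *: "\<exists>s. h = (\<lambda>x. \<Sum>\<alpha>\<in>?E. s \<alpha> * monomial \<alpha> x) \<and>
    (\<forall>z :: (real^'n::_) \<times> 'n. (\<lambda>k. \<Sum>\<alpha>\<in>?E. a k \<alpha> * (grad (monomial \<alpha>) (fst z) $ snd z)) \<longlonglongrightarrow>
       (\<Sum>\<alpha>\<in>?E. s \<alpha> * (grad (monomial \<alpha>) (fst z) $ snd z)))"
  proof (rule finite_span_pointwise_limit[where b = monomial
        and c = "\<lambda>\<alpha> z. grad (monomial \<alpha>) (fst z) $ snd z"])
    show "finite ?E" by simp
    show "(\<lambda>k. \<Sum>\<alpha>\<in>?E. a k \<alpha> * monomial \<alpha> x) \<longlonglongrightarrow> h x" for x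
      using lim[of x] by (simp add: a)
    fix b and z :: "(real^'n::_) \<times> 'n"
    assume "\<And>y :: real^'n::_. (\<Sum>\<alpha>\<in>?E. b \<alpha> * monomial \<alpha> y) = 0"
    then have "grad (\<lambda>x. \<Sum>\<alpha>\<in>?E. b \<alpha> * monomial \<alpha> x) (fst z) = 0"
      by (intro grad_eqI) (simp add: GDERIV_const)
    then have "(\<Sum>\<alpha>\<in>?E. b \<alpha> *\<^sub>R grad (monomial \<alpha>) (fst z)) $ snd z = 0"
      by (simp add: g)
    then show "(\<Sum>\<alpha>\<in>?E. b \<alpha> * (grad (monomial \<alpha>) (fst z) $ snd z)) = 0" by simp
  qed
  then obtain s where s: "h = (\<lambda>x. \<Sum>\<alpha>\<in>?E. s \<alpha> * monomial \<alpha> x)"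
    "\<And>(x :: real^'n::_) i. (\<lambda>k. \<Sum>\<alpha>\<in>?E. a k \<alpha> * (grad (monomial \<alpha>) x $ i)) \<longlonglongrightarrow>
       (\<Sum>\<alpha>\<in>?E. s \<alpha> * (grad (monomial \<alpha>) x $ i))" by force
  show "h \<in> poly_space d1 d2" using s(1) unfolding poly_space_def by blast
  show "(\<lambda>k. grad (p k) x) \<longlonglongrightarrow> grad h x"
    by (rule vec_tendstoI) (use s(2)[of x] in \<open>simp add: a s(1) g\<close>)
qed

subsection \<open>Sums of squares and the Hamiltonian\<close>

text \<open>Lagrange reduction: complete the square in one variable and recurse on the rest. It
  matters that \<open>ws\<close> does not depend on \<open>v\<close>, since polynomials are
  substituted for the entries of \<open>v\<close>.\<close>

lemma positive_form_sum_squares: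
  fixes a :: "'i \<Rightarrow> 'i \<Rightarrow> real"
  assumes "finite A" and "\<And>i j. a i j = a j i"
    and "\<And>v. (\<exists>i\<in>A. v i \<noteq> 0) \<Longrightarrow> (\<Sum>i\<in>A. \<Sum>j\<in>A. a i j * v i * v j) > 0"
  shows "\<exists>ws. \<forall>v. (\<Sum>i\<in>A. \<Sum>j\<in>A. a i j * v i * v j) = (\<Sum>w\<leftarrow>ws. (\<Sum>i\<in>A. w i * v i)\<^sup>2)"
  using assms
proof (induction A arbitrary: a rule: finite_induct)
  case empty
  show ?case by (rule exI[of _ "[]"]) simp
next
  case (insert k A a)
  define s where "s v = (\<Sum>j\<in>A. a k j * v j)" for v
  have expand: "(\<Sum>i\<in>insert k A. \<Sum>j\<in>insert k A. a i j * v i * v j) =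
      a k k * (v k)\<^sup>2 + 2 * v k * s v + (\<Sum>i\<in>A. \<Sum>j\<in>A. a i j * v i * v j)" for v
  proof -
    have "(\<Sum>i\<in>insert k A. \<Sum>j\<in>insert k A. a i j * v i * v j) =
      a k k * v k * v k + (\<Sum>j\<in>A. a k j * v k * v j) + ((\<Sum>i\<in>A. a i k * v i * v k) + (\<Sum>i\<in>A. \<Sum>j\<in>A. a i j * v i * v j))"
      using insert.hyps by (simp add: sum.distrib)
    moreover have "(\<Sum>j\<in>A. a k j * v k * v j) = v k * s v" "(\<Sum>i\<in>A. a i k * v i * v k) = v k * s v"
      by (auto simp: s_def sum_distrib_left insert.prems(1)[of _ k] intro!: sum.cong)
    ultimately show ?thesis by (simp add: power2_eq_square)
  qed
  have cong: "(\<Sum>i\<in>A. \<Sum>j\<in>A. b i j * (v(k := c)) i * (v(k := c)) j) = (\<Sum>i\<in>A. \<Sum>j\<in>A. b i j * v i * v j)"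
    "s (v(k := c)) = s v" "(\<Sum>i\<in>A. (v(k := c)) i * z i) = (\<Sum>i\<in>A. v i * z i)" for b v c z
    unfolding s_def using insert.hyps by (auto intro!: sum.cong)
  \<comment> \<open>Evaluating the form at the unit vector of \<open>k\<close> shows that the pivot
    \<open>a k k\<close> is positive.\<close>
  have "s (\<lambda>i. if i = k then 1 else 0) = 0"
    unfolding s_def using insert.hyps by (intro sum.neutral) auto
  moreover have "(\<Sum>i\<in>A. \<Sum>j\<in>A. a i j * (if i = k then 1 else 0) * (if j = k then 1 else 0)) = 0"
    using insert.hyps by (intro sum.neutral ballI) auto
  ultimately have akk: "a k k > 0"
    using insert.prems(2)[of "\<lambda>i. if i = k then 1 else 0"] by (simp add: expand)
  \<comment> \<open>The Schur complement of the pivot: the form that remains after the square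
    containing \<open>v k\<close> has been split off.\<close>
  define b where "b i j = a i j - a k i * a k j / a k k" for i j
  have b: "(\<Sum>i\<in>A. \<Sum>j\<in>A. b i j * v i * v j) = (\<Sum>i\<in>A. \<Sum>j\<in>A. a i j * v i * v j) - (s v)\<^sup>2 / a k k" for v
  proof -
    have "(s v)\<^sup>2 / a k k = (\<Sum>i\<in>A. \<Sum>j\<in>A. a k i * a k j / a k k * v i * v j)"
      unfolding s_def power2_eq_square sum_product sum_divide_distrib
      by (simp add: mult.assoc mult.left_commute divide_simps)
    then show ?thesis
      by (simp add: b_def left_diff_distrib sum_subtractf)
  qed
  have sq: "(\<Sum>i\<in>insert k A. \<Sum>j\<in>insert k A. a i j * v i * v j) =
      (sqrt (a k k) * v k + s v / sqrt (a k k))\<^sup>2 + (\<Sum>i\<in>A. \<Sum>j\<in>A. b i j * v i * v j)" for v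
    using akk by (simp add: expand b power2_sum power_mult_distrib power_divide)
  have "\<exists>ws. \<forall>v. (\<Sum>i\<in>A. \<Sum>j\<in>A. b i j * v i * v j) = (\<Sum>w\<leftarrow>ws. (\<Sum>i\<in>A. w i * v i)\<^sup>2)"
  proof (rule insert.IH)
    show "b i j = b j i" for i j using insert.prems(1)[of i j] by (simp add: b_def mult.commute)
    fix v :: "'i \<Rightarrow> real" assume v: "\<exists>i\<in>A. v i \<noteq> 0"
    \<comment> \<open>This value at \<open>k\<close> makes the completed square vanish, so the
      remaining form at \<open>v\<close> equals the whole form at \<open>?v\<close> and inherits its
      positivity.\<close>
    let ?v = "v(k := - s v / a k k)"
    have "(sqrt (a k k) * ?v k + s ?v / sqrt (a k k)) = 0"
      unfolding cong using akk by (simp add: field_simps)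
    moreover have "\<exists>i\<in>insert k A. ?v i \<noteq> 0" using v insert.hyps by auto
    ultimately show "(\<Sum>i\<in>A. \<Sum>j\<in>A. b i j * v i * v j) > 0"
      using insert.prems(2)[of ?v] unfolding sq cong by simp
  qed
  then obtain ws where ws: "\<And>v. (\<Sum>i\<in>A. \<Sum>j\<in>A. b i j * v i * v j) = (\<Sum>w\<leftarrow>ws. (\<Sum>i\<in>A. w i * v i)\<^sup>2)"
    by blast
  \<comment> \<open>The linear form inside the completed square; the forms obtained recursively are
    extended by 0 at \<open>k\<close>.\<close>
  define w0 where "w0 = (\<lambda>i. a k i / sqrt (a k k))(k := sqrt (a k k))"
  have w0: "(\<Sum>i\<in>insert k A. w0 i * v i) = sqrt (a k k) * v k + s v / sqrt (a k k)" for v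
    using insert.hyps unfolding w0_def
    by (simp add: cong s_def sum_divide_distrib fun_upd_same del: fun_upd_apply)
  have ext: "(\<Sum>i\<in>insert k A. (w(k := 0)) i * v i) = (\<Sum>i\<in>A. w i * v i)"
    for w v :: "'i \<Rightarrow> real"
    using insert.hyps by (simp add: cong fun_upd_same del: fun_upd_apply)
  show ?case
  proof (intro exI allI)
    fix v
    show "(\<Sum>i\<in>insert k A. \<Sum>j\<in>insert k A. a i j * v i * v j) =
        (\<Sum>w\<leftarrow>w0 # map (\<lambda>w. w(k := 0)) ws. (\<Sum>i\<in>insert k A. w i * v i)\<^sup>2)"
      unfolding sq ws list.map sum_list.Cons w0 map_map o_def ext ..
  qed
qed

lemma inner_matrix_eq_sum:
  "v \<bullet> (R *v w) = (\<Sum>i\<in>UNIV. \<Sum>j\<in>UNIV. R $ i $ j * v $ i * (w :: real^'m) $ j)"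
  by (simp add: inner_vec_def matrix_vector_mult_def sum_distrib_left mult.commute mult.left_commute)

lemma SOS_add: "SOS p \<Longrightarrow> SOS q \<Longrightarrow> SOS (\<lambda>x. p x + q x)"
  unfolding SOS_def
proof (elim exE conjE)
  fix hs ks assume "\<forall>h\<in>set hs. is_polynomial h" "\<forall>h\<in>set ks. is_polynomial h"
    "p = (\<lambda>x. \<Sum>h\<leftarrow>hs. (h x)\<^sup>2)" "q = (\<lambda>x. \<Sum>h\<leftarrow>ks. (h x)\<^sup>2)"
  then show "\<exists>hs. (\<forall>h\<in>set hs. is_polynomial h) \<and> (\<lambda>x. p x + q x) = (\<lambda>x. \<Sum>h\<leftarrow>hs. (h x)\<^sup>2)"
    by (intro exI[of _ "hs @ ks"]) auto
qed

lemma SOS_0: "SOS (\<lambda>x. 0)"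
  unfolding SOS_def by (rule exI[of _ "[]"]) simp

lemma SOS_nonneg: "SOS p \<Longrightarrow> p x \<ge> 0"
  unfolding SOS_def by (auto intro!: sum_list_nonneg)

text \<open>The linear forms that diagonalise \<open>R\<close> have constant coefficients, so
  composing them with the polynomial map \<open>v\<close> gives the polynomials to be
  squared.\<close>

lemma SOS_quadratic_form:
  fixes v :: "real^'n::{finite,linorder} \<Rightarrow> real^'m"
  assumes "transpose R = R" "positive_definite_mat R" "\<And>i. is_polynomial (\<lambda>x. v x $ i)"
  shows "SOS (\<lambda>x. v x \<bullet> (R *v v x))"
proof -
  have "\<exists>ws. \<forall>c. (\<Sum>i\<in>UNIV. \<Sum>j\<in>UNIV. R $ i $ j * c i * c j) = (\<Sum>w\<leftarrow>ws. (\<Sum>i\<in>UNIV. w i * c i)\<^sup>2)"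
  proof (rule positive_form_sum_squares)
    show "R $ i $ j = R $ j $ i" for i j
      using assms(1) by (metis transpose_def vec_lambda_beta)
    fix c :: "'m \<Rightarrow> real" assume "\<exists>i\<in>UNIV. c i \<noteq> 0"
    then obtain i where "(\<chi> i. c i) $ i \<noteq> (0 :: real^'m) $ i" by auto
    then have "(\<chi> i. c i) \<noteq> 0" by metis
    then have "(\<chi> i. c i) \<bullet> (R *v (\<chi> i. c i)) > 0"
      using assms(2) unfolding positive_definite_mat_def by blast
    then show "(\<Sum>i\<in>UNIV. \<Sum>j\<in>UNIV. R $ i $ j * c i * c j) > 0"
      by (simp add: inner_matrix_eq_sum)
  qed simp
  then obtain ws where ws: "\<And>c. (\<Sum>i\<in>UNIV. \<Sum>j\<in>UNIV. R $ i $ j * c i * c j) = (\<Sum>w\<leftarrow>ws. (\<Sum>i\<in>UNIV. w i * c i)\<^sup>2)"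
    by blast
  show ?thesis
    unfolding SOS_def
  proof (intro exI[of _ "map (\<lambda>w x. \<Sum>i\<in>UNIV. w i * v x $ i) ws"] conjI)
    show "\<forall>h\<in>set (map (\<lambda>w x. \<Sum>i\<in>UNIV. w i * v x $ i) ws). is_polynomial h"
      by (auto intro!: is_polynomial_sum is_polynomial_mult is_polynomial_const assms)
    show "(\<lambda>x. v x \<bullet> (R *v v x)) = (\<lambda>x. \<Sum>h\<leftarrow>map (\<lambda>w x. \<Sum>i\<in>UNIV. w i * v x $ i) ws. (h x)\<^sup>2)"
      by (simp add: inner_matrix_eq_sum ws o_def)
  qed
qed

lemma positive_definite_mat_inverse:
  assumes "positive_definite_mat (R :: real^'m^'m)"
  shows "R *v (matrix_inv R *v w) = w"
proof -
  have "x = 0" if "R *v x = 0" for x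
    using assms that unfolding positive_definite_mat_def by (metis inner_zero_right less_irrefl)
  then have "invertible R"
    unfolding invertible_left_inverse matrix_left_invertible_ker by blast
  then have "R ** matrix_inv R = Finite_Cartesian_Product.mat 1"
    unfolding invertible_def matrix_inv_def by (rule someI2_ex) simp
  then show ?thesis by (simp add: matrix_vector_mul_assoc)
qed

lemma inner_matrix_transpose: "x \<bullet> (A *v y) = (transpose A *v x) \<bullet> (y :: real^'m)"
  by (simp add: dot_lmul_matrix)

section \<open>Greedy controls and completion of the square\<close>

text \<open>For positive definite \<open>R\<close> this is, at each state, the control value that
  maximises \<open>L_op\<close>, that is, minimises the derivative of \<open>V\<close> along the
  flow plus the running cost: the policy improvement step.\<close>

definition greedy_control :: "(real^'n \<Rightarrow> real^'m^'n) \<Rightarrow> real^'m^'m \<Rightarrow> (real^'n \<Rightarrow> real) \<Rightarrow>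
    real^'n \<Rightarrow> real^'m" where
  "greedy_control g R V y = - (1/2) *\<^sub>R (matrix_inv R *v (transpose (g y) *v grad V y))"

context
  fixes R :: "real^'m^'m"
  assumes R_sym: "transpose R = R" and R_pd: "positive_definite_mat R"
begin

text \<open>Eliminates \<open>g\<close>: afterwards the input enters only through the form of
  \<open>R\<close> applied to the greedy control. It rests on \<open>R\<close> times the greedy
  control being minus half of \<open>transpose (g y) *v grad V y\<close>, and on the symmetry of
  \<open>R\<close>.\<close>

lemma grad_inner_input:
  "grad V y \<bullet> (g y *v w) = - 2 * (greedy_control g R V y \<bullet> (R *v w))"
proof -
  have "R *v greedy_control g R V y = - (1/2) *\<^sub>R (transpose (g y) *v grad V y)"
    unfolding greedy_control_def matrix_vector_mult_scaleR
    by (simp add: positive_definite_mat_inverse[OF R_pd])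
  then have "(transpose (g y) *v grad V y) \<bullet> w = - 2 * ((R *v greedy_control g R V y) \<bullet> w)"
    by simp
  then show ?thesis by (simp only: inner_matrix_transpose R_sym)
qed

lemma quadratic_form_nonneg: "v \<bullet> (R *v v) \<ge> 0"
  using R_pd unfolding positive_definite_mat_def by (cases "v = 0") (auto simp: less_imp_le)

lemma H_op_greedy:
  "H_op f g q R V y = grad V y \<bullet> f y + q y - greedy_control g R V y \<bullet> (R *v greedy_control g R V y)"
proof -
  let ?u = "greedy_control g R V y"
  have inv: "matrix_inv R *v (transpose (g y) *v grad V y) = (- 2) *\<^sub>R ?u"
    by (simp add: greedy_control_def)
  show ?thesis
    unfolding H_op_def inv grad_inner_input matrix_vector_mult_scaleR inner_scaleR_right by simp
qed

lemma L_op_eq: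
  "L_op f g q R V u y = - (grad V y \<bullet> f y) + 2 * (greedy_control g R V y \<bullet> (R *v u y))
     - q y - u y \<bullet> (R *v u y)"
  unfolding L_op_def running_cost_def inner_add_right grad_inner_input by simp

lemma L_op_complete_square:
  "L_op f g q R V u y = - H_op f g q R V y
     - (u y - greedy_control g R V y) \<bullet> (R *v (u y - greedy_control g R V y))"
proof -
  let ?u = "greedy_control g R V y"
  have "u y \<bullet> (R *v ?u) = ?u \<bullet> (R *v u y)"
    by (metis inner_matrix_transpose R_sym inner_commute)
  then show ?thesis
    unfolding L_op_eq H_op_greedy matrix_vector_mult_diff_distrib
    by (simp add: inner_diff_left inner_diff_right)
qed

lemma L_op_greedy:
  "L_op f g q R V (greedy_control g R V) y =
     L_op f g q R V u y + (u y - greedy_control g R V y) \<bullet> (R *v (u y - greedy_control g R V y))"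
  "L_op f g q R V (greedy_control g R V) y = - H_op f g q R V y"
  by (simp_all add: L_op_complete_square)

end

lemma grad_inner_closed_loop:
  "grad V y \<bullet> (f y + g y *v u y) = - running_cost q R y (u y) - L_op f g q R V u y"
  by (simp add: L_op_def)

subsection \<open>The data matrices\<close>

lemma full_column_rank_inj:
  fixes A :: "real mat"
  assumes A: "A \<in> carrier_mat n nc" and rank: "vec_space.rank n A = nc"
    and v: "v \<in> carrier_vec nc" "w \<in> carrier_vec nc" and eq: "A *\<^sub>v v = A *\<^sub>v w"
  shows "v = w"
proof -
  interpret vec_space "TYPE(real)" n .
  \<comment> \<open>Linear independence speaks about the set of columns and would overlook a
    repeated column. A repetition leaves fewer than \<open>nc\<close> distinct columns, hence a
    smaller rank.\<close>
  have dist: "distinct (cols A)"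
  proof (rule ccontr)
    assume nd: "\<not> distinct (cols A)"
    obtain S where S: "maximal S (\<lambda>T. T \<subseteq> set (cols A) \<and> lin_indpt T)"
      using maximal_exists[of "(\<lambda>T. T \<subseteq> set (cols A) \<and> lin_indpt T)" "card (set (cols A))" "{}"]
      by (meson List.finite_set card_mono empty_iff empty_subsetI finite_lin_indpt2 rev_finite_subset)
    then have "card S \<le> card (set (cols A))" by (simp add: card_mono maximal_def)
    also have "\<dots> < nc"
      using A nd card_distinct[of "cols A"] card_length[of "cols A"] by (cases "card (set (cols A)) = nc") auto
    finally show False
      using rank_card_indpt[OF A S] rank by simp
  qed
  have "lin_indpt (set (cols A))" by (rule full_rank_lin_indpt[OF A rank dist])
  moreover have "A *\<^sub>v (v - w) = 0\<^sub>v n"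
    using A v eq by (simp add: mult_minus_distrib_mat_vec)
  ultimately have "v - w = 0\<^sub>v nc"
    using lin_depI[OF A, of "v - w"] v dist by auto
  then show ?thesis
    using v by (intro eq_vecI) (metis carrier_vecD eq_iff_diff_eq_0 index_minus_vec(1) index_zero_vec(1), simp)
qed

text \<open>Both \<open>kronecker_vec\<close> and \<open>stack_columns\<close> encode a pair of
  indices by quotient and remainder; this turns the single sum back into a double sum.\<close>

lemma sum_div_mod:
  fixes h :: "nat \<Rightarrow> nat \<Rightarrow> real"
  shows "(\<Sum>k<a * b. h (k div b) (k mod b)) = (\<Sum>i<a. \<Sum>j<b. h i j)"
proof (cases "b = 0")
  case False
  have bound: "i * b + j < a * b" if "i < a" "j < b" for i j
  proof -
    have "i * b + j < Suc i * b" using that by simp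
    also have "\<dots> \<le> a * b" using that by (intro mult_le_mono1) simp
    finally show ?thesis .
  qed
  have "(\<Sum>k<a * b. h (k div b) (k mod b)) = (\<Sum>(i, j)\<in>{..<a} \<times> {..<b}. h i j)"
    by (rule sum.reindex_bij_witness[of _ "\<lambda>(i, j). i * b + j" "\<lambda>k. (k div b, k mod b)"])
      (use False in \<open>auto simp: less_mult_imp_div_less bound\<close>)
  then show ?thesis by (simp add: sum.cartesian_product)
qed simp

lemma kronecker_stack_columns:
  assumes K: "K \<in> carrier_mat a b" and m: "m \<in> carrier_vec b" and w: "w \<in> carrier_vec a"
  shows "scalar_prod (kronecker_vec m w) (stack_columns K) = scalar_prod w (K *\<^sub>v m)"
proof -
  have "scalar_prod (kronecker_vec m w) (stack_columns K) =
      (\<Sum>k<b * a. vec_index m (k div a) * vec_index w (k mod a) * K $$ (k mod a, k div a))"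
    using K m w by (auto simp: scalar_prod_def kronecker_vec_def stack_columns_def atLeast0LessThan mult.commute
        intro!: sum.cong)
  also have "\<dots> = (\<Sum>j<b. \<Sum>i<a. vec_index m j * vec_index w i * K $$ (i, j))"
    by (rule sum_div_mod)
  also have "\<dots> = (\<Sum>i<a. \<Sum>j<b. vec_index m j * vec_index w i * K $$ (i, j))"
    by (rule sum.swap)
  also have "\<dots> = scalar_prod w (K *\<^sub>v m)"
    using K m w by (auto simp: scalar_prod_def atLeast0LessThan sum_distrib_left ac_simps intro!: sum.cong)
  finally show ?thesis .
qed

lemma scalar_prod_to_vec:
  assumes "v \<in> carrier_vec CARD('m::{finite,linorder})"
  shows "scalar_prod (to_vec (a :: real^'m::_)) v = a \<bullet> of_vec v"
  using assms card_less_coord[where 'n='m]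
  by (auto simp: scalar_prod_def to_vec_def of_vec_def inner_vec_coord atLeast0LessThan intro!: sum.cong)

text \<open>Meant for the entries of \<open>Phi\<close> that contain the noise, which are not
  continuous in time: measurability and a constant bound on the interval suffice.\<close>

lemma continuous_mult_bounded_measurable_integrable:
  fixes h w :: "real \<Rightarrow> real"
  assumes h: "continuous_on {a..b} h" and w: "w \<in> borel_measurable lebesgue" "\<And>t. \<bar>w t\<bar> \<le> B"
  shows "(\<lambda>t. h t * w t) integrable_on {a..b}"
proof -
  have "bounded (h ` {a..b})"
    by (intro compact_imp_bounded compact_continuous_image h) simp
  then obtain C where C: "\<And>t. t \<in> {a..b} \<Longrightarrow> \<bar>h t\<bar> \<le> C"
    unfolding bounded_iff by (metis imageI real_norm_def)
  show ?thesis
  proof (rule measurable_bounded_by_integrable_imp_integrable)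
    have "h \<in> borel_measurable (lebesgue_on {a..b})"
      by (rule continuous_imp_measurable_on_sets_lebesgue[OF h]) simp
    moreover have "w \<in> borel_measurable (lebesgue_on {a..b})"
      using w(1) by (rule measurable_restrict_space1)
    ultimately show "(\<lambda>t. h t * w t) \<in> borel_measurable (lebesgue_on {a..b})"
      by (rule borel_measurable_times)
    show "(\<lambda>t. C * B) integrable_on {a..b}"
      by (intro integrable_continuous_interval continuous_intros)
    show "norm (h t * w t) \<le> C * B" if "t \<in> {a..b}" for t
    proof -
      have "\<bar>h t\<bar> * \<bar>w t\<bar> \<le> C * B"
        using C[OF that] w(2)[of t] by (intro mult_mono) (auto intro: order_trans[OF abs_ge_zero])
      then show ?thesis by (simp add: abs_mult)
    qed
  qed simp
qed

section \<open>Control laws as coefficient matrices, and the rows of \<open>Phi\<close>\<close>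

lemma poly_space_inner:
  assumes "\<And>i. (\<lambda>y. v y $ i) \<in> poly_space a b" "\<And>i. (\<lambda>y. w y $ i) \<in> poly_space a' b'"
  shows "(\<lambda>y. v y \<bullet> w y) \<in> poly_space (a + a') (b + b')"
  unfolding inner_vec_def inner_real_def by (intro poly_space_sum poly_space_mult assms)

lemma poly_space_const_matrix:
  assumes "\<And>i. (\<lambda>y. v y $ i) \<in> poly_space a b"
  shows "(\<lambda>y. (A *v v y) $ i) \<in> poly_space a b"
  unfolding matrix_vector_mult_def vec_lambda_beta
  by (intro poly_space_sum poly_space_cmult assms)

lemma feedback_poly_space:
  fixes K :: "real mat"
  assumes "K \<in> carrier_mat CARD('m::{finite,linorder}) k"
  shows "(\<lambda>y :: real^'n::{finite,linorder}. (feedback d K y :: real^'m::_) $ i) \<in> poly_space 1 d"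
proof -
  have "(feedback d K y :: real^'m::_) $ i = scalar_prod (row K (card {j. j < i})) (monomials 1 d y)"
    for y :: "real^'n::_"
    using assms card_less_CARD[of i] by (simp add: feedback_def of_vec_def)
  then show ?thesis by (simp add: scalar_prod_monomials_poly_space)
qed

lemma card_exponents_num_monomials:
  "card (exponents CARD('n::{finite,linorder}) 1 d) = num_monomials1 CARD('n) d"
  "d \<ge> 1 \<Longrightarrow> card (exponents CARD('n) 2 d) = num_monomials2 CARD('n) d"
  using dim_monomials1[of d "0 :: real^'n::_"] dim_monomials[of 1 d "0 :: real^'n::_"]
    dim_monomials2[of d "0 :: real^'n::_"] dim_monomials[of 2 d "0 :: real^'n::_"] by simp_all

lemma poly_space_feedbackE:
  fixes v :: "real^'n::{finite,linorder} \<Rightarrow> real^'m::{finite,linorder}"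
  assumes "\<And>i. (\<lambda>y. v y $ i) \<in> poly_space 1 d"
  obtains K where "K \<in> carrier_mat CARD('m) (num_monomials1 CARD('n) d)" "\<And>y. feedback d K y = v y"
proof -
  let ?k = "num_monomials1 CARD('n) d"
  have "\<exists>a. a \<in> carrier_vec ?k \<and> (\<forall>y. v y $ i = scalar_prod a (monomials 1 d y))" for i
    using poly_space_scalar_prodE[OF assms[of i]]
    unfolding card_exponents_num_monomials(1)[where 'n='n] by metis
  then obtain a where a: "\<And>i. a i \<in> carrier_vec ?k" "\<And>i y. v y $ i = scalar_prod (a i) (monomials 1 d y)"
    by metis
  define K where "K = mat_of_rows ?k (map (\<lambda>k. a (coord k)) [0..<CARD('m)])"
  have K: "K \<in> carrier_mat CARD('m) ?k"
    using mat_of_rows_carrier(1)[of ?k "map (\<lambda>k. a (coord k)) [0..<CARD('m)]"] by (simp add: K_def)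
  have row: "row K (card {j. j < i}) = a i" for i
    using card_less_CARD[of i] a(1) by (simp add: K_def coord_card_less)
  show thesis
  proof (rule that[OF K])
    fix y :: "real^'n::_"
    have "(feedback d K y :: real^'m::_) $ i = v y $ i" for i
      using K card_less_CARD[of i] by (simp add: feedback_def of_vec_def row a(2))
    then show "feedback d K y = v y" by (simp add: Finite_Cartesian_Product.vec_eq_iff)
  qed
qed

lemma poly_degree_le_degree_vec: "poly_degree (\<lambda>x. h x $ i) \<le> degree_vec h"
  unfolding degree_vec_def by (intro Max_ge) auto

lemma poly_degree_le_degree_mat: "poly_degree (\<lambda>x. h x $ i $ j) \<le> degree_mat h"
  unfolding degree_mat_def by (intro Max_ge) (auto intro: rev_image_eqI[of "(i, j)"])

text \<open>The integrand of one row of \<open>Phi\<close> applied to the unknowns. The Kronecker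
  block becomes the form of \<open>R\<close> between the noise and the control with coefficient
  matrix \<open>K\<close>.\<close>

lemma scalar_prod_sigma_e:
  fixes R :: "real^'m::{finite,linorder}^'m::_" and y :: "real^'n::{finite,linorder}"
  assumes "d \<ge> 1"
    and K: "K \<in> carrier_mat CARD('m) (num_monomials1 CARD('n) d)"
    and l: "l \<in> carrier_vec (num_monomials2 CARD('n) (2*d))"
  shows "scalar_prod (sigma_e R d y w) (l @\<^sub>v stack_columns K) =
    - scalar_prod l (monomials 2 (2*d) y) - 2 * (w \<bullet> (R *v feedback d K y))"
proof -
  have m: "monomials 1 d y \<in> carrier_vec (num_monomials1 CARD('n) d)"
    "monomials 2 (2*d) y \<in> carrier_vec (num_monomials2 CARD('n) (2*d))"
    using dim_monomials1[of d y] dim_monomials2[of "2*d" y] assms(1) by (auto intro!: carrier_vecI)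
  have t: "to_vec (w v* R) \<in> carrier_vec CARD('m)" by (simp add: to_vec_def)
  let ?k = "kronecker_vec (monomials 1 d y) (to_vec (w v* R))"
  have k: "?k \<in> carrier_vec (num_monomials1 CARD('n) d * CARD('m))"
    "stack_columns K \<in> carrier_vec (num_monomials1 CARD('n) d * CARD('m))"
    using m(1) t K by (auto simp: kronecker_vec_def stack_columns_def)
  have "scalar_prod (sigma_e R d y w) (l @\<^sub>v stack_columns K) =
      - scalar_prod (monomials 2 (2*d) y @\<^sub>v (2 \<cdot>\<^sub>v ?k)) (l @\<^sub>v stack_columns K)"
    unfolding sigma_e_def using m l k by (intro scalar_prod_uminus_left) auto
  also have "scalar_prod (monomials 2 (2*d) y @\<^sub>v (2 \<cdot>\<^sub>v ?k)) (l @\<^sub>v stack_columns K) =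
      scalar_prod (monomials 2 (2*d) y) l + scalar_prod (2 \<cdot>\<^sub>v ?k) (stack_columns K)"
    using m l k by (intro scalar_prod_append) auto
  also have "scalar_prod (2 \<cdot>\<^sub>v ?k) (stack_columns K) = 2 * scalar_prod ?k (stack_columns K)"
    using k by (intro scalar_prod_smult_left) auto
  also have "scalar_prod ?k (stack_columns K) = scalar_prod (to_vec (w v* R)) (K *\<^sub>v monomials 1 d y)"
    by (rule kronecker_stack_columns[OF K m(1) t])
  also have "\<dots> = (w v* R) \<bullet> feedback d K y"
    unfolding feedback_def by (rule scalar_prod_to_vec[OF mult_mat_vec_carrier[OF K m(1)]])
  also have "\<dots> = w \<bullet> (R *v feedback d K y)" by (rule dot_lmul_matrix)
  also have "scalar_prod (monomials 2 (2*d) y) l = scalar_prod l (monomials 2 (2*d) y)"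
    by (rule comm_scalar_prod[OF m(2) l])
  finally show ?thesis by simp
qed

lemma vec_index_monomials:
  assumes "k < card (exponents CARD('n) d1 d2)"
  shows "vec_index (monomials d1 d2 (y :: real^'n::{finite,linorder})) k =
    monomial (rev (sorted_list_of_set (exponents CARD('n) d1 d2)) ! k) y"
  using assms by (simp add: monomials_def vec_of_list_index)

lemma continuous_vec_index_monomials:
  assumes x: "continuous_on S x" and k: "k < card (exponents CARD('n) d1 d2)"
  shows "continuous_on S (\<lambda>t. vec_index (monomials d1 d2 (x t :: real^'n::{finite,linorder})) k)"
proof -
  let ?\<alpha> = "rev (sorted_list_of_set (exponents CARD('n) d1 d2)) ! k"
  have "?\<alpha> \<in> set (rev (sorted_list_of_set (exponents CARD('n) d1 d2)))"
    using k by (intro nth_mem) auto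
  then have "is_polynomial (monomial ?\<alpha> :: real^'n::_ \<Rightarrow> real)"
    by (intro is_polynomialI[OF monomial_in_poly_space[of _ d1 d2]]) simp
  then show ?thesis
    unfolding vec_index_monomials[OF k]
    by (intro continuous_on_compose2[OF polynomial_continuous[of _ UNIV] x]) auto
qed

lemma integrable_sigma_e:
  fixes R :: "real^'m::{finite,linorder}^'m::_" and x :: "real \<Rightarrow> real^'n::{finite,linorder}"
  assumes d: "d \<ge> 1" and x: "continuous_on {a..b} x"
    and e: "bounded (range e)" "e \<in> borel_measurable lebesgue"
    and k: "k < num_monomials2 CARD('n) (2*d) + CARD('m) * num_monomials1 CARD('n) d"
  shows "(\<lambda>t. vec_index (sigma_e R d (x t) (e t)) k) integrable_on {a..b}"
proof -
  define n1 where "n1 = num_monomials1 CARD('n) d"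
  define n2 where "n2 = num_monomials2 CARD('n) (2*d)"
  have m: "dim_vec (monomials 1 d y) = n1" "dim_vec (monomials 2 (2*d) y) = n2" for y :: "real^'n::_"
    using dim_monomials1[of d y] dim_monomials2[of "2*d" y] d by (auto simp: n1_def n2_def)
  have t: "dim_vec (to_vec (w :: real^'m::_)) = CARD('m)" for w by (simp add: to_vec_def)
  have k': "k < n2 + n1 * CARD('m)" using k by (simp add: n1_def n2_def mult.commute)
  have cards: "card (exponents CARD('n) 1 d) = n1" "card (exponents CARD('n) 2 (2*d)) = n2"
    using card_exponents_num_monomials[where 'n='n] d by (auto simp: n1_def n2_def)
  show ?thesis
  proof (cases "k < n2")
    case True
    have "(\<lambda>t. - vec_index (monomials 2 (2*d) (x t)) k) integrable_on {a..b}"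
      using True cards
      by (intro integrable_continuous_interval continuous_on_minus continuous_vec_index_monomials x) auto
    moreover have "vec_index (sigma_e R d (x t) (e t)) k = - vec_index (monomials 2 (2*d) (x t)) k" for t
      unfolding sigma_e_def using True k' by (simp add: m t kronecker_vec_def del: One_nat_def)
    ultimately show ?thesis by simp
  next
    case False
    \<comment> \<open>Beyond the first block, an index encodes a pair: the monomial number
      \<open>k1\<close> and the input coordinate \<open>i\<close>.\<close>
    define k1 where "k1 = (k - n2) div CARD('m)"
    define i :: 'm where "i = coord ((k - n2) mod CARD('m))"
    have k1: "k1 < n1" using False k' by (simp add: k1_def less_mult_imp_div_less)
    have eq: "vec_index (sigma_e R d (x t) (e t)) k =
        (- 2 * vec_index (monomials 1 d (x t)) k1) * (e t v* R) $ i" for t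
      unfolding sigma_e_def using False k'
      by (simp add: m t kronecker_vec_def k1_def i_def to_vec_def del: One_nat_def)
    have inner: "(w v* R) $ i = w \<bullet> column i R" for w
      by (simp add: vector_matrix_mult_def inner_vec_def column_def mult.commute)
    obtain B where B: "\<And>t. norm (e t) \<le> B" using e(1) by (auto simp: bounded_iff)
    show ?thesis
      unfolding eq inner
    proof (rule continuous_mult_bounded_measurable_integrable)
      show "continuous_on {a..b} (\<lambda>t. - 2 * vec_index (monomials 1 d (x t)) k1)"
        using k1 cards by (intro continuous_on_mult continuous_on_const continuous_vec_index_monomials x) auto
      have "(\<lambda>w. w \<bullet> column i R) \<in> borel_measurable borel"
        by (intro borel_measurable_continuous_onI continuous_intros)
      then show "(\<lambda>t. e t \<bullet> column i R) \<in> borel_measurable lebesgue"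
        by (rule measurable_compose[OF e(2)])
      show "\<bar>e t \<bullet> column i R\<bar> \<le> B * norm (column i R)" for t
        using Cauchy_Schwarz_ineq2[of "e t" "column i R"] mult_right_mono[OF B[of t], of "norm (column i R)"]
        by (meson norm_ge_zero order_trans)
    qed
  qed
qed

subsection \<open>The iteration\<close>

locale polynomial_regulator =
  fixes f :: "real^'n::_ \<Rightarrow> real^'n::{finite,linorder}"
    and g :: "real^'n::_ \<Rightarrow> real^'m::{finite,linorder}^'n::_"
    and q :: "real^'n::_ \<Rightarrow> real"
    and R :: "real^'m::_^'m::_"
    and r d :: nat
  assumes f_poly: "\<forall>i. is_polynomial (\<lambda>y. f y $ i)" and f_0: "f 0 = 0"
    and g_poly: "\<forall>i j. is_polynomial (\<lambda>y. g y $ i $ j)"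
    and q_poly: "is_polynomial q" and q_pd: "positive_definite_fun q"
    and R_sym: "transpose R = R" and R_pd: "positive_definite_mat R"
    and r_pos: "r \<ge> 1" and d_pos: "d \<ge> 1"
    and d_ge: "real d \<ge> 1/2 * Max {real (degree_vec f) + 2 * real r - 1,
                 real (degree_mat g) + 2 * (2 * real r - 1),
                 real (poly_degree q),
                 2 * (2 * real r - 1) + 2 * real (degree_mat g)}"
begin

abbreviation "greedy \<equiv> greedy_control g R"
abbreviation "LL \<equiv> L_op f g q R"
abbreviation "HH \<equiv> H_op f g q R"

section \<open>Degree bookkeeping\<close>

text \<open>\<open>2*r - 1\<close> bounds the degree of the gradient of a value function. The three
  bounds are those for the drift term \<open>grad V y \<bullet> f y\<close>, for the greedy control
  and for \<open>q\<close>.\<close>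

lemma degree_bounds:
  "(2*r - 1) + degree_vec f \<le> 2*d" "(2*r - 1) + degree_mat g \<le> d" "poly_degree q \<le> 2*d"
proof -
  let ?S = "{real (degree_vec f) + 2 * real r - 1, real (degree_mat g) + 2 * (2 * real r - 1),
     real (poly_degree q), 2 * (2 * real r - 1) + 2 * real (degree_mat g)}"
  have le: "s \<le> 2 * real d" if "s \<in> ?S" for s
  proof -
    have "s \<le> Max ?S" by (rule Max_ge[OF _ that]) simp
    then show ?thesis using d_ge by linarith
  qed
  have "real (degree_vec f) + 2 * real r - 1 \<le> 2 * real d" "real (poly_degree q) \<le> 2 * real d"
    "2 * (2 * real r - 1) + 2 * real (degree_mat g) \<le> 2 * real d"
    by (rule le, simp)+
  then have "real (degree_vec f + 2*r) \<le> real (2*d + 1)" "real (poly_degree q) \<le> real (2*d)"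
    "real (2*r + degree_mat g) \<le> real (d + 1)"
    by simp_all
  then have "degree_vec f + 2*r \<le> 2*d + 1" "poly_degree q \<le> 2*d" "2*r + degree_mat g \<le> d + 1"
    by (simp_all only: of_nat_le_iff)
  then show "(2*r - 1) + degree_vec f \<le> 2*d" "(2*r - 1) + degree_mat g \<le> d" "poly_degree q \<le> 2*d"
    using r_pos by auto
qed

lemma f_space: "(\<lambda>y. f y $ i) \<in> poly_space 1 (degree_vec f)"
  using f_poly f_0 poly_degree_le_degree_vec[of f i]
  by (intro poly_space_1_of_zero poly_space_mono[OF is_polynomial_poly_degree]) auto

lemma g_space: "(\<lambda>y. g y $ i $ j) \<in> poly_space 0 (degree_mat g)"
  using g_poly poly_degree_le_degree_mat[of g i j]
  by (intro poly_space_mono[OF is_polynomial_poly_degree]) auto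

lemma q_nonneg: "q y \<ge> 0"
  using q_pd by (cases "y = 0") (auto simp: positive_definite_fun_def less_imp_le)

lemma q_space: "q \<in> poly_space 2 (2*d)"
  using q_pd q_nonneg degree_bounds(3)
  by (intro poly_space_2_of_nonneg poly_space_mono[OF is_polynomial_poly_degree[OF q_poly]])
    (auto simp: positive_definite_fun_def)

lemma value_poly_space: "(value_poly r p :: real^'n::_ \<Rightarrow> real) \<in> poly_space 2 (2*r)"
  unfolding value_poly_def[abs_def] by (rule scalar_prod_monomials_poly_space)

lemma grad_space:
  assumes "V \<in> poly_space 2 (2*r)"
  shows "(\<lambda>y. grad V y $ i) \<in> poly_space 1 (2*r - 1)"
  using GDERIV_poly_space[OF assms] by simp

lemma greedy_space:
  assumes "V \<in> poly_space 2 (2*r)"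
  shows "(\<lambda>y. greedy V y $ i) \<in> poly_space 1 d"
proof -
  have "(\<lambda>y. (transpose (g y) *v grad V y) $ k) \<in> poly_space (0 + 1) (degree_mat g + (2*r - 1))" for k
    unfolding matrix_vector_mult_def transpose_def vec_lambda_beta
    by (intro poly_space_sum poly_space_mult g_space grad_space assms)
  then have "(\<lambda>y. (transpose (g y) *v grad V y) $ k) \<in> poly_space 1 d" for k
    by (rule poly_space_mono) (use degree_bounds in auto)
  then have "(\<lambda>y. (- (1/2)) * (matrix_inv R *v (transpose (g y) *v grad V y)) $ i) \<in> poly_space 1 d"
    by (intro poly_space_cmult poly_space_const_matrix)
  then show ?thesis unfolding greedy_control_def by simp
qed

text \<open>In the form \<open>L_op_eq\<close> every term except \<open>q\<close> is a constant
  multiple of a product of two factors without constant term, so the degrees start at 2; the input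
  terms reach at most \<open>d + d\<close>.\<close>

lemma L_op_space:
  assumes V: "V \<in> poly_space 2 (2*r)" and u: "\<And>i. (\<lambda>y. u y $ i) \<in> poly_space 1 d"
  shows "LL V u \<in> poly_space 2 (2*d)"
proof -
  have "(\<lambda>y. grad V y \<bullet> f y) \<in> poly_space (1 + 1) ((2*r - 1) + degree_vec f)"
    by (intro poly_space_inner grad_space V f_space)
  then have 1: "(\<lambda>y. grad V y \<bullet> f y) \<in> poly_space 2 (2*d)"
    by (rule poly_space_mono) (use degree_bounds in auto)
  have 2: "(\<lambda>y. w y \<bullet> (R *v u y)) \<in> poly_space 2 (2*d)"
    if "\<And>i. (\<lambda>y. w y $ i) \<in> poly_space 1 d" for w
  proof (rule poly_space_mono)
    show "(\<lambda>y. w y \<bullet> (R *v u y)) \<in> poly_space (1 + 1) (d + d)"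
      by (intro poly_space_inner poly_space_const_matrix u that)
  qed auto
  have "(\<lambda>y. - (grad V y \<bullet> f y) + 2 * (greedy V y \<bullet> (R *v u y)) - q y - u y \<bullet> (R *v u y))
      \<in> poly_space 2 (2*d)"
    by (intro poly_space_diff poly_space_add poly_space_uminus poly_space_cmult 1 2 q_space u
        greedy_space V)
  then show ?thesis by (simp add: L_op_eq[OF R_sym R_pd, abs_def])
qed

lemma closed_loop_polynomial:
  assumes "\<And>i. (\<lambda>y. u y $ i) \<in> poly_space 1 d"
  shows "is_polynomial (\<lambda>y. (f y + g y *v u y) $ i)"
  unfolding vector_add_component matrix_vector_mult_def vec_lambda_beta
  using f_poly g_poly is_polynomialI[OF assms]
  by (intro is_polynomial_add is_polynomial_sum is_polynomial_mult) auto

lemma GDERIV_value_poly: "GDERIV (value_poly r p) y :> grad (value_poly r p) (y :: real^'n::_)"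
  using GDERIV_poly_space[OF value_poly_space] by blast

section \<open>The data equation and the feasible set\<close>

lemma data_equation:
  fixes x :: "real \<Rightarrow> real^'n::_"
  assumes p: "p \<in> carrier_vec (num_monomials2 CARD('n) (2*r))" and K: "K \<in> carrier_mat CARD('m) (num_monomials1 CARD('n) d)" and l: "l \<in> carrier_vec (num_monomials2 CARD('n) (2*d))"
    and Kg: "\<And>y. feedback d K y = greedy (value_poly r p) y"
    and lL: "\<And>y. scalar_prod l (monomials 2 (2*d) y) = LL (value_poly r p) u y"
    and u: "\<And>i. (\<lambda>y. u y $ i) \<in> poly_space 1 d"
    and data: "sampled_data f g e u x \<tau> N"
    and e: "bounded (range e)" "e \<in> borel_measurable lebesgue"
  shows "Phi R d e x \<tau> N *\<^sub>v (l @\<^sub>v stack_columns K) = Xi q R u x \<tau> N + Theta r x \<tau> N *\<^sub>v p"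
proof (rule eq_vecI)
  let ?V = "value_poly r p :: real^'n::_ \<Rightarrow> real"
  define \<phi> where "\<phi> t = f (x t) + g (x t) *v (u (x t) + e t)" for t
  have car: "continuous_on {\<tau> 0..\<tau> N} x"
    "\<And>t. t \<in> {\<tau> 0..\<tau> N} \<Longrightarrow> (\<phi> has_integral (x t - x (\<tau> 0))) {\<tau> 0..t}"
    using data by (auto simp: sampled_data_def caratheodory_solution_def \<phi>_def[abs_def])
  have mono: "\<tau> i \<le> \<tau> j" if "i \<le> j" "j \<le> N" for i j
    using that
  proof (induction j rule: dec_induct)
    case (step k)
    then have "\<tau> i \<le> \<tau> k" "\<tau> k < \<tau> (Suc k)" using data by (auto simp: sampled_data_def)
    then show ?case by simp
  qed simp
  fix j assume "j < dim_vec (Xi q R u x \<tau> N + Theta r x \<tau> N *\<^sub>v p)"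
  then have j: "j < N" by (simp add: Theta_def)
  define a where "a = \<tau> j"
  define b where "b = \<tau> (Suc j)"
  have ab: "\<tau> 0 \<le> a" "a \<le> b" "b \<le> \<tau> N" using mono[of 0 j] mono[of j "Suc j"] mono[of "Suc j" N] j
    by (auto simp: a_def b_def)
  have contx: "continuous_on {a..b} x"
    using car(1) by (rule continuous_on_subset) (use ab in auto)
  let ?c = "l @\<^sub>v stack_columns K"
  have dimc: "dim_vec ?c = (num_monomials2 CARD('n) (2*d)) + CARD('m) * (num_monomials1 CARD('n) d)"
    using l K by (simp add: stack_columns_def)
  have dims: "dim_vec (sigma_e R d y w) = (num_monomials2 CARD('n) (2*d)) + CARD('m) * (num_monomials1 CARD('n) d)" for y :: "real^'n::_" and w
    using dim_monomials1[of d y] dim_monomials2[of "2*d" y] d_pos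
    by (simp add: sigma_e_def kronecker_vec_def to_vec_def mult.commute)
  define S where "S t = scalar_prod (sigma_e R d (x t) (e t)) ?c" for t
  have S: "(S has_integral vec_index (Phi R d e x \<tau> N *\<^sub>v ?c) j) {a..b}"
  proof -
    have "((\<lambda>t. \<Sum>k<(num_monomials2 CARD('n) (2*d)) + CARD('m) * (num_monomials1 CARD('n) d). vec_index (sigma_e R d (x t) (e t)) k * vec_index ?c k) has_integral
        (\<Sum>k<(num_monomials2 CARD('n) (2*d)) + CARD('m) * (num_monomials1 CARD('n) d). integral {a..b} (\<lambda>t. vec_index (sigma_e R d (x t) (e t)) k) * vec_index ?c k)) {a..b}"
      using integrable_sigma_e[OF d_pos contx e]
      by (intro has_integral_sum has_integral_mult_left) auto
    moreover have "(\<Sum>k<(num_monomials2 CARD('n) (2*d)) + CARD('m) * (num_monomials1 CARD('n) d). integral {a..b} (\<lambda>t. vec_index (sigma_e R d (x t) (e t)) k) * vec_index ?c k)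
        = vec_index (Phi R d e x \<tau> N *\<^sub>v ?c) j"
      using j dimc by (auto simp: Phi_def scalar_prod_def a_def b_def atLeast0LessThan simp del: index_append_vec(1) intro!: sum.cong)
    ultimately show ?thesis
      unfolding S_def scalar_prod_def dimc atLeast0LessThan by simp
  qed
  \<comment> \<open>\<open>LL\<close> refers to the closed loop without noise, whereas the
    trajectory is driven by \<open>u + e\<close>. The noise block of \<open>sigma_e\<close>, paired
    with the greedy control, contributes exactly the missing
    \<open>grad V \<bullet> (g *v e)\<close>.\<close>
  have S_eq: "S t = grad ?V (x t) \<bullet> \<phi> t + running_cost q R (x t) (u (x t))" for t
  proof -
    have "S t = - LL ?V u (x t) - 2 * (e t \<bullet> (R *v greedy ?V (x t)))"
      unfolding S_def scalar_prod_sigma_e[OF d_pos K l] by (simp add: lL Kg)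
    also have "e t \<bullet> (R *v greedy ?V (x t)) = greedy ?V (x t) \<bullet> (R *v e t)"
      by (metis inner_matrix_transpose R_sym inner_commute)
    also have "- LL ?V u (x t) - 2 * (greedy ?V (x t) \<bullet> (R *v e t)) =
        - LL ?V u (x t) + grad ?V (x t) \<bullet> (g (x t) *v e t)"
      by (simp add: grad_inner_input[OF R_sym R_pd])
    also have "\<dots> = grad ?V (x t) \<bullet> \<phi> t + running_cost q R (x t) (u (x t))"
      by (simp add: L_op_def \<phi>_def matrix_vector_right_distrib inner_add_right)
    finally show ?thesis .
  qed
  have contu: "continuous_on UNIV (\<lambda>y. u y $ i)" for i
    using polynomial_continuous[OF is_polynomialI[OF u]] .
  have contq: "continuous_on UNIV q" using polynomial_continuous[OF q_poly] .
  have contR: "continuous_on {a..b} (\<lambda>t. running_cost q R (x t) (u (x t)))"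
    unfolding running_cost_def inner_matrix_eq_sum
    by (intro continuous_intros continuous_on_compose2[OF contq contx] continuous_on_compose2[OF contu contx]) auto
  have Xi: "((\<lambda>t. running_cost q R (x t) (u (x t))) has_integral vec_index (Xi q R u x \<tau> N) j) {a..b}"
    using integrable_integral[OF integrable_continuous_interval[OF contR]] j
    by (simp add: Xi_def a_def b_def)
  \<comment> \<open>The integrability of \<open>grad V \<bullet> \<phi>\<close> that the chain rule
    asks for is obtained here from the two data integrals.\<close>
  have diff: "((\<lambda>t. grad ?V (x t) \<bullet> \<phi> t) has_integral
      (vec_index (Phi R d e x \<tau> N *\<^sub>v ?c) j - vec_index (Xi q R u x \<tau> N) j)) {a..b}"
    using has_integral_diff[OF S Xi] by (simp add: S_eq)
  \<comment> \<open>The velocity is a continuous function of state and noise, evaluated on the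
    product of the compact trajectory segment and the closure of the noise range.\<close>
  obtain M where M: "\<And>t. t \<in> {a..b} \<Longrightarrow> norm (\<phi> t) \<le> M"
  proof -
    define F where "F z = (\<chi> i. f (fst z) $ i + (\<Sum>j\<in>UNIV. g (fst z) $ i $ j * (u (fst z) $ j + snd z $ j)))"
      for z :: "(real^'n::_) \<times> (real^'m::_)"
    have comp: "continuous_on UNIV (\<lambda>z :: (real^'n::_) \<times> (real^'m::_). h (fst z))"
      if "is_polynomial h" for h :: "real^'n::_ \<Rightarrow> real"
      by (rule continuous_on_compose2[OF polynomial_continuous[OF that, of UNIV]])
        (auto intro: continuous_on_fst)
    have "continuous_on UNIV (\<lambda>z :: (real^'n::_) \<times> (real^'m::_). snd z $ j)" for j
      by (intro continuous_intros)
    then have "continuous_on UNIV F"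
      unfolding F_def
      by (intro continuous_on_vec_lambda continuous_on_add continuous_on_sum continuous_on_mult
          comp f_poly[rule_format] g_poly[rule_format] is_polynomialI[OF u])
    then have "continuous_on (x ` {a..b} \<times> closure (range e)) F"
      by (rule continuous_on_subset) simp
    moreover have "compact (x ` {a..b})" by (rule compact_continuous_image[OF contx compact_Icc])
    moreover have "compact (closure (range e))" using e(1) by (simp add: compact_closure)
    ultimately have "compact (F ` (x ` {a..b} \<times> closure (range e)))"
      by (metis compact_Times compact_continuous_image)
    then have "bounded (F ` (x ` {a..b} \<times> closure (range e)))" by (rule compact_imp_bounded)
    then obtain M where M: "\<And>z. z \<in> x ` {a..b} \<times> closure (range e) \<Longrightarrow> norm (F z) \<le> M"
      unfolding bounded_iff by blast
    have F: "\<phi> t = F (x t, e t)" for t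
      by (simp add: F_def \<phi>_def matrix_vector_mult_def Finite_Cartesian_Product.vec_eq_iff)
    have "e t \<in> closure (range e)" for t by (rule subsetD[OF closure_subset rangeI])
    then show thesis by (intro that[of M]) (simp add: F M)
  qed
  have \<phi>int: "\<phi> integrable_on {\<tau> 0..t}" if "t \<in> {\<tau> 0..\<tau> N}" for t
    using car(2)[OF that] by (rule has_integral_integrable)
  have "((\<lambda>t. grad ?V (x t) \<bullet> \<phi> t) has_integral (?V (x b) - ?V (x a))) {a..b}"
  proof (rule chain_rule_indefinite_integral[OF ab(2)])
    show "\<phi> integrable_on {a..b}"
      by (rule integrable_on_subinterval[OF \<phi>int[of b]]) (use ab in auto)
    show "x t = x a + integral {a..t} \<phi>" if "t \<in> {a..b}" for t
    proof -
      have "integral {\<tau> 0..a} \<phi> + integral {a..t} \<phi> = integral {\<tau> 0..t} \<phi>"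
        using that ab \<phi>int[of t] by (intro Henstock_Kurzweil_Integration.integral_combine) auto
      moreover have "integral {\<tau> 0..a} \<phi> = x a - x (\<tau> 0)" "integral {\<tau> 0..t} \<phi> = x t - x (\<tau> 0)"
        using that ab by (auto intro!: integral_unique car(2))
      ultimately show ?thesis by (simp add: algebra_simps)
    qed
    show "continuous_on UNIV (grad ?V)"
      by (rule polynomial_continuous_grad[OF is_polynomialI[OF value_poly_space]])
    show "(\<lambda>t. grad ?V (x t) \<bullet> \<phi> t) integrable_on {a..b}"
      using diff by (rule has_integral_integrable)
  qed (rule M GDERIV_value_poly, assumption?)+
  then have "vec_index (Phi R d e x \<tau> N *\<^sub>v ?c) j - vec_index (Xi q R u x \<tau> N) j = ?V (x b) - ?V (x a)"
    using has_integral_unique[OF diff] by blast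
  moreover have "vec_index (Theta r x \<tau> N *\<^sub>v p) j = ?V (x b) - ?V (x a)"
  proof -
    have "dim_vec (monomials 2 (2*r) y) = (num_monomials2 CARD('n) (2*r))" for y :: "real^'n::_"
      using dim_monomials2[of "2*r" y] r_pos by simp
    then show ?thesis
      using j p
      by (simp add: Theta_def scalar_prod_def value_poly_def a_def b_def right_diff_distrib sum_subtractf
          left_diff_distrib mult.commute)
  qed
  ultimately show "vec_index (Phi R d e x \<tau> N *\<^sub>v ?c) j = vec_index (Xi q R u x \<tau> N + Theta r x \<tau> N *\<^sub>v p) j"
    using j by (simp add: Theta_def Xi_def)
qed (simp add: Phi_def Theta_def)

lemma data_solution_exists:
  assumes "p \<in> carrier_vec (num_monomials2 CARD('n) (2*r))" "\<And>i. (\<lambda>y. u y $ i) \<in> poly_space 1 d"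
  obtains K l where "K \<in> carrier_mat CARD('m) (num_monomials1 CARD('n) d)" "l \<in> carrier_vec (num_monomials2 CARD('n) (2*d))"
    "\<And>y. feedback d K y = greedy (value_poly r p) y"
    "\<And>y. scalar_prod l (monomials 2 (2*d) y) = LL (value_poly r p) u y"
proof -
  obtain K where K: "K \<in> carrier_mat CARD('m) (num_monomials1 CARD('n) d)" "\<And>y. feedback d K y = greedy (value_poly r p) y"
    using poly_space_feedbackE[OF greedy_space[OF value_poly_space]] by metis
  obtain l where l: "l \<in> carrier_vec (num_monomials2 CARD('n) (2*d))"
    "\<And>y. LL (value_poly r p) u y = scalar_prod l (monomials 2 (2*d) y)"
    using poly_space_scalar_prodE[OF L_op_space[OF value_poly_space assms(2)]]
      card_exponents_num_monomials(2)[where 'n='n, of "2*d"] d_pos by auto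
  show thesis using that[OF K(1) l(1) K(2)] l(2) by simp
qed

lemma feasible_set_nonempty:
  fixes x :: "real \<Rightarrow> real^'n::_"
  assumes p: "p \<in> carrier_vec (num_monomials2 CARD('n) (2*r))" and K0: "K0 \<in> carrier_mat CARD('m) (num_monomials1 CARD('n) d)"
    and sos: "SOS (LL (value_poly r p) (feedback d K0))"
    and data: "sampled_data f g e (feedback d K0) x \<tau> N"
    and e: "bounded (range e)" "e \<in> borel_measurable lebesgue"
  shows "feasible_set q R r d e (feedback d K0) x \<tau> N p \<noteq> {}"
proof -
  obtain K l where Kl: "K \<in> carrier_mat CARD('m) (num_monomials1 CARD('n) d)" "l \<in> carrier_vec (num_monomials2 CARD('n) (2*d))"
    "\<And>y. feedback d K y = greedy (value_poly r p) y"
    "\<And>y. scalar_prod l (monomials 2 (2*d) y) = LL (value_poly r p) (feedback d K0) y"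
    using data_solution_exists[OF p feedback_poly_space[OF K0]] by metis
  \<comment> \<open>The previous weights are kept: their difference to themselves gives the zero
    polynomial, which is SOS, and \<open>l\<close> carries the coefficients of the given SOS
    polynomial.\<close>
  have "(p, K, l) \<in> feasible_set q R r d e (feedback d K0) x \<tau> N p"
  proof -
    have "scalar_prod (p - p) (monomials 2 (2*r) y) = 0" for y :: "real^'n::_"
      unfolding minus_cancel_vec[OF p] using dim_monomials2[of "2*r" y] r_pos
      by (intro scalar_prod_left_zero carrier_vecI) simp
    then have "SOS (\<lambda>y :: real^'n::_. scalar_prod (p - p) (monomials 2 (2*r) y))"
      by (simp add: SOS_0)
    moreover have "SOS (\<lambda>y :: real^'n::_. scalar_prod l (monomials 2 (2*d) y))"
      unfolding Kl(4) by (rule sos)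
    ultimately show ?thesis
      unfolding feasible_set_def
      using data_equation[OF p Kl feedback_poly_space[OF K0] data e] p Kl(1,2) by blast
  qed
  then show ?thesis by blast
qed

lemma feasible_solution:
  fixes x :: "real \<Rightarrow> real^'n::_"
  assumes K0: "K0 \<in> carrier_mat CARD('m) (num_monomials1 CARD('n) d)"
    and data: "sampled_data f g e (feedback d K0) x \<tau> N"
    and e: "bounded (range e)" "e \<in> borel_measurable lebesgue"
    and rank: "vec_space.rank N (Phi R d e x \<tau> N) = (num_monomials2 CARD('n) (2*d)) + CARD('m) * (num_monomials1 CARD('n) d)"
    and feas: "(p, K, l) \<in> feasible_set q R r d e (feedback d K0) x \<tau> N p'"
  shows "p \<in> carrier_vec (num_monomials2 CARD('n) (2*r))" "K \<in> carrier_mat CARD('m) (num_monomials1 CARD('n) d)"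
    "feedback d K = greedy (value_poly r p)"
    "SOS (LL (value_poly r p) (feedback d K0))"
    "SOS (LL (value_poly r p) (feedback d K))"
proof -
  have F: "p \<in> carrier_vec (num_monomials2 CARD('n) (2*r))" "K \<in> carrier_mat CARD('m) (num_monomials1 CARD('n) d)" "l \<in> carrier_vec (num_monomials2 CARD('n) (2*d))"
    "Phi R d e x \<tau> N *\<^sub>v (l @\<^sub>v stack_columns K) = Xi q R (feedback d K0) x \<tau> N + Theta r x \<tau> N *\<^sub>v p"
    "SOS (\<lambda>y :: real^'n::_. scalar_prod l (monomials 2 (2*d) y))"
    using feas by (auto simp: feasible_set_def)
  show "p \<in> carrier_vec (num_monomials2 CARD('n) (2*r))" "K \<in> carrier_mat CARD('m) (num_monomials1 CARD('n) d)" by (rule F)+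
  note u = feedback_poly_space[OF K0]
  obtain K' l' where Kl: "K' \<in> carrier_mat CARD('m) (num_monomials1 CARD('n) d)" "l' \<in> carrier_vec (num_monomials2 CARD('n) (2*d))"
    "\<And>y. feedback d K' y = greedy (value_poly r p) y"
    "\<And>y. scalar_prod l' (monomials 2 (2*d) y) = LL (value_poly r p) (feedback d K0) y"
    using data_solution_exists[OF F(1) u] by metis
  have st: "stack_columns A \<in> carrier_vec (CARD('m) * (num_monomials1 CARD('n) d))" if "A \<in> carrier_mat CARD('m) (num_monomials1 CARD('n) d)" for A
    using that by (auto simp: stack_columns_def)
  have "l @\<^sub>v stack_columns K = l' @\<^sub>v stack_columns K'"
  proof (rule full_column_rank_inj[OF _ rank])
    show "Phi R d e x \<tau> N \<in> carrier_mat N ((num_monomials2 CARD('n) (2*d)) + CARD('m) * (num_monomials1 CARD('n) d))" by (simp add: Phi_def)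
    show "Phi R d e x \<tau> N *\<^sub>v (l @\<^sub>v stack_columns K) = Phi R d e x \<tau> N *\<^sub>v (l' @\<^sub>v stack_columns K')"
      using data_equation[OF F(1) Kl u data e] F(4) by simp
  qed (use F Kl st in auto)
  then have eq: "l = l'" "stack_columns K = stack_columns K'"
    using append_vec_eq[OF F(3) Kl(2)] by auto
  have "K = K'"
  proof (rule eq_matI)
    fix i j assume "i < dim_row K'" "j < dim_col K'"
    then have ij: "i < CARD('m)" "j < (num_monomials1 CARD('n) d)" using Kl(1) by auto
    \<comment> \<open>Stacking by columns puts the entry \<open>(i, j)\<close> at position
      \<open>j * CARD('m) + i\<close>, so the matrices can be compared entry by entry.\<close>
    have "j * CARD('m) + i < CARD('m) * (num_monomials1 CARD('n) d)"
    proof -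
      have "j * CARD('m) + i < Suc j * CARD('m)" using ij by simp
      also have "\<dots> \<le> (num_monomials1 CARD('n) d) * CARD('m)" using ij by (intro mult_le_mono1) simp
      finally show ?thesis by (simp add: mult.commute)
    qed
    then have "vec_index (stack_columns A) (j * CARD('m) + i) = A $$ (i, j)"
      if "A \<in> carrier_mat CARD('m) (num_monomials1 CARD('n) d)" for A
      using that ij by (simp add: stack_columns_def)
    then show "K $$ (i, j) = K' $$ (i, j)" using F(2) Kl(1) eq(2) by metis
  qed (use F(2) Kl(1) in auto)
  then show greedy: "feedback d K = greedy (value_poly r p)" using Kl(3) by auto
  have "(\<lambda>y. scalar_prod l (monomials 2 (2*d) y)) = LL (value_poly r p) (feedback d K0)"
    using Kl(4) eq(1) by auto
  then show sos: "SOS (LL (value_poly r p) (feedback d K0))" using F(5) by simp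
  \<comment> \<open>This is what \<open>L_op\<close> gains when the old control is replaced by the
    greedy one; it is a polynomial form because both controls are polynomial.\<close>
  have "SOS (\<lambda>y. (feedback d K0 y - greedy (value_poly r p) y) \<bullet> (R *v (feedback d K0 y - greedy (value_poly r p) y)))"
    by (intro SOS_quadratic_form R_sym R_pd, unfold vector_minus_component)
      (rule is_polynomial_diff[OF is_polynomialI[OF u] is_polynomialI[OF greedy_space[OF value_poly_space]]])
  from SOS_add[OF sos this] show "SOS (LL (value_poly r p) (feedback d K))"
    unfolding greedy L_op_greedy(1)[OF R_sym R_pd, symmetric] .
qed

section \<open>Stability of the closed loops and comparison with the optimal value\<close>

lemma closed_loop_decrease:
  assumes "\<And>y. LL V u y \<ge> 0"
  shows "grad V y \<bullet> (f y + g y *v u y) \<le> - q y"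
  unfolding grad_inner_closed_loop[of V y f g u q R] running_cost_def
  using assms[of y] quadratic_form_nonneg[OF R_sym R_pd, of "u y"] by linarith

lemma closed_loop_stable:
  assumes "V \<in> class_P" "\<And>i. (\<lambda>y. u y $ i) \<in> poly_space 1 d" "\<And>y. LL V u y \<ge> 0"
  shows "globally_asymptotically_stable (\<lambda>y. f y + g y *v u y)"
  by (rule Lyapunov_globally_asymptotically_stable[OF assms(1) _ polynomial_continuous[OF q_poly] q_pd])
    (rule polynomial_map_lipschitz_cball closed_loop_polynomial closed_loop_decrease assms)+

text \<open>Positivity of \<open>V\<close> is not among the assumptions, since it will be deduced
  from this very inequality. Convergence to the origin, where \<open>V\<close> and \<open>Vo\<close>
  both vanish, comes from the stability assumption instead.\<close>

lemma optimal_value_le: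
  assumes Vo: "Vo \<in> class_P" "\<And>y. HH Vo y = 0"
    and V: "V \<in> poly_space 2 (2*r)" and L: "\<And>y. LL V u y \<ge> 0"
    and gas: "globally_asymptotically_stable (\<lambda>y. f y + g y *v u y)"
  shows "Vo y \<le> V y"
proof -
  let ?F = "\<lambda>y. f y + g y *v u y"
  obtain z where z: "solution ?F z" "z 0 = y" and z0: "(z \<longlongrightarrow> 0) at_top"
    using gas unfolding globally_asymptotically_stable_def by metis
  define \<phi> where "\<phi> t = V (z t) - Vo (z t)" for t
  define \<phi>' where "\<phi>' t = grad V (z t) \<bullet> ?F (z t) - grad Vo (z t) \<bullet> ?F (z t)" for t
  have VG: "GDERIV V w :> grad V w" for w using GDERIV_poly_space[OF V] by blast
  have der: "(\<phi> has_real_derivative \<phi>' t) (at t within {0..})" if "t \<ge> 0" for t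
    unfolding \<phi>_def[abs_def] \<phi>'_def
    using z(1) that unfolding solution_def
    by (intro DERIV_diff has_real_derivative_along VG class_PD(1)[OF Vo(1)]) auto
  \<comment> \<open>The running costs of the two functions cancel. As \<open>HH Vo\<close> vanishes,
    \<open>LL Vo u\<close> is minus a nonnegative form in the deviation of \<open>u\<close> from the
    optimal control, while \<open>LL V u\<close> is nonnegative.\<close>
  have neg: "\<phi>' t \<le> - 0" for t
  proof -
    have "LL Vo u (z t) \<le> 0"
      unfolding L_op_complete_square[OF R_sym R_pd] Vo(2)
      using quadratic_form_nonneg[OF R_sym R_pd] by simp
    then show ?thesis
      unfolding \<phi>'_def grad_inner_closed_loop[of _ "z t" f g u q R] using L[of "z t"] by simp
  qed
  have "isCont V 0" "isCont Vo 0"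
    using VG[of 0] class_PD(1)[OF Vo(1), of 0] by (auto simp: gderiv_def dest: has_derivative_continuous)
  then have "((\<lambda>t. V (z t)) \<longlongrightarrow> V 0) at_top" "((\<lambda>t. Vo (z t)) \<longlongrightarrow> Vo 0) at_top"
    using z0 isCont_tendsto_compose by blast+
  then have "(\<phi> \<longlongrightarrow> V 0 - Vo 0) at_top"
    unfolding \<phi>_def[abs_def] by (rule tendsto_diff)
  moreover have "V 0 - Vo 0 = 0" using poly_space_at_0[OF V] class_PD(3)[OF Vo(1)] by simp
  ultimately have "(\<phi> \<longlongrightarrow> 0) at_top" by simp
  moreover have "\<forall>\<^sub>F t in at_top. \<phi> t \<le> \<phi> 0"
  proof -
    have "\<phi> t \<le> \<phi> 0 - 0 * (t - 0)" if "t \<ge> 0" for t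
      by (rule decrease_of_derivative_le[where S = "{0..}" and \<phi>' = \<phi>', OF that])
        (use der neg in auto)
    then show ?thesis by (auto simp: eventually_at_top_linorder)
  qed
  ultimately have "0 \<le> \<phi> 0" by (rule tendsto_upperbound) simp
  then show ?thesis by (simp add: \<phi>_def z(2))
qed

text \<open>Positivity and properness are inherited from the lower bound \<open>Vo\<close>;
  smoothness and the value 0 at the origin come from \<open>V\<close> being a polynomial without
  constant term.\<close>

lemma class_P_of_ge:
  assumes Vo: "Vo \<in> class_P" and V: "V \<in> poly_space 2 (2*r)" and le: "\<And>y. Vo y \<le> V y"
  shows "V \<in> class_P"
proof -
  have "V 0 = 0" using poly_space_at_0[OF V] by simp
  moreover have "V y > 0" if "y \<noteq> 0" for y
    using class_PD(4)[OF Vo that] le[of y] by linarith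
  moreover have "filterlim V at_top at_infinity"
    by (rule filterlim_at_top_mono[OF class_PD(5)[OF Vo]]) (use le in auto)
  moreover have "continuous_on UNIV (grad V)"
    by (rule polynomial_continuous_grad[OF is_polynomialI[OF V]])
  moreover have "V differentiable at y" for y
    using GDERIV_poly_space[OF V] unfolding gderiv_def differentiable_def by blast
  ultimately show ?thesis by (simp add: class_P_def positive_definite_fun_def)
qed

lemma H_op_tendsto:
  assumes "(\<lambda>i. grad (V i) y) \<longlonglongrightarrow> grad W y"
  shows "(\<lambda>i. HH (V i) y) \<longlonglongrightarrow> HH W y"
  unfolding H_op_def
  by (intro tendsto_intros assms bounded_linear.tendsto[OF matrix_vector_mul_bounded_linear])

text \<open>Since \<open>HH V\<close> is nonpositive, its integral over \<open>{0..T}\<close> is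
  nonincreasing in \<open>T\<close>, so the improper integral always exists as an extended
  real.\<close>

lemma optimal_loop_bound:
  assumes Vo: "Vo \<in> class_P" "\<And>y. HH Vo y = 0"
    and V: "V \<in> poly_space 2 (2*r)" and H: "\<And>y. HH V y \<le> 0"
    and z: "solution (\<lambda>y. f y + g y *v greedy Vo y) z"
  shows "\<exists>I. has_improper_integral (\<lambda>t. HH V (z t)) I \<and> ereal (V (z 0) - Vo (z 0)) \<le> - I"
proof -
  let ?F = "\<lambda>y. f y + g y *v greedy Vo y"
  have LVo: "LL Vo (greedy Vo) y = 0" for y
    by (simp add: L_op_greedy(2)[OF R_sym R_pd] Vo(2))
  have z0: "(z \<longlongrightarrow> 0) at_top"
    by (rule Lyapunov_tendsto_0[OF Vo(1) z polynomial_continuous[OF q_poly] q_pd])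
      (rule closed_loop_decrease, simp add: LVo)
  have VG: "GDERIV V w :> grad V w" for w using GDERIV_poly_space[OF V] by blast
  define h where "h t = HH V (z t)" for t
  define \<phi> where "\<phi> t = V (z t) - Vo (z t)" for t
  define \<phi>' where "\<phi>' t = grad V (z t) \<bullet> ?F (z t) - grad Vo (z t) \<bullet> ?F (z t)" for t
  \<comment> \<open>Only continuity of \<open>HH V\<close> is at stake, and as minus
    \<open>LL\<close> at the greedy control it is a polynomial.\<close>
  have "HH V = (\<lambda>y. - LL V (greedy V) y)"
    by (simp add: L_op_greedy(2)[OF R_sym R_pd])
  moreover have "is_polynomial (\<lambda>y. - LL V (greedy V) y)"
    by (rule is_polynomialI[OF poly_space_uminus[OF L_op_space[OF V greedy_space[OF V]]]])
  ultimately have contH: "continuous_on UNIV (HH V)" by (simp add: polynomial_continuous)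
  have contz: "continuous_on {0..} z"
    unfolding continuous_on_eq_continuous_within
    using z has_vector_derivative_continuous unfolding solution_def by fastforce
  have conth: "continuous_on {0..T} h" for T
    unfolding h_def
    by (rule continuous_on_compose2[OF contH continuous_on_subset[OF contz]]) auto
  then have inth: "h integrable_on {0..T}" for T by (rule integrable_continuous_interval)
  define J where "J T = integral {0..T} h" for T
  have Jmono: "J T' \<le> J T" if "0 \<le> T" "T \<le> T'" for T T'
  proof -
    have "J T + integral {T..T'} h = J T'"
      unfolding J_def by (rule Henstock_Kurzweil_Integration.integral_combine[OF that inth])
    moreover have "integral {T..T'} h \<le> integral {T..T'} (\<lambda>_. 0)"
    proof (rule integral_le)
      show "h integrable_on {T..T'}" by (rule integrable_on_subinterval[OF inth[of T']]) (use that in auto)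
    qed (simp_all add: h_def H integrable_0)
    ultimately show ?thesis by simp
  qed
  have key: "\<phi> 0 \<le> \<phi> T - J T" if "T \<ge> 0" for T
  proof -
    have der: "(\<phi> has_vector_derivative \<phi>' t) (at t within {0..T})" if "t \<in> {0..T}" for t
    proof -
      have "(\<phi> has_real_derivative \<phi>' t) (at t within {0..})"
        unfolding \<phi>_def[abs_def] \<phi>'_def
        using z that unfolding solution_def
        by (intro DERIV_diff has_real_derivative_along VG class_PD(1)[OF Vo(1)]) auto
      then have "(\<phi> has_real_derivative \<phi>' t) (at t within {0..T})"
        by (rule has_field_derivative_subset) auto
      then show ?thesis by (simp add: has_real_derivative_iff_has_vector_derivative)
    qed
    \<comment> \<open>Again the running costs cancel: \<open>LL Vo\<close> is 0 at the optimal
      control, and completing the square for \<open>V\<close> at that control gives at most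
      \<open>- h t\<close>.\<close>
    have "h t \<le> \<phi>' t" for t
    proof -
      have "LL V (greedy Vo) (z t) \<le> - h t"
        unfolding L_op_complete_square[OF R_sym R_pd] h_def
        using quadratic_form_nonneg[OF R_sym R_pd] by simp
      then show ?thesis
        unfolding \<phi>'_def grad_inner_closed_loop[of _ "z t" f g "greedy Vo" q R] by (simp add: LVo)
    qed
    moreover have "(\<phi>' has_integral \<phi> T - \<phi> 0) {0..T}"
      by (rule fundamental_theorem_of_calculus[OF that der])
    ultimately have "J T \<le> \<phi> T - \<phi> 0"
      unfolding J_def using has_integral_le[OF integrable_integral[OF inth]] by blast
    then show ?thesis by simp
  qed
  \<comment> \<open>The limit of a nonincreasing function is its infimum, here possibly minus
    infinity.\<close>
  define I where "I = (INF T\<in>{0..}. ereal (J T))"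
  have "((\<lambda>T. ereal (J T)) \<longlongrightarrow> I) at_top"
  proof (rule order_tendstoI)
    fix a assume "a < I"
    then have "a < ereal (J T)" if "T \<ge> 0" for T
      using that unfolding I_def by (metis INF_lower atLeast_iff less_le_trans)
    then show "\<forall>\<^sub>F T in at_top. a < ereal (J T)" by (auto simp: eventually_at_top_linorder)
  next
    fix a assume "I < a"
    then obtain T0 where T0: "T0 \<ge> 0" "ereal (J T0) < a" unfolding I_def INF_less_iff by auto
    have "ereal (J T) < a" if "T \<ge> T0" for T
      using Jmono[OF T0(1) that] T0(2) by (metis ereal_less_eq(3) le_less_trans)
    then show "\<forall>\<^sub>F T in at_top. ereal (J T) < a" by (auto simp: eventually_at_top_linorder)
  qed
  then have imp: "has_improper_integral (\<lambda>t. HH V (z t)) I"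
    using inth by (simp add: has_improper_integral_def J_def h_def[abs_def])
  have "isCont V 0" "isCont Vo 0"
    using VG[of 0] class_PD(1)[OF Vo(1), of 0] by (auto simp: gderiv_def dest: has_derivative_continuous)
  then have "((\<lambda>t. V (z t)) \<longlongrightarrow> V 0) at_top" "((\<lambda>t. Vo (z t)) \<longlongrightarrow> Vo 0) at_top"
    using z0 isCont_tendsto_compose by blast+
  then have "(\<phi> \<longlongrightarrow> V 0 - Vo 0) at_top"
    unfolding \<phi>_def[abs_def] by (rule tendsto_diff)
  moreover have "V 0 - Vo 0 = 0" using poly_space_at_0[OF V] class_PD(3)[OF Vo(1)] by simp
  ultimately have \<phi>0: "(\<phi> \<longlongrightarrow> 0) at_top" by simp
  \<comment> \<open>\<open>key\<close> bounds the integral up to \<open>T\<close> by the difference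
    of the end values; at a late \<open>T\<close> the value of \<open>\<phi>\<close> is below any
    given positive number.\<close>
  have "I \<le> ereal (- \<phi> 0) + ereal \<epsilon>" if "\<epsilon> > 0" for \<epsilon>
  proof -
    have "\<forall>\<^sub>F T in at_top. \<phi> T < \<epsilon>" using order_tendstoD(2)[OF \<phi>0 that] .
    then have "\<exists>T\<ge>0. \<phi> T < \<epsilon>"
      unfolding eventually_at_top_linorder by (metis max.cobounded1 max.cobounded2)
    then obtain T where T: "T \<ge> 0" "\<phi> T < \<epsilon>" by blast
    have "I \<le> ereal (J T)" unfolding I_def using T(1) by (intro INF_lower) simp
    also have "\<dots> \<le> ereal (- \<phi> 0 + \<epsilon>)" using key[OF T(1)] T(2) by simp
    finally show ?thesis by simp
  qed
  then have "I \<le> ereal (- \<phi> 0)" by (rule ereal_le_epsilon2)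
  then have "ereal (\<phi> 0) \<le> - I"
    using ereal_minus_le_minus[of "ereal (- \<phi> 0)" I] by simp
  with imp show ?thesis unfolding \<phi>_def by blast
qed

end

theorem theoremV6:
  fixes f :: "real^'n::_ \<Rightarrow> real^'n::{finite,linorder}"
    and g :: "real^'n::_ \<Rightarrow> real^'m::{finite,linorder}^'n::_"
    and q :: "real^'n::_ \<Rightarrow> real"
    and R :: "real^'m::_^'m::_"
    and r d :: nat
    and \<Omega> :: "(real^'n::_) set"
    and V\<^sub>o :: "real^'n::_ \<Rightarrow> real"
    and u\<^sub>o :: "real^'n::_ \<Rightarrow> real^'m::_"
    and p :: "nat \<Rightarrow> real Matrix.vec"
    and K :: "nat \<Rightarrow> real mat"
    and e :: "real \<Rightarrow> real^'m::_"
    and x :: "nat \<Rightarrow> nat \<Rightarrow> real \<Rightarrow> real^'n::_"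
    and \<tau> :: "nat \<Rightarrow> nat \<Rightarrow> nat \<Rightarrow> real"
    and N :: "nat \<Rightarrow> nat"
  assumes f_poly: "\<forall>i. is_polynomial (\<lambda>y. f y $ i)" and f_0: "f 0 = 0"
    and g_poly: "\<forall>i j. is_polynomial (\<lambda>y. g y $ i $ j)"
    and q_poly: "is_polynomial q" and q_pd: "positive_definite_fun q"
    and R_sym: "transpose R = R" and R_pd: "positive_definite_mat R"
    and r_pos: "r \<ge> 1" and d_pos: "d \<ge> 1"
    and d_ge: "real d \<ge> 1/2 * Max {real (degree_vec f) + 2 * real r - 1,
                 real (degree_mat g) + 2 * (2 * real r - 1),
                 real (poly_degree q),
                 2 * (2 * real r - 1) + 2 * real (degree_mat g)}"
    and Omega: "compact \<Omega>" "0 \<in> interior \<Omega>"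
    and A2: "V\<^sub>o \<in> class_P" "\<forall>y. H_op f g q R V\<^sub>o y = 0"
    and u\<^sub>o: "u\<^sub>o = (\<lambda>y. - (1/2) *\<^sub>R (matrix_inv R *v (transpose (g y) *v grad V\<^sub>o y)))"
    and A3: "p 0 \<in> carrier_vec (num_monomials2 CARD('n) (2*r))"
        "K 1 \<in> carrier_mat CARD('m) (num_monomials1 CARD('n) d)"
        "(value_poly r (p 0) :: real^'n::_ \<Rightarrow> real) \<in> poly_space 2 (2*r) \<inter> class_P"
        "SOS (L_op f g q R (value_poly r (p 0)) (feedback d (K 1)))"
    and noise: "bounded (range e)" "e \<in> borel_measurable lebesgue"
  shows
    "(\<forall>i\<ge>1.
        (\<forall>j\<in>{1..i}. (\<forall>M. sampled_data f g e (feedback d (K j)) (x j M) (\<tau> j M) M) \<and>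
                    (\<exists>N0. rank_condition R d e (x j) (\<tau> j) N0 \<and> N j \<ge> N0)) \<and>
        (\<forall>j\<in>{1..<i}. optimal_solution \<Omega> q R r d e (feedback d (K j))
                        (x j (N j)) (\<tau> j (N j)) (N j) (p (j - 1)) (p j) (K (j + 1)))
      \<longrightarrow> feasible_set q R r d e (feedback d (K i))
             (x i (N i)) (\<tau> i (N i)) (N i) (p (i - 1)) \<noteq> {})
   \<and> ((\<forall>i\<ge>1.
         (\<forall>M. sampled_data f g e (feedback d (K i)) (x i M) (\<tau> i M) M) \<and>
         (\<exists>N0. rank_condition R d e (x i) (\<tau> i) N0 \<and> N i \<ge> N0) \<and>
         optimal_solution \<Omega> q R r d e (feedback d (K i))
           (x i (N i)) (\<tau> i (N i)) (N i) (p (i - 1)) (p i) (K (i + 1)))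
      \<longrightarrow>
        (\<forall>i\<ge>1. globally_asymptotically_stable (\<lambda>y. f y + g y *v feedback d (K i) y))
      \<and> (\<forall>i\<ge>1. (value_poly r (p i) :: real^'n::_ \<Rightarrow> real) \<in> class_P \<and>
           (\<forall>x0 :: real^'n::_. V\<^sub>o x0 \<le> value_poly r (p i) x0 \<and>
                            value_poly r (p i) x0 \<le> value_poly r (p (i - 1)) x0))
      \<and> (\<exists>Vstar :: real^'n::_ \<Rightarrow> real. Vstar \<in> poly_space 2 (2*r) \<inter> class_P \<and>
           (\<forall>x0. (\<lambda>i. value_poly r (p i) x0) \<longlonglongrightarrow> Vstar x0) \<and>
           (\<forall>x0 z. solution (\<lambda>y. f y + g y *v u\<^sub>o y) z \<and> z 0 = x0 \<longrightarrow>
              (\<exists>I. has_improper_integral (\<lambda>t. H_op f g q R Vstar (z t)) I \<and>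
                   0 \<le> Vstar x0 - V\<^sub>o x0 \<and> ereal (Vstar x0 - V\<^sub>o x0) \<le> - I))))"
proof -
  interpret polynomial_regulator f g q R r d
    by unfold_locales (use assms in auto)
  let ?V = "\<lambda>i. value_poly r (p i) :: real^'n::_ \<Rightarrow> real"
  let ?u = "\<lambda>i. feedback d (K i) :: real^'n::_ \<Rightarrow> real^'m::_"
  let ?data = "\<lambda>i. (\<forall>M. sampled_data f g e (?u i) (x i M) (\<tau> i M) M) \<and>
     (\<exists>N0. rank_condition R d e (x i) (\<tau> i) N0 \<and> N i \<ge> N0)"
  let ?opt = "\<lambda>i. optimal_solution \<Omega> q R r d e (?u i) (x i (N i)) (\<tau> i (N i)) (N i)
     (p (i - 1)) (p i) (K (i + 1))"
  have step: "p i \<in> carrier_vec (num_monomials2 CARD('n) (2*r))"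
    "K (Suc i) \<in> carrier_mat CARD('m) (num_monomials1 CARD('n) d)"
    "?u (Suc i) = greedy (?V i)" "SOS (LL (?V i) (?u i))" "SOS (LL (?V i) (?u (Suc i)))"
    "SOS (\<lambda>y :: real^'n::_. scalar_prod (p (i - 1) - p i) (monomials 2 (2*r) y))"
    if K: "K i \<in> carrier_mat CARD('m) (num_monomials1 CARD('n) d)" and data: "?data i" and opt: "?opt i" for i
  proof -
    obtain l where l: "(p i, K (Suc i), l) \<in>
        feasible_set q R r d e (?u i) (x i (N i)) (\<tau> i (N i)) (N i) (p (i - 1))"
      using opt by (auto simp: optimal_solution_def)
    have rank: "vec_space.rank (N i) (Phi R d e (x i (N i)) (\<tau> i (N i)) (N i)) =
        num_monomials2 CARD('n) (2*d) + CARD('m) * num_monomials1 CARD('n) d"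
      using data by (auto simp: rank_condition_def)
    have samp: "sampled_data f g e (?u i) (x i (N i)) (\<tau> i (N i)) (N i)" using data by blast
    note fs = feasible_solution[OF K samp noise rank l]
    show "p i \<in> carrier_vec (num_monomials2 CARD('n) (2*r))"
      "K (Suc i) \<in> carrier_mat CARD('m) (num_monomials1 CARD('n) d)"
      "?u (Suc i) = greedy (?V i)" "SOS (LL (?V i) (?u i))" "SOS (LL (?V i) (?u (Suc i)))"
      by (rule fs)+
    show "SOS (\<lambda>y :: real^'n::_. scalar_prod (p (i - 1) - p i) (monomials 2 (2*r) y))"
      using l by (auto simp: feasible_set_def)
  qed
  \<comment> \<open>Only the data and optimal choices before step \<open>i\<close> enter. Thus the
    fact serves the feasibility claim, where nothing has yet been chosen at step \<open>i\<close>,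
    as well as the convergence claim.\<close>
  have stage: "p (i - 1) \<in> carrier_vec (num_monomials2 CARD('n) (2*r)) \<and>
      K i \<in> carrier_mat CARD('m) (num_monomials1 CARD('n) d) \<and> SOS (LL (?V (i - 1)) (?u i))"
    if "i \<ge> 1" "\<And>j. j \<in> {1..<i} \<Longrightarrow> ?data j" "\<And>j. j \<in> {1..<i} \<Longrightarrow> ?opt j" for i
    using that
  proof (induction i rule: nat_induct_at_least)
    case base
    show ?case using A3 by simp
  next
    case (Suc i)
    then have "K i \<in> carrier_mat CARD('m) (num_monomials1 CARD('n) d)" "?data i" "?opt i"
      by simp_all
    from step(1,2,5)[OF this] show ?case by simp
  qed
  show ?thesis
  proof (intro conjI allI impI)
    fix i :: nat
    assume i: "1 \<le> i" and h: "(\<forall>j\<in>{1..i}. ?data j) \<and> (\<forall>j\<in>{1..<i}. ?opt j)"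
    have st: "p (i - 1) \<in> carrier_vec (num_monomials2 CARD('n) (2*r)) \<and>
      K i \<in> carrier_mat CARD('m) (num_monomials1 CARD('n) d) \<and> SOS (LL (?V (i - 1)) (?u i))"
      by (rule stage[OF i]) (use h in auto)
    have "sampled_data f g e (?u i) (x i (N i)) (\<tau> i (N i)) (N i)" using h i by auto
    then show "feasible_set q R r d e (?u i) (x i (N i)) (\<tau> i (N i)) (N i) (p (i - 1)) \<noteq> {}"
      using st by (intro feasible_set_nonempty noise) auto
  next
    assume h: "\<forall>i\<ge>1. (\<forall>M. sampled_data f g e (?u i) (x i M) (\<tau> i M) M) \<and>
         (\<exists>N0. rank_condition R d e (x i) (\<tau> i) N0 \<and> N i \<ge> N0) \<and> ?opt i"
    then have data: "?data i" and opt: "?opt i" if "i \<ge> 1" for i using that by blast+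
    have p_car: "p i \<in> carrier_vec (num_monomials2 CARD('n) (2*r))"
      and K_car: "K (Suc i) \<in> carrier_mat CARD('m) (num_monomials1 CARD('n) d)"
      and L_next: "SOS (LL (?V i) (?u (Suc i)))" for i
      using stage[of "Suc i"] data opt by simp_all
    have st: "?u (Suc i) = greedy (?V i)" "SOS (LL (?V i) (?u i))"
      "SOS (\<lambda>y :: real^'n::_. scalar_prod (p (i - 1) - p i) (monomials 2 (2*r) y))" if "i \<ge> 1" for i
    proof -
      have "K i \<in> carrier_mat CARD('m) (num_monomials1 CARD('n) d)" using K_car[of "i - 1"] that by simp
      from step(3,4,6)[OF this data[OF that] opt[OF that]]
      show "?u (Suc i) = greedy (?V i)" "SOS (LL (?V i) (?u i))"
        "SOS (\<lambda>y :: real^'n::_. scalar_prod (p (i - 1) - p i) (monomials 2 (2*r) y))" by blast+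
    qed
    have u_space: "(\<lambda>y. ?u (Suc i) y $ k) \<in> poly_space 1 d" for i k
      by (rule feedback_poly_space[OF K_car])
    have gas: "globally_asymptotically_stable (\<lambda>y. f y + g y *v ?u (Suc i) y)" if "?V i \<in> class_P" for i
      by (rule closed_loop_stable[OF that u_space SOS_nonneg[OF L_next]])
    have ge: "V\<^sub>o y \<le> ?V (Suc i) y" if "?V i \<in> class_P" for i y
    proof (rule optimal_value_le[OF A2(1) _ value_poly_space _ gas[OF that]])
      show "HH V\<^sub>o y = 0" for y using A2(2) by blast
      show "LL (?V (Suc i)) (?u (Suc i)) y \<ge> 0" for y by (rule SOS_nonneg[OF st(2)]) simp
    qed
    \<comment> \<open>\<open>ge\<close> presupposes that \<open>?V i\<close> lies in
      \<open>class_P\<close> and delivers the lower bound that puts \<open>?V (Suc i)\<close> there;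
      \<open>A3\<close> starts the chain.\<close>
    have P: "?V i \<in> class_P" for i
    proof (induction i)
      case 0
      show ?case using A3 by simp
    next
      case (Suc i)
      show ?case by (rule class_P_of_ge[OF A2(1) value_poly_space ge[OF Suc]])
    qed
    have le: "?V (Suc i) y \<le> ?V i y" for i y
    proof -
      have "scalar_prod (p i - p (Suc i)) (monomials 2 (2*r) y) \<ge> 0"
        using SOS_nonneg[OF st(3)[of "Suc i"]] by simp
      moreover have "monomials 2 (2*r) y \<in> carrier_vec (num_monomials2 CARD('n) (2*r))"
        using dim_monomials2[of "2*r" y] r_pos by (intro carrier_vecI) simp
      ultimately show ?thesis
        using minus_scalar_prod_distrib[OF p_car[of i] p_car[of "Suc i"]] by (simp add: value_poly_def)
    qed
    show "globally_asymptotically_stable (\<lambda>y. f y + g y *v ?u i y)" if "1 \<le> i" for i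
      using gas[OF P, of "i - 1"] that by simp
    show "?V i \<in> class_P" for i by (rule P)
    show "V\<^sub>o y \<le> ?V i y" if "1 \<le> i" for i y using ge[OF P, of y "i - 1"] that by simp
    show "?V i y \<le> ?V (i - 1) y" if "1 \<le> i" for i y using le[of "i - 1" y] that by simp
    have "\<exists>c. (\<lambda>i. ?V i y) \<longlonglongrightarrow> c" for y
    proof -
      have "decseq (\<lambda>i. ?V i y)" by (rule decseq_SucI) (rule le)
      \<comment> \<open>\<open>ge\<close> speaks about successors; monotonicity carries its bound
        back by one index and so reaches index 0.\<close>
      moreover have "V\<^sub>o y \<le> ?V i y" for i
        using ge[OF P, of y i] le[of i y] by linarith
      ultimately show ?thesis using decseq_convergent by blast
    qed
    then obtain W where W: "\<And>y. (\<lambda>i. ?V i y) \<longlonglongrightarrow> W y" by metis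
    have W_space: "W \<in> poly_space 2 (2*r)"
      by (rule poly_space_pointwise_limit(1)[OF value_poly_space W])
    have W_ge: "V\<^sub>o y \<le> W y" for y
      by (rule LIMSEQ_le_const[OF W]) (use ge[OF P] in \<open>auto intro!: exI[of _ 1] simp: Suc_le_eq gr0_conv_Suc\<close>)
    have W_P: "W \<in> class_P" by (rule class_P_of_ge[OF A2(1) W_space W_ge])
    have W_H: "HH W y \<le> 0" for y
    proof (rule LIMSEQ_le_const2)
      show "(\<lambda>i. HH (?V i) y) \<longlonglongrightarrow> HH W y"
        by (rule H_op_tendsto[OF poly_space_pointwise_limit(2)[OF value_poly_space W]])
      \<comment> \<open>From index 1 on, the next control is greedy for the current value function,
        which turns its SOS expression into minus \<open>HH\<close>. The first control is given, so
        index 0 is left out.\<close>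
      have "HH (?V i) y \<le> 0" if "i \<ge> 1" for i
        using SOS_nonneg[OF L_next[of i], of y] unfolding st(1)[OF that] L_op_greedy(2)[OF R_sym R_pd]
        by simp
      then show "\<exists>n. \<forall>i\<ge>n. HH (?V i) y \<le> 0" by blast
    qed
    have uo: "u\<^sub>o = greedy V\<^sub>o"
      by (simp add: u\<^sub>o greedy_control_def[abs_def])
    have A2': "HH V\<^sub>o y = 0" for y using A2(2) by blast
    show "\<exists>Vstar :: real^'n::_ \<Rightarrow> real. Vstar \<in> poly_space 2 (2*r) \<inter> class_P \<and>
           (\<forall>x0. (\<lambda>i. ?V i x0) \<longlonglongrightarrow> Vstar x0) \<and>
           (\<forall>x0 z. solution (\<lambda>y. f y + g y *v u\<^sub>o y) z \<and> z 0 = x0 \<longrightarrow>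
              (\<exists>I. has_improper_integral (\<lambda>t. HH Vstar (z t)) I \<and>
                   0 \<le> Vstar x0 - V\<^sub>o x0 \<and> ereal (Vstar x0 - V\<^sub>o x0) \<le> - I))"
    proof (intro exI[of _ W] conjI allI impI)
      fix x0 z assume z: "solution (\<lambda>y. f y + g y *v u\<^sub>o y) z \<and> z 0 = x0"
      then have "\<exists>I. has_improper_integral (\<lambda>t. HH W (z t)) I \<and> ereal (W (z 0) - V\<^sub>o (z 0)) \<le> - I"
        by (intro optimal_loop_bound[OF A2(1) A2' W_space W_H]) (simp add: uo)
      then show "\<exists>I. has_improper_integral (\<lambda>t. HH W (z t)) I \<and>
          0 \<le> W x0 - V\<^sub>o x0 \<and> ereal (W x0 - V\<^sub>o x0) \<le> - I"
        using z W_ge[of x0] by auto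
    qed (use W W_space W_P in auto)
  qed
qed

end
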